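(* Let $G$ be a graph with $\alpha(G)=2$ and $\mathrm{icr}(G)\ge \frac14+\frac{1}{62}$. Then every inflation $G'$ of $G$ with $\alpha(G')=2$ satisfies $\mathrm{had}(G')\ge\chi(G')$.
   Context: All graphs are finite and simple. An inflation of a graph $H$ is obtained by choosing integers $c_x\ge 0$ for $x\in V(H)$, replacing each $x$ by a clique $C_x$ of order $c_x$, and making every vertex of $C_x$ adjacent to every vertex of $C_y$ (for $x\ne y$) if $xy\in E(H)$, and no edges between $C_x$ and $C_y$ otherwise. The inflated clique ratio of a non-empty graph $G$ is $\mathrm{icr}(G)=\inf\{\omega(G')/|V(G')| : G' \text{ an inflation of } G \text{ with } |V(G')|>0\}$. $\mathrm{had}(G)$ is the largest $t$ such that $K_t$ is a minor of $G$. *)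

theory Defs
  imports
    Complex_Main
    "HOL-Library.Disjoint_Sets"
    "Graph_Theory.Graph_Theory"
begin

text \<open>
  Finite simple graphs are the library's \<^const>\<open>pair_graph\<close>s: finite, loop-free and
  symmetric, with an undirected edge represented by its two arcs.
\<close>

definition clique :: "'a pair_pre_digraph \<Rightarrow> 'a set \<Rightarrow> bool" where
  "clique G S \<longleftrightarrow> S \<subseteq> pverts G \<and> (\<forall>u\<in>S. \<forall>v\<in>S. u \<noteq> v \<longrightarrow> (u, v) \<in> parcs G)"

definition independent_vertices :: "'a pair_pre_digraph \<Rightarrow> 'a set \<Rightarrow> bool" where
  "independent_vertices G S \<longleftrightarrow> S \<subseteq> pverts G \<and> (\<forall>u\<in>S. \<forall>v\<in>S. (u, v) \<notin> parcs G)"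

definition clique_number :: "'a pair_pre_digraph \<Rightarrow> nat" where
  "clique_number G = Max {card S | S. clique G S}"

definition independence_number :: "'a pair_pre_digraph \<Rightarrow> nat" where
  "independence_number G = Max {card S | S. independent_vertices G S}"

definition proper_colouring :: "'a pair_pre_digraph \<Rightarrow> nat \<Rightarrow> ('a \<Rightarrow> nat) \<Rightarrow> bool" where
  "proper_colouring G k f \<longleftrightarrow>
     f ` pverts G \<subseteq> {..<k} \<and> (\<forall>(u, v)\<in>parcs G. f u \<noteq> f v)"

definition chromatic_number :: "'a pair_pre_digraph \<Rightarrow> nat" where
  "chromatic_number G = (LEAST k. \<exists>f. proper_colouring G k f)"

text \<open>
  \<open>B x\<close> is the branch set contracted to the vertex \<open>x\<close> of the minor \<open>H\<close>.  The library's
  \<^const>\<open>Digraph_Component.connected\<close> includes non-emptiness.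
\<close>

definition is_minor :: "'b pair_pre_digraph \<Rightarrow> 'a pair_pre_digraph \<Rightarrow> bool" where
  "is_minor H G \<longleftrightarrow> (\<exists>B.
     (\<forall>x\<in>pverts H. B x \<subseteq> pverts G \<and> Digraph_Component.connected (with_proj G \<restriction> B x)) \<and>
     disjoint_family_on B (pverts H) \<and>
     (\<forall>(x, y)\<in>parcs H. \<exists>u\<in>B x. \<exists>v\<in>B y. (u, v) \<in> parcs G))"

definition hadwiger_number :: "'a pair_pre_digraph \<Rightarrow> nat" where
  "hadwiger_number G =
     Max {t. \<exists>K :: nat pair_pre_digraph. complete_digraph t (with_proj K) \<and> is_minor K G}"

text \<open>
  \<open>C x\<close> is the clique replacing \<open>x\<close>; its order is an arbitrary natural number, possibly \<open>0\<close>.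
\<close>

definition is_inflation :: "'a pair_pre_digraph \<Rightarrow> 'b pair_pre_digraph \<Rightarrow> bool" where
  "is_inflation H G' \<longleftrightarrow> (\<exists>C.
     (\<forall>x\<in>pverts H. finite (C x)) \<and>
     disjoint_family_on C (pverts H) \<and>
     pverts G' = (\<Union>x\<in>pverts H. C x) \<and>
     parcs G' = {(u, v). \<exists>x\<in>pverts H. \<exists>y\<in>pverts H. u \<in> C x \<and> v \<in> C y \<and>
                   (x = y \<and> u \<noteq> v \<or> x \<noteq> y \<and> (x, y) \<in> parcs H)})"

text \<open>
  Every choice of clique orders is realised on the vertex type \<^typ>\<open>'a \<times> nat\<close>, so
  restricting the infimum to graphs on this type loses no inflation up to isomorphism
  (lemma \<open>inflation_exists\<close>).
\<close>

definition inflated_clique_ratio :: "'a pair_pre_digraph \<Rightarrow> real" where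
  "inflated_clique_ratio G =
     Inf {real (clique_number G') / real (card (pverts G')) |
            G' :: ('a \<times> nat) pair_pre_digraph. is_inflation G G' \<and> card (pverts G') > 0}"

lemma inflation_exists:
  fixes H :: "'a pair_pre_digraph" and c :: "'a \<Rightarrow> nat"
  shows "is_inflation H
    \<lparr> pverts = (SIGMA x:pverts H. {..<c x}),
      parcs = {((x, i), (y, j)). x \<in> pverts H \<and> y \<in> pverts H \<and> i < c x \<and> j < c y \<and>
                 (x = y \<and> i \<noteq> j \<or> x \<noteq> y \<and> (x, y) \<in> parcs H)} \<rparr>"
  unfolding is_inflation_def
  by (rule exI[of _ "\<lambda>x. {x} \<times> {..<c x}"]) (auto simp: disjoint_family_on_def)

lemma pair_graph_inflation:
  assumes "pair_graph H" and "is_inflation H G'"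
  shows "pair_graph G'"
proof -
  interpret pair_graph H by fact
  obtain C where C: "\<forall>x\<in>pverts H. finite (C x)" "disjoint_family_on C (pverts H)"
    "pverts G' = (\<Union>x\<in>pverts H. C x)"
    "parcs G' = {(u, v). \<exists>x\<in>pverts H. \<exists>y\<in>pverts H. u \<in> C x \<and> v \<in> C y \<and>
                   (x = y \<and> u \<noteq> v \<or> x \<noteq> y \<and> (x, y) \<in> parcs H)}"
    using assms(2) unfolding is_inflation_def by blast
  have fin: "finite (pverts G')"
    using C pair_finite_verts by simp
  have "parcs G' \<subseteq> pverts G' \<times> pverts G'"
    using C(3,4) by auto
  with fin have "finite (parcs G')"
    by (meson finite_SigmaI finite_subset)
  moreover have "sym (parcs G')"
    unfolding sym_def C(4) using arcs_symmetric by blast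
  moreover have "u \<noteq> v" if "(u, v) \<in> parcs G'" for u v
    using that C(2) unfolding C(4) disjoint_family_on_def by blast
  ultimately show ?thesis
    using fin \<open>parcs G' \<subseteq> _\<close> by unfold_locales (auto simp: symmetric_def)
qed

end

theory Submission
  imports Defs
begin

text \<open>
  Let \<open>H\<close> be the complement of \<open>G'\<close>; it is triangle-free. If \<open>M\<close> is a matching of \<open>H\<close> then
  \<open>G'\<close> has a colouring with \<open>|V| - |M|\<close> colours, so it suffices to find a complete minor of that
  order for some \<open>M\<close>. By induction one may assume that \<open>H\<close> is connected and that every vertex is
  missed by some maximum matching; by Gallai's lemma \<open>H\<close> is then factor-critical with, say, \<open>2m + 1\<close>
  vertices, and a \<open>K\<^bsub>m+1\<^esub>\<close> minor of \<open>G'\<close> is needed.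

  Every induced subgraph of \<open>G'\<close> is again an inflation of \<open>G\<close>. Together with a weak Ramsey bound for
  small orders, the clique ratio therefore gives a maximum clique \<open>Z\<close> with \<open>2|Z| \<ge> m + 2\<close>. As
  Chudnovsky and Seymour observed, an induced three-vertex path (a seagull) of a graph without
  stable sets of size three has a neighbour of every vertex outside it; so \<open>k = m + 1 - |Z|\<close>
  disjoint seagulls avoiding \<open>Z\<close> complete \<open>Z\<close> to a \<open>K\<^bsub>m+1\<^esub>\<close> model.

  To pack the seagulls, take a maximum packing with fewer than \<open>k\<close> members. What it leaves over is
  in \<open>H\<close> either edgeless or complete bipartite. In each case exchanges contradict one of three facts:
  \<open>H - Z\<close> has a matching of size \<open>k\<close>, its degrees are less than \<open>|Z|\<close>, and a complete bipartite
  subgraph of \<open>H\<close> on more than \<open>m\<close> vertices already yields a \<open>K\<^bsub>m+1\<^esub>\<close> minor of \<open>G'\<close>.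
\<close>

section \<open>Matchings\<close>

text \<open>With \<open>k = m + 1 - |Z|\<close> and \<open>s = 2|Z| - m - 2\<close>, exactly
  \<open>3k + s\<close> vertices lie outside \<open>Z\<close>. So \<open>2|Z| \<ge> m + 2\<close>
  says precisely that there is room for \<open>k\<close> disjoint seagulls. For large
  \<open>m\<close> this asks for a clique ratio of about \<open>1/4\<close>; the excess
  \<open>1/62\<close> absorbs the additive constant as soon as \<open>m \<ge> 8\<close>, and for
  smaller \<open>m\<close> the Ramsey bound takes over. Room alone is not enough: if
  \<open>H\<close> is a five-cycle with an isolated vertex, its six vertices do not contain two
  disjoint seagulls. This configuration satisfies the numerical bounds, so it has to be followed
  through the exchanges and excluded by a separate argument.\<close>

definition pair_matching :: "'a set set \<Rightarrow> bool" where
  "pair_matching M \<longleftrightarrow> finite M \<and> disjoint M \<and> (\<forall>e\<in>M. card e = 2)"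

lemma ex_not_in_list:
  assumes "length xs < card R"
  shows "\<exists>r\<in>R. r \<notin> set xs"
proof (rule ccontr)
  assume "\<not> ?thesis"
  then have "card R \<le> card (set xs)" by (intro card_mono) auto
  then show False using assms card_length[of xs] by linarith
qed

lemma card_2_obtain_other:
  assumes "card e = 2" "v \<in> e"
  obtains w where "e = {v, w}" "w \<noteq> v"
proof -
  obtain a b where "e = {a, b}" "a \<noteq> b" using assms(1) by (meson card_2_iff)
  then show ?thesis using assms(2) that[of a] that[of b] by (auto simp: insert_commute)
qed

lemma pair_matching_subset: "pair_matching M \<Longrightarrow> N \<subseteq> M \<Longrightarrow> pair_matching N"
  unfolding pair_matching_def by (meson finite_subset pairwise_subset subsetD)

lemma pair_matching_card_Union:
  assumes "pair_matching M"
  shows "card (\<Union>M) = 2 * card M"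
proof -
  have "card (\<Union>M) = sum card M"
    using assms unfolding pair_matching_def
    by (intro card_Union_disjoint) (auto simp: card_ge_0_finite)
  also have "\<dots> = 2 * card M"
    using assms unfolding pair_matching_def by simp
  finally show ?thesis .
qed

lemma pair_matching_finite_Union: "pair_matching M \<Longrightarrow> finite (\<Union>M)"
  unfolding pair_matching_def by (metis card.infinite finite_Union zero_neq_numeral)

lemma pair_matching_insert:
  assumes "pair_matching M" "card e = 2" "\<And>f. f \<in> M \<Longrightarrow> e \<inter> f = {}"
  shows "pair_matching (insert e M)"
  using assms unfolding pair_matching_def pairwise_insert disjnt_def by (auto simp: Int_commute)

lemma pair_matching_eqI: "pair_matching M \<Longrightarrow> e \<in> M \<Longrightarrow> f \<in> M \<Longrightarrow> x \<in> e \<Longrightarrow> x \<in> f \<Longrightarrow> e = f"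
  unfolding pair_matching_def pairwise_def disjnt_def by blast

text \<open>The \<open>M\<close>-edge \<open>e\<close> at \<open>v\<close> can meet only one edge of
  \<open>N\<close>, at its other end \<open>v1\<close>. Trading that edge for \<open>e\<close> keeps
  the size of \<open>N\<close>, and the discarded edge lies outside \<open>M\<close>, so the overlap
  with \<open>M\<close> grows. Repeating this takes the place of augmenting paths.\<close>

lemma pair_matching_improve:
  assumes M: "pair_matching M" and N: "pair_matching N" and card: "card M < card N"
    and v: "v \<in> \<Union>M" "v \<notin> \<Union>N"
  obtains N' where "N' \<subseteq> M \<union> N" "pair_matching N'" "card N' = card N"
    "card (M \<inter> N) < card (M \<inter> N')"
proof -
  have fin: "finite M" "finite N"
    using M N unfolding pair_matching_def by auto
  obtain e where e: "e \<in> M" "v \<in> e" using v by blast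
  have "e \<notin> N" using v e by blast
  obtain v1 where v1: "e = {v, v1}"
    using M e card_2_obtain_other unfolding pair_matching_def by metis
  obtain f where f: "f \<in> N" "f \<notin> M" "v1 \<in> \<Union>N \<longrightarrow> v1 \<in> f"
  proof (cases "v1 \<in> \<Union>N")
    case True
    then obtain f where "f \<in> N" "v1 \<in> f" by blast
    moreover have "f \<notin> M"
    proof
      assume "f \<in> M"
      then have "e = f"
        using pair_matching_eqI[OF M e(1), of f v1] \<open>v1 \<in> f\<close> v1 by simp
      then show False using \<open>f \<in> N\<close> \<open>e \<notin> N\<close> by simp
    qed
    ultimately show ?thesis by (intro that) auto
  next
    case False
    \<comment> \<open>Here \<open>e\<close> is disjoint from all of \<open>N\<close>; an edge of
      \<open>N\<close> outside \<open>M\<close> is dropped only to keep the size.\<close>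
    have "\<not> N \<subseteq> M" using card fin card_mono leD by blast
    then obtain f where "f \<in> N" "f \<notin> M" by blast
    then show ?thesis using that False by simp
  qed
  let ?N = "insert e (N - {f})"
  have "e \<inter> g = {}" if "g \<in> N - {f}" for g
    using that v f v1 pair_matching_eqI[OF N f(1), of g v1] by blast
  then have pm: "pair_matching ?N"
    using pair_matching_insert[OF pair_matching_subset[OF N]] M e(1)
    unfolding pair_matching_def by (metis Diff_subset)
  have "card ?N = card N"
    using fin f(1) \<open>e \<notin> N\<close> by (metis DiffD1 card_Suc_Diff1 card_insert_disjoint finite_Diff)
  moreover have "M \<inter> ?N = insert e (M \<inter> N)"
    using e f by blast
  ultimately show ?thesis
    using that[of ?N] pm e fin \<open>e \<notin> N\<close> by auto
qed

text \<open>Among the matchings of size \<open>|M| + 1\<close> inside \<open>M \<union> N\<close>,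
  one with greatest overlap with \<open>M\<close> covers \<open>\<Union>M\<close>, since a missed
  vertex would allow an improvement.\<close>

lemma pair_matching_extend:
  assumes M: "pair_matching M" and N: "pair_matching N" and card: "card M < card N"
  obtains N' where "N' \<subseteq> M \<union> N" "pair_matching N'" "card N' = Suc (card M)" "\<Union>M \<subseteq> \<Union>N'"
proof -
  obtain N0 where N0: "N0 \<subseteq> N" "card N0 = Suc (card M)"
    using card by (meson Suc_leI obtain_subset_with_card_n)
  define P where "P N' \<longleftrightarrow> N' \<subseteq> M \<union> N \<and> pair_matching N' \<and> card N' = Suc (card M)" for N'
  have "P N0"
    using N0 pair_matching_subset[OF N] unfolding P_def by blast
  moreover have "card (M \<inter> N') \<le> card M" for N'
    using M unfolding pair_matching_def by (simp add: card_mono)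
  ultimately obtain N1 where N1: "P N1" "\<And>N'. P N' \<Longrightarrow> card (M \<inter> N') \<le> card (M \<inter> N1)"
    using ex_has_greatest_nat[of P N0 "\<lambda>N'. card (M \<inter> N')" "Suc (card M)"]
    by (metis le_imp_less_Suc)
  have "\<Union>M \<subseteq> \<Union>N1"
  proof (rule ccontr)
    assume "\<not> \<Union>M \<subseteq> \<Union>N1"
    then obtain v where v: "v \<in> \<Union>M" "v \<notin> \<Union>N1" by blast
    obtain N' where "N' \<subseteq> M \<union> N1" "pair_matching N'" "card N' = card N1"
      "card (M \<inter> N1) < card (M \<inter> N')"
      using pair_matching_improve[OF M _ _ v] N1(1) unfolding P_def by auto
    moreover from this have "P N'"
      using N1(1) unfolding P_def by auto
    ultimately show False
      using N1(2) leD by blast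
  qed
  then show ?thesis using that N1(1) unfolding P_def by blast
qed

section \<open>Koenig's theorem for bipartite graphs\<close>

definition bipartite_edges :: "'a set \<Rightarrow> 'a set \<Rightarrow> 'a set set \<Rightarrow> bool" where
  "bipartite_edges X Y F \<longleftrightarrow> finite F \<and> X \<inter> Y = {} \<and> (\<forall>e\<in>F. \<exists>x\<in>X. \<exists>y\<in>Y. e = {x, y})"

lemma bipartite_edges_swap: "bipartite_edges X Y F \<Longrightarrow> bipartite_edges Y X F"
  unfolding bipartite_edges_def by (metis Int_commute insert_commute)

text \<open>
  Rizzi's argument: the covers of \<open>F - {e}\<close> and \<open>F - {e'}\<close> can be uncrossed into two covers of \<open>F\<close>,
  one of which is too small.
\<close>

lemma bipartite_critical_disjoint:
  assumes bip: "bipartite_edges X Y F"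
    and cov: "\<And>K. K \<subseteq> \<Union>F \<Longrightarrow> (\<And>e. e \<in> F \<Longrightarrow> e \<inter> K \<noteq> {}) \<Longrightarrow> n \<le> card K"
    and crit: "\<And>e. e \<in> F \<Longrightarrow>
      \<exists>K. K \<subseteq> \<Union>F \<and> (\<forall>f\<in>F - {e}. f \<inter> K \<noteq> {}) \<and> card K < n"
    and e: "e \<in> F" "e' \<in> F" "e \<noteq> e'" "x \<in> e" "x \<in> e'" "x \<in> X"
  shows False
proof -
  have XY: "X \<inter> Y = {}" and form: "\<And>e. e \<in> F \<Longrightarrow> \<exists>x\<in>X. \<exists>y\<in>Y. e = {x, y}"
    using bip unfolding bipartite_edges_def by auto
  have sub: "\<Union>F \<subseteq> X \<union> Y" using form by fastforce
  have fin: "finite (\<Union>F)"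
    using bip form unfolding bipartite_edges_def by (metis finite.emptyI finite.insertI finite_Union)
  obtain y where y: "e = {x, y}" "y \<in> Y" using form[OF e(1)] e XY by fastforce
  obtain y' where y': "e' = {x, y'}" "y' \<in> Y" using form[OF e(2)] e XY by fastforce
  obtain C where C: "C \<subseteq> \<Union>F" "\<forall>f\<in>F - {e}. f \<inter> C \<noteq> {}" "card C < n"
    using crit[OF e(1)] by blast
  obtain C' where C': "C' \<subseteq> \<Union>F" "\<forall>f\<in>F - {e'}. f \<inter> C' \<noteq> {}" "card C' < n"
    using crit[OF e(2)] by blast
  \<comment> \<open>If \<open>C\<close> met \<open>e\<close>, it would cover all of \<open>F\<close>
    with fewer than \<open>n\<close> vertices; likewise for \<open>C'\<close> and
    \<open>e'\<close>.\<close>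
  have miss: "C \<inter> e = {}" "C' \<inter> e' = {}"
  proof -
    show "C \<inter> e = {}"
    proof (rule ccontr)
      assume "C \<inter> e \<noteq> {}"
      then have "f \<inter> C \<noteq> {}" if "f \<in> F" for f using C(2) that by (cases "f = e") auto
      then show False using cov[OF C(1)] C(3) by simp
    qed
    show "C' \<inter> e' = {}"
    proof (rule ccontr)
      assume "C' \<inter> e' \<noteq> {}"
      then have "f \<inter> C' \<noteq> {}" if "f \<in> F" for f using C'(2) that by (cases "f = e'") auto
      then show False using cov[OF C'(1)] C'(3) by simp
    qed
  qed
  \<comment> \<open>The two covers are intersected on one side and united on the other.
    \<open>K1\<close> meets \<open>e\<close> and \<open>e'\<close> in \<open>y\<close> and
    \<open>y'\<close>, \<open>K2\<close> meets them in the added \<open>x\<close>, and any other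
    edge meets both \<open>C\<close> and \<open>C'\<close>. The sizes sum to at most
    \<open>2 (n - 1) + 1\<close>.\<close>
  define K1 where "K1 = (C \<inter> C' \<inter> X) \<union> ((C \<union> C') \<inter> Y)"
  define K2 where "K2 = insert x (((C \<union> C') \<inter> X) \<union> (C \<inter> C' \<inter> Y))"
  have finC: "finite C" "finite C'" using C(1) C'(1) fin by (auto intro: finite_subset)
  have dY: "y \<in> C'" "y' \<in> C"
  proof -
    have "e \<inter> C' \<noteq> {}" "e' \<inter> C \<noteq> {}" using C(2) C'(2) e(1-3) by auto
    then show "y \<in> C'" "y' \<in> C" using y y' miss by auto
  qed
  have "n \<le> card K1"
  proof (rule cov)
    show "K1 \<subseteq> \<Union>F" using C C' unfolding K1_def by blast
    fix f assume f: "f \<in> F"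
    obtain a b where ab: "f = {a, b}" "a \<in> X" "b \<in> Y" using form[OF f] by blast
    show "f \<inter> K1 \<noteq> {}"
    proof (cases "f = e \<or> f = e'")
      case True then show ?thesis using dY y y' unfolding K1_def by blast
    next
      case False
      then have "f \<inter> C \<noteq> {}" "f \<inter> C' \<noteq> {}" using C C' f by auto
      then show ?thesis using ab unfolding K1_def by blast
    qed
  qed
  moreover have "n \<le> card K2"
  proof (rule cov)
    show "K2 \<subseteq> \<Union>F" using C C' e unfolding K2_def by blast
    fix f assume f: "f \<in> F"
    obtain a b where ab: "f = {a, b}" "a \<in> X" "b \<in> Y" using form[OF f] by blast
    show "f \<inter> K2 \<noteq> {}"
    proof (cases "f = e \<or> f = e'")
      case True then show ?thesis using e unfolding K2_def by blast
    next
      case False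
      then have "f \<inter> C \<noteq> {}" "f \<inter> C' \<noteq> {}" using C C' f by auto
      then show ?thesis using ab unfolding K2_def by blast
    qed
  qed
  moreover have "card K1 + card K2 \<le> Suc (card C + card C')"
  proof -
    have a: "card (C \<inter> C' \<inter> X) + card ((C \<union> C') \<inter> X) = card (C \<inter> X) + card (C' \<inter> X)"
    proof -
      have "(C \<inter> X) \<inter> (C' \<inter> X) = C \<inter> C' \<inter> X" "(C \<inter> X) \<union> (C' \<inter> X) = (C \<union> C') \<inter> X" by auto
      then show ?thesis using card_Un_Int[of "C \<inter> X" "C' \<inter> X"] finC by simp
    qed
    have b: "card (C \<inter> C' \<inter> Y) + card ((C \<union> C') \<inter> Y) = card (C \<inter> Y) + card (C' \<inter> Y)"
    proof -
      have "(C \<inter> Y) \<inter> (C' \<inter> Y) = C \<inter> C' \<inter> Y" "(C \<inter> Y) \<union> (C' \<inter> Y) = (C \<union> C') \<inter> Y" by auto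
      then show ?thesis using card_Un_Int[of "C \<inter> Y" "C' \<inter> Y"] finC by simp
    qed
    have c: "card D = card (D \<inter> X) + card (D \<inter> Y)" if "D \<subseteq> \<Union>F" "finite D" for D
    proof -
      have "D = (D \<inter> X) \<union> (D \<inter> Y)" using that sub by blast
      moreover have "card ((D \<inter> X) \<union> (D \<inter> Y)) = card (D \<inter> X) + card (D \<inter> Y)"
        using that XY by (intro card_Un_disjoint) auto
      ultimately show ?thesis by simp
    qed
    have "card K1 \<le> card (C \<inter> C' \<inter> X) + card ((C \<union> C') \<inter> Y)"
      unfolding K1_def by (rule card_Un_le)
    moreover have "card K2 \<le> Suc (card ((C \<union> C') \<inter> X) + card (C \<inter> C' \<inter> Y))"
    proof -
      have "card K2 \<le> Suc (card (((C \<union> C') \<inter> X) \<union> (C \<inter> C' \<inter> Y)))"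
        unfolding K2_def using finC by (simp add: card_insert_if)
      also have "\<dots> \<le> Suc (card ((C \<union> C') \<inter> X) + card (C \<inter> C' \<inter> Y))"
        using card_Un_le by (simp add: card_Un_le)
      finally show ?thesis .
    qed
    ultimately show ?thesis
      using a b c[OF C(1) finC(1)] c[OF C'(1) finC(2)] by linarith
  qed
  ultimately show False using C(3) C'(3) by linarith
qed

text \<open>Edges are deleted as long as every cover still needs \<open>n\<close> vertices. When no
  deletion is possible, criticality makes \<open>F\<close> a matching, and one vertex from each edge
  is a cover. Covers are confined to the finite set \<open>\<Union>F\<close> because an infinite set
  has cardinality \<open>0\<close>.\<close>

lemma konig:
  assumes "bipartite_edges X Y F"
    and "\<And>K. K \<subseteq> \<Union>F \<Longrightarrow> (\<And>e. e \<in> F \<Longrightarrow> e \<inter> K \<noteq> {}) \<Longrightarrow> n \<le> card K"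
  obtains M where "M \<subseteq> F" "pair_matching M" "card M = n"
proof -
  have "finite F" using assms(1) unfolding bipartite_edges_def by blast
  then have "\<exists>M. M \<subseteq> F \<and> pair_matching M \<and> card M = n"
    using assms
  proof (induction F rule: finite_psubset_induct)
    case (psubset F)
    have form: "\<exists>x\<in>X. \<exists>y\<in>Y. e = {x, y}" if "e \<in> F" for e
      using that psubset.prems(1) unfolding bipartite_edges_def by blast
    have XY: "X \<inter> Y = {}" using psubset.prems(1) unfolding bipartite_edges_def by blast
    show ?case
    proof (cases "\<exists>e\<in>F. \<forall>K. K \<subseteq> \<Union>(F - {e}) \<longrightarrow> (\<forall>f\<in>F - {e}. f \<inter> K \<noteq> {}) \<longrightarrow> n \<le> card K")
      case True
      then obtain e where e: "e \<in> F"
        "\<forall>K. K \<subseteq> \<Union>(F - {e}) \<longrightarrow> (\<forall>f\<in>F - {e}. f \<inter> K \<noteq> {}) \<longrightarrow> n \<le> card K" by blast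
      have "bipartite_edges X Y (F - {e})"
        using psubset.prems(1) unfolding bipartite_edges_def by auto
      then have "\<exists>M. M \<subseteq> F - {e} \<and> pair_matching M \<and> card M = n"
        using psubset.IH[of "F - {e}"] e by (metis Diff_iff insertCI psubsetI Diff_subset)
      then show ?thesis by blast
    next
      case False
      have crit: "\<exists>K. K \<subseteq> \<Union>F \<and> (\<forall>f\<in>F - {e}. f \<inter> K \<noteq> {}) \<and> card K < n" if "e \<in> F" for e
        using that False by (meson Diff_subset Union_mono dual_order.trans not_le)
      have "disjoint F"
      proof (rule pairwiseI, rule ccontr)
        fix e e' assume ee: "e \<in> F" "e' \<in> F" "e \<noteq> e'" "\<not> disjnt e e'"
        then obtain x where x: "x \<in> e" "x \<in> e'" unfolding disjnt_def by blast
        have "x \<in> X \<or> x \<in> Y" using form[OF ee(1)] x by blast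
        then show False
        proof
          assume "x \<in> X"
          show False
            by (rule bipartite_critical_disjoint[OF psubset.prems(1,2) crit ee(1-3) x \<open>x \<in> X\<close>])
        next
          assume "x \<in> Y"
          show False
            by (rule bipartite_critical_disjoint[OF bipartite_edges_swap[OF psubset.prems(1)]
                  psubset.prems(2) crit ee(1-3) x \<open>x \<in> Y\<close>])
        qed
      qed
      moreover have "card e = 2" if "e \<in> F" for e
        using form[OF that] XY by (metis IntI card_2_iff empty_iff)
      ultimately have pm: "pair_matching F"
        using psubset.hyps unfolding pair_matching_def by blast
      define g where "g e = (SOME x. x \<in> e)" for e :: "'a set"
      have g: "g e \<in> e" if "e \<in> F" for e
        using form[OF that] unfolding g_def by (metis insertI1 someI)
      have "n \<le> card (g ` F)"
        using g by (intro psubset.prems(2)) auto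
      then have "n \<le> card F" using card_image_le[OF psubset.hyps] le_trans by blast
      then obtain M where "M \<subseteq> F" "card M = n" by (meson obtain_subset_with_card_n)
      then show ?thesis using pair_matching_subset[OF pm] by blast
    qed
  qed
  then show ?thesis using that by blast
qed

section \<open>Seagulls\<close>

text \<open>
  \<open>E\<close> is adjacency in the complement \<open>H\<close>. Thus a set is a clique of the graph iff it is \<open>indep\<close>, and
  a \<open>gull {u, w, v}\<close> is the induced path \<open>u - v - w\<close> of the graph.
\<close>

locale triangle_free =
  fixes E :: "'a \<Rightarrow> 'a \<Rightarrow> bool"
  assumes sym: "E x y \<Longrightarrow> E y x"
    and irrefl: "\<not> E x x"
    and no_triangle: "E x y \<Longrightarrow> E y z \<Longrightarrow> \<not> E x z"
begin

lemma sym_iff: "E x y \<longleftrightarrow> E y x"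
  using sym by blast

definition indep :: "'a set \<Rightarrow> bool" where
  "indep S \<longleftrightarrow> (\<forall>x\<in>S. \<forall>y\<in>S. \<not> E x y)"

definition edges :: "'a set \<Rightarrow> 'a set set" where
  "edges U = {{x, y} | x y. x \<in> U \<and> y \<in> U \<and> E x y}"

definition gull :: "'a set \<Rightarrow> bool" where
  "gull T \<longleftrightarrow> (\<exists>u w v. T = {u, w, v} \<and> E u w \<and> \<not> E u v \<and> \<not> E w v)"

definition packing :: "'a set \<Rightarrow> 'a set set \<Rightarrow> bool" where
  "packing V S \<longleftrightarrow> disjoint S \<and> (\<forall>T\<in>S. gull T \<and> T \<subseteq> V)"

lemma gullI: "E u w \<Longrightarrow> \<not> E u v \<Longrightarrow> \<not> E w v \<Longrightarrow> gull {u, w, v}"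
  unfolding gull_def by blast

lemma card_gull: "gull T \<Longrightarrow> card T = 3"
  unfolding gull_def using sym irrefl by (metis card_3_iff)

lemma gull_nonempty: "gull T \<Longrightarrow> T \<noteq> {}"
  unfolding gull_def by blast

lemma edges_gull: "E u w \<Longrightarrow> \<not> E u v \<Longrightarrow> \<not> E w v \<Longrightarrow> edges {u, w, v} = {{u, w}}"
  unfolding edges_def using irrefl sym by auto

lemma edges_mono: "U \<subseteq> W \<Longrightarrow> edges U \<subseteq> edges W"
  unfolding edges_def by blast

lemma card_edge: "e \<in> edges U \<Longrightarrow> card e = 2"
  unfolding edges_def using irrefl by (force simp: card_2_iff)

lemma edge_subset: "e \<in> edges U \<Longrightarrow> e \<subseteq> U"
  unfolding edges_def by auto

lemma finite_edges: "finite U \<Longrightarrow> finite (edges U)"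
  using edge_subset by (meson Pow_iff finite_Pow_iff finite_subset subsetI)

lemma edge_mem: "{x, y} \<in> edges U \<longleftrightarrow> x \<in> U \<and> y \<in> U \<and> E x y"
  unfolding edges_def using sym by (auto simp: doubleton_eq_iff)

lemma packing_finite: "finite V \<Longrightarrow> packing V S \<Longrightarrow> finite S"
  unfolding packing_def by (meson Pow_iff finite_Pow_iff finite_subset subsetI)

lemma packing_card_Union:
  assumes "packing V S"
  shows "card (\<Union>S) = 3 * card S"
proof -
  have "card (\<Union>S) = sum card S"
    using assms card_gull unfolding packing_def
    by (intro card_Union_disjoint) (auto simp: card_ge_0_finite)
  then show ?thesis using assms card_gull unfolding packing_def by simp
qed

lemma packing_empty: "packing V {}"
  unfolding packing_def by simp

lemma packing_disjoint: "packing V S \<Longrightarrow> T \<in> S \<Longrightarrow> T' \<in> S \<Longrightarrow> x \<in> T \<Longrightarrow> x \<in> T' \<Longrightarrow> T = T'"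
  unfolding packing_def pairwise_def disjnt_def by blast

lemma packingI:
  assumes "\<And>T. T \<in> S \<Longrightarrow> gull T" "\<And>T. T \<in> S \<Longrightarrow> T \<subseteq> V"
    "\<And>T T' x. T \<in> S \<Longrightarrow> T' \<in> S \<Longrightarrow> x \<in> T \<Longrightarrow> x \<in> T' \<Longrightarrow> T = T'"
  shows "packing V S"
  using assms unfolding packing_def pairwise_def disjnt_def by blast

text \<open>The gulls of \<open>Y\<close> live in the room provided by \<open>X\<close> and the
  uncovered vertices. Gulls are nonempty, so \<open>Y\<close> has no member in common with
  \<open>S - X\<close> and the cardinalities add.\<close>

lemma packing_exchange:
  assumes "finite V" and S: "packing V S" and X: "X \<subseteq> S"
    and Y: "packing (\<Union>X \<union> (V - \<Union>S)) Y"
  shows "packing V (S - X \<union> Y)" "card (S - X \<union> Y) = card S - card X + card Y"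
    "V - \<Union>(S - X \<union> Y) = (\<Union>X \<union> (V - \<Union>S)) - \<Union>Y"
proof -
  have dj: "T \<inter> G = {}" if "T \<in> S - X" "G \<in> Y" for T G
  proof -
    have "T \<inter> T' = {}" if "T' \<in> X" for T'
      using packing_disjoint[OF S, of T T'] X \<open>T \<in> S - X\<close> that by auto
    moreover have "G \<subseteq> \<Union>X \<union> (V - \<Union>S)" using Y that unfolding packing_def by blast
    ultimately show ?thesis using \<open>T \<in> S - X\<close> by blast
  qed
  have XV: "\<Union>X \<subseteq> V" using S X unfolding packing_def by blast
  have YV: "G \<subseteq> V" if "G \<in> Y" for G
    using Y XV that unfolding packing_def by blast
  show "packing V (S - X \<union> Y)"
  proof (rule packingI)
    fix T assume "T \<in> S - X \<union> Y"
    then show "gull T" "T \<subseteq> V"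
      using S Y YV unfolding packing_def by auto
  next
    fix T T' x assume T: "T \<in> S - X \<union> Y" "T' \<in> S - X \<union> Y" "x \<in> T" "x \<in> T'"
    consider "T \<in> S" "T' \<in> S" | "T \<in> Y" "T' \<in> Y" | "T \<in> S - X" "T' \<in> Y" | "T \<in> Y" "T' \<in> S - X"
      using T(1,2) by auto
    then show "T = T'"
    proof cases
      case 1 then show ?thesis using packing_disjoint[OF S] T(3,4) by simp
    next
      case 2 then show ?thesis using packing_disjoint[OF Y] T(3,4) by simp
    next
      case 3 then show ?thesis using dj[of T T'] T(3,4) by auto
    next
      case 4 then show ?thesis using dj[of T' T] T(3,4) by auto
    qed
  qed
  have fin: "finite S" "finite X" "finite Y"
    using packing_finite[OF assms(1) S] X packing_finite[OF _ Y] assms(1) XV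
    by (auto intro: finite_subset)
  have "(S - X) \<inter> Y = {}"
  proof (rule ccontr)
    assume "(S - X) \<inter> Y \<noteq> {}"
    then obtain T where "T \<in> S - X" "T \<in> Y" by blast
    then show False using dj[of T T] gull_nonempty Y unfolding packing_def by auto
  qed
  then show "card (S - X \<union> Y) = card S - card X + card Y"
    using fin X by (simp add: card_Un_disjoint card_Diff_subset)
  show "V - \<Union>(S - X \<union> Y) = (\<Union>X \<union> (V - \<Union>S)) - \<Union>Y"
  proof -
    have "\<Union>(S - X) \<inter> \<Union>X = {}"
    proof (rule ccontr)
      assume "\<Union>(S - X) \<inter> \<Union>X \<noteq> {}"
      then obtain x T T' where "T \<in> S - X" "T' \<in> X" "x \<in> T" "x \<in> T'" by blast
      then show False using packing_disjoint[OF S, of T T' x] X by auto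
    qed
    then show ?thesis using XV X by auto
  qed
qed

text \<open>Each gull inside \<open>{u, w, v} \<union> R\<close> makes the vertices it omits
  pairwise nonadjacent. If \<open>v\<close> had a neighbour \<open>r0\<close> in \<open>R\<close>, a
  non-neighbour \<open>r\<close> would give the gull \<open>{v, r0, r}\<close>, which omits the edge
  \<open>u w\<close>; so \<open>v\<close> would be adjacent to all of \<open>R\<close>, and then
  three elements of \<open>R\<close> cannot be shared out between \<open>u\<close> and
  \<open>w\<close>. If \<open>u\<close> and \<open>w\<close> had neighbours \<open>r1\<close> and
  \<open>r2\<close>, the gull \<open>{w, r2, r1}\<close> would separate \<open>u\<close> from a
  third \<open>r3\<close>, and \<open>{u, r1, r3}\<close> would omit the edge
  \<open>w r2\<close>.\<close>

lemma independent_leftover_shape: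
  assumes T: "E u w" "\<not> E u v" "\<not> E w v"
    and R: "indep R" "card R \<ge> 3" "R \<inter> {u, w, v} = {}"
    and left: "\<And>G. gull G \<Longrightarrow> G \<subseteq> {u, w, v} \<union> R \<Longrightarrow> indep (({u, w, v} \<union> R) - G)"
  shows "(\<forall>r\<in>R. \<not> E v r) \<and> ((\<forall>r\<in>R. \<not> E w r) \<or> (\<forall>r\<in>R. \<not> E u r))"
proof -
  have Rind: "\<not> E r r'" if "r \<in> R" "r' \<in> R" for r r'
    using that R(1) unfolding indep_def by blast
  have L: "\<not> E x y" if "E a b" "\<not> E a c" "\<not> E b c" "{a, b, c} \<subseteq> {u, w, v} \<union> R"
    "x \<in> {u, w, v} \<union> R" "y \<in> {u, w, v} \<union> R" "x \<notin> {a, b, c}" "y \<notin> {a, b, c}" for a b c x y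
    using left[OF gullI[OF that(1-3)] that(4)] that(5-8) unfolding indep_def by blast
  have neq: "u \<notin> R" "w \<notin> R" "v \<notin> R" "u \<noteq> v" "w \<noteq> v" "u \<noteq> w"
    using R(3) T sym irrefl by blast+
  have three: "\<exists>r\<in>R. r \<noteq> a \<and> r \<noteq> b" for a b
    using ex_not_in_list[of "[a, b]" R] R(2) by simp
  have v: "\<forall>r\<in>R. \<not> E v r"
  proof (rule ccontr)
    assume "\<not> (\<forall>r\<in>R. \<not> E v r)"
    then obtain r0 where r0: "r0 \<in> R" "E v r0" by blast
    have full: "E v r" if "r \<in> R" for r
    proof (rule ccontr)
      assume "\<not> E v r"
      then show False
        using L[of v r0 r u w] r0 that Rind neq T by auto
    qed
    have uw: "E u r \<or> E w r" if "r \<in> R" for r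
    proof (rule ccontr)
      assume a: "\<not> (E u r \<or> E w r)"
      obtain r' where "r' \<in> R" "r' \<noteq> r" using three by blast
      then show False using L[of u w r v r'] full a T that neq by auto
    qed
    have u: "\<not> E u r'" if "r \<in> R" "r' \<in> R" "r \<noteq> r'" "\<not> E w r" for r r'
      using L[of v r w u r'] full that T sym neq by (auto simp: sym_iff)
    have w: "\<not> E w r'" if "r \<in> R" "r' \<in> R" "r \<noteq> r'" "\<not> E u r" for r r'
      using L[of v r u w r'] full that T sym neq by (auto simp: sym_iff)
    obtain r1 r2 where "r1 \<in> R" "r2 \<in> R" "r1 \<noteq> r0" "r2 \<noteq> r0" "r1 \<noteq> r2"
      using three by metis
    moreover have "\<not> (E u r1 \<and> E w r1)" using T no_triangle by blast
    ultimately show False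
      using u[of r1 r0] u[of r1 r2] w[of r2 r0] w[of r1 r0] w[of r1 r2] u[of r2 r0]
        uw[of r0] uw[of r1] uw[of r2] r0 by auto
  qed
  moreover have "(\<forall>r\<in>R. \<not> E w r) \<or> (\<forall>r\<in>R. \<not> E u r)"
  proof (rule ccontr)
    assume "\<not> ?thesis"
    then obtain r1 r2 where r: "r1 \<in> R" "r2 \<in> R" "E u r1" "E w r2" by blast
    have "\<not> E u r2" "\<not> E w r1" using r T no_triangle sym by blast+
    then have "r1 \<noteq> r2" using r by blast
    obtain r3 where r3: "r3 \<in> R" "r3 \<noteq> r1" "r3 \<noteq> r2" using three by blast
    have "\<not> E u r3"
      using L[of w r2 r1 u r3] r r3 \<open>\<not> E w r1\<close> \<open>r1 \<noteq> r2\<close> Rind neq by auto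
    then show False
      using L[of u r1 r3 w r2] r r3 \<open>r1 \<noteq> r2\<close> Rind neq by auto
  qed
  ultimately show ?thesis by blast
qed

end

text \<open>
  The situation to be refuted: \<open>t < k\<close> is the largest number of disjoint gulls in \<open>V\<close>. In the
  application \<open>V\<close> is the complement of a maximum clique of size \<open>k + s + 1\<close>.
\<close>

locale gull_deficit = triangle_free E for E :: "'a \<Rightarrow> 'a \<Rightarrow> bool" +
  fixes V :: "'a set" and k s t :: nat
  assumes finV: "finite V"
    and card_V: "card V = 3 * k + s"
    and t_less: "t < k"
    and attained: "\<exists>S. packing V S \<and> card S = t"
    and maximal: "packing V S \<Longrightarrow> card S \<le> t"
    and degree: "x \<in> V \<Longrightarrow> card {y \<in> V. E x y} \<le> k + s"
    and biclique: "\<And>A B. A \<subseteq> V \<Longrightarrow> B \<subseteq> V \<Longrightarrow> A \<noteq> {} \<Longrightarrow> B \<noteq> {} \<Longrightarrow>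
      (\<And>a b. a \<in> A \<Longrightarrow> b \<in> B \<Longrightarrow> E a b) \<Longrightarrow> card A + card B \<le> 2 * k + s"
    and no_five_cycle: "\<And>c p q r s'. k = 2 \<Longrightarrow> s = 0 \<Longrightarrow> {c, p, q, r, s'} \<subseteq> V \<Longrightarrow>
      E c p \<Longrightarrow> E p q \<Longrightarrow> E q r \<Longrightarrow> E r s' \<Longrightarrow> E s' c \<Longrightarrow> False"
begin

definition max_packing :: "'a set set \<Rightarrow> bool" where
  "max_packing S \<longleftrightarrow> packing V S \<and> card S = t"

definition leftover :: "'a set set \<Rightarrow> 'a set" where
  "leftover S = V - \<Union>S"

text \<open>A gull contains exactly one \<open>E\<close>-edge, so for a maximum packing this is a
  matching with \<open>t\<close> edges.\<close>

definition core :: "'a set set \<Rightarrow> 'a set set" where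
  "core S = (\<Union>T\<in>S. edges T)"

lemma max_packing_gull: "max_packing S \<Longrightarrow> T \<in> S \<Longrightarrow> gull T"
  and max_packing_subset: "max_packing S \<Longrightarrow> T \<in> S \<Longrightarrow> T \<subseteq> V"
  and max_packing_finite: "max_packing S \<Longrightarrow> finite S"
  using packing_finite[OF finV] unfolding max_packing_def packing_def by auto

lemma max_packing_disjoint: "max_packing S \<Longrightarrow> T \<in> S \<Longrightarrow> T' \<in> S \<Longrightarrow> x \<in> T \<Longrightarrow> x \<in> T' \<Longrightarrow> T = T'"
  unfolding max_packing_def packing_def pairwise_def disjnt_def by blast

lemma leftover_disjoint: "T \<in> S \<Longrightarrow> x \<in> T \<Longrightarrow> x \<notin> leftover S"
  unfolding leftover_def by blast

lemma finite_leftover: "finite (leftover S)"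
  using finV unfolding leftover_def by simp

lemma card_leftover: "max_packing S \<Longrightarrow> card (leftover S) = 3 * (k - t) + s"
proof -
  assume S: "max_packing S"
  have "\<Union>S \<subseteq> V" using max_packing_subset[OF S] by blast
  then have "card (leftover S) = card V - card (\<Union>S)"
    unfolding leftover_def using finV by (simp add: card_Diff_subset finite_subset)
  also have "card (\<Union>S) = 3 * t"
    using S packing_card_Union unfolding max_packing_def by blast
  finally show ?thesis using card_V t_less by simp
qed

lemma card_leftover_ge: "max_packing S \<Longrightarrow> 3 \<le> card (leftover S)"
  using card_leftover t_less by simp

lemma exchange_le:
  assumes "max_packing S" "X \<subseteq> S" "packing (\<Union>X \<union> leftover S) Y"
  shows "card Y \<le> card X"
proof -
  have "packing V S" "card S = t" using assms(1) unfolding max_packing_def by auto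
  then have "card S - card X + card Y \<le> t"
    using packing_exchange(1,2)[OF finV, of S X Y] maximal assms(2,3) unfolding leftover_def by metis
  moreover have "card X \<le> card S"
    using assms(1,2) max_packing_finite card_mono by blast
  ultimately show ?thesis using \<open>card S = t\<close> by linarith
qed

lemma no_two_gulls:
  assumes "max_packing S" "T \<in> S" "gull G" "gull G'" "G \<inter> G' = {}" "G \<union> G' \<subseteq> T \<union> leftover S"
  shows False
proof -
  have "G \<noteq> G'" using assms(3,5) gull_nonempty by blast
  moreover have "packing (\<Union>{T} \<union> leftover S) {G, G'}"
    using assms unfolding packing_def by (auto simp: pairwise_insert disjnt_def)
  ultimately show False using exchange_le[of S "{T}" "{G, G'}"] assms(1,2) by simp
qed

lemma swap:
  assumes "max_packing S" "T \<in> S" "gull G" "G \<subseteq> T \<union> leftover S"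
  shows "max_packing (insert G (S - {T}))" "leftover (insert G (S - {T})) = (T \<union> leftover S) - G"
    "core (insert G (S - {T})) = (core S - edges T) \<union> edges G"
proof -
  have P: "packing V S" "card S = t" using assms(1) unfolding max_packing_def by auto
  have Y: "packing (\<Union>{T} \<union> (V - \<Union>S)) {G}"
    using assms unfolding packing_def leftover_def by simp
  have eq: "S - {T} \<union> {G} = insert G (S - {T})" by simp
  have "card S \<ge> 1" using assms(2) max_packing_finite[OF assms(1)] by (metis One_nat_def Suc_leI card_gt_0_iff empty_iff)
  then show "max_packing (insert G (S - {T}))"
    using packing_exchange(1,2)[OF finV P(1) _ Y] assms(2) P(2) unfolding max_packing_def eq by simp
  show "leftover (insert G (S - {T})) = (T \<union> leftover S) - G"
    using packing_exchange(3)[OF finV P(1) _ Y] assms(2) unfolding leftover_def eq by simp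
  have "edges T' \<inter> edges T = {}" if "T' \<in> S" "T' \<noteq> T" for T'
  proof (rule ccontr)
    assume "edges T' \<inter> edges T \<noteq> {}"
    then obtain x y where "x \<in> T'" "x \<in> T" unfolding edges_def by (auto simp: doubleton_eq_iff)
    then show False using max_packing_disjoint[OF assms(1) that(1) assms(2)] that(2) by blast
  qed
  then show "core (insert G (S - {T})) = (core S - edges T) \<union> edges G"
    using assms(2) unfolding core_def by auto
qed

lemma core_matching:
  assumes "max_packing S"
  shows "pair_matching (core S)" "card (core S) = t" "\<Union>(core S) \<subseteq> \<Union>S"
proof -
  have one: "\<exists>e. edges T = {e} \<and> card e = 2 \<and> e \<subseteq> T" if T: "T \<in> S" for T
  proof -
    obtain u w v where "T = {u, w, v}" "E u w" "\<not> E u v" "\<not> E w v"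
      using max_packing_gull[OF assms T] unfolding gull_def by blast
    then show ?thesis using edges_gull card_edge edge_subset by (metis singletonI)
  qed
  then obtain e where e: "\<And>T. T \<in> S \<Longrightarrow> edges T = {e T} \<and> card (e T) = 2 \<and> e T \<subseteq> T"
    by metis
  have core: "core S = e ` S" unfolding core_def using e by auto
  have "inj_on e S"
  proof (rule inj_onI)
    fix T T' assume T: "T \<in> S" "T' \<in> S" "e T = e T'"
    obtain x where x: "x \<in> e T" using e[OF T(1)] by (metis all_not_in_conv card.empty zero_neq_numeral)
    then have "x \<in> T" "x \<in> T'" using e[OF T(1)] e[OF T(2)] T(3) by auto
    then show "T = T'" using max_packing_disjoint[OF assms T(1,2)] by simp
  qed
  then show "card (core S) = t" using core assms card_image unfolding max_packing_def by metis
  have "disjoint (e ` S)"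
  proof (rule pairwiseI)
    fix a b assume "a \<in> e ` S" "b \<in> e ` S" "a \<noteq> b"
    then obtain T T' where "T \<in> S" "a = e T" "T' \<in> S" "b = e T'" "T \<noteq> T'" by blast
    then show "disjnt a b"
      unfolding disjnt_def using e[of T] e[of T'] max_packing_disjoint[OF assms, of T T'] by blast
  qed
  then show "pair_matching (core S)"
    unfolding pair_matching_def core using max_packing_finite[OF assms] e by auto
  show "\<Union>(core S) \<subseteq> \<Union>S" unfolding core using e by blast
qed

text \<open>Swapping \<open>T\<close> for any gull inside \<open>T \<union> leftover S\<close> gives
  another maximum packing, whose leftover is again independent. At most one vertex of
  \<open>T\<close> then has neighbours in the leftover; by the symmetry of \<open>u\<close> and
  \<open>w\<close> it may be called \<open>u\<close>.\<close>

lemma leftover_shape: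
  assumes S: "max_packing S" "T \<in> S" and ind: "\<And>S. max_packing S \<Longrightarrow> indep (leftover S)"
  obtains u w v where "T = {u, w, v}" "E u w" "\<not> E u v" "\<not> E w v"
    "\<And>r. r \<in> leftover S \<Longrightarrow> \<not> E v r" "\<And>r. r \<in> leftover S \<Longrightarrow> \<not> E w r"
proof -
  obtain u w v where T: "T = {u, w, v}" "E u w" "\<not> E u v" "\<not> E w v"
    using max_packing_gull[OF S] unfolding gull_def by blast
  have "indep (({u, w, v} \<union> leftover S) - G)" if "gull G" "G \<subseteq> {u, w, v} \<union> leftover S" for G
    using swap[OF S that(1)] that(2) ind T(1) by metis
  moreover have "leftover S \<inter> {u, w, v} = {}" using leftover_disjoint[OF S(2)] T(1) by blast
  ultimately have "(\<forall>r\<in>leftover S. \<not> E v r) \<and> ((\<forall>r\<in>leftover S. \<not> E w r) \<or> (\<forall>r\<in>leftover S. \<not> E u r))"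
    using independent_leftover_shape[OF T(2-4)] ind[OF S(1)] card_leftover_ge[OF S(1)] by blast
  then consider "\<forall>r\<in>leftover S. \<not> E v r" "\<forall>r\<in>leftover S. \<not> E w r"
    | "\<forall>r\<in>leftover S. \<not> E v r" "\<forall>r\<in>leftover S. \<not> E u r" by blast
  then show ?thesis
  proof cases
    case 1 then show ?thesis using that[of u w v] T by blast
  next
    case 2
    have "T = {w, u, v}" using T by blast
    then show ?thesis using that[of w u v] T 2 sym by blast
  qed
qed

end

section \<open>Packings whose leftovers are all independent\<close>

context gull_deficit
begin

text \<open>
  If all leftovers were independent, choose a maximum packing and a matching \<open>N\<close> with \<open>t + 1\<close> edges
  having as many edges as possible in common with the edges inside the gulls. Then \<open>N\<close> covers the
  third vertex \<open>v\<close> of some gull \<open>{u, w, v}\<close>, but no exchange can bring \<open>v\<close> into the leftover; this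
  forces \<open>u\<close> to be adjacent to the whole leftover and to every gull, contradicting the degree bound.
\<close>

lemma exists_leftover_edge:
  assumes N0: "N0 \<subseteq> edges V" "pair_matching N0" "card N0 = Suc t"
  shows "\<exists>S. max_packing S \<and> \<not> indep (leftover S)"
proof (rule ccontr)
  assume "\<not> ?thesis"
  then have ind: "\<And>S. max_packing S \<Longrightarrow> indep (leftover S)" by blast
  define P where "P = (\<lambda>(S, N). max_packing S \<and> N \<subseteq> edges V \<and> pair_matching N \<and> card N = Suc t)"
  define f where "f = (\<lambda>(S, N). card (core S \<inter> N))"
  obtain S0 where "max_packing S0" using attained unfolding max_packing_def by blast
  then have "P (S0, N0)" unfolding P_def using N0 by simp
  moreover have "f y < Suc (Suc t)" if "P y" for y
  proof -
    obtain S N where y: "y = (S, N)" by force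
    have "card (core S \<inter> N) \<le> card N"
      using that card_mono[of N "core S \<inter> N"] unfolding P_def y pair_matching_def by auto
    then show ?thesis using that unfolding P_def f_def y by simp
  qed
  ultimately obtain y where y: "P y" "\<And>z. P z \<Longrightarrow> f z \<le> f y"
    using ex_has_greatest_nat[of P "(S0, N0)" f "Suc (Suc t)"] by metis
  obtain S N where SN: "y = (S, N)" by force
  \<comment> \<open>All pairs as good as the chosen one stay in play, because the exchanges below
    lead from one optimal pair to another.\<close>
  define opt where "opt S' N' \<longleftrightarrow> P (S', N') \<and> f (S', N') \<ge> f (S, N)" for S' N'
  have opt: "opt S N" unfolding opt_def using y SN by simp
  have optD: "max_packing S'" "N' \<subseteq> edges V" "pair_matching N'" "card N' = Suc t" if "opt S' N'" for S' N'
    using that unfolding opt_def P_def by auto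
  have best: "card (core S'' \<inter> N'') \<le> card (core S' \<inter> N')"
    if "opt S' N'" "max_packing S''" "N'' \<subseteq> edges V" "pair_matching N''" "card N'' = Suc t" for S' N' S'' N''
    using that y(2)[of "(S'', N'')"] unfolding opt_def P_def f_def SN by auto
  have optI: "opt S'' N''" if "max_packing S''" "N'' \<subseteq> edges V" "pair_matching N''" "card N'' = Suc t"
    "card (core S \<inter> N) \<le> card (core S'' \<inter> N'')" for S'' N''
    using that unfolding opt_def P_def f_def by auto
  \<comment> \<open>A core vertex missed by \<open>N'\<close> would let
    \<open>pair_matching_improve\<close> raise the overlap.\<close>
  have covers: "\<Union>(core S') \<subseteq> \<Union>N'" if o: "opt S' N'" for S' N'
  proof (rule ccontr)
    note D = optD[OF o]
    assume "\<not> \<Union>(core S') \<subseteq> \<Union>N'"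
    then obtain v where v: "v \<in> \<Union>(core S')" "v \<notin> \<Union>N'" by blast
    obtain N'' where N'': "N'' \<subseteq> core S' \<union> N'" "pair_matching N''" "card N'' = card N'"
      "card (core S' \<inter> N') < card (core S' \<inter> N'')"
      using pair_matching_improve[OF core_matching(1)[OF D(1)] D(3) _ v] core_matching(2)[OF D(1)] D(4)
      by auto
    have "core S' \<subseteq> edges V"
      unfolding core_def using max_packing_subset[OF D(1)] edges_mono by blast
    then show False using best[OF o D(1) _ N''(2)] N'' D by auto
  qed
  \<comment> \<open>An edge of \<open>N'\<close> at a leftover vertex \<open>p\<close> must end in
    the vertex \<open>u\<close> of some gull \<open>{u, w, v}\<close>. Replacing \<open>w\<close> by
    \<open>p\<close> puts this edge into the core at the cost of \<open>{u, w}\<close>, which is not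
    in \<open>N'\<close>, so the overlap would grow.\<close>
  have avoids: "p \<notin> \<Union>N'" if o: "opt S' N'" and p: "p \<in> leftover S'" for S' N' p
  proof
    note D = optD[OF o]
    assume "p \<in> \<Union>N'"
    then obtain e where e: "e \<in> N'" "p \<in> e" by blast
    then have "e \<in> edges V" using D by blast
    then obtain x where x: "e = {p, x}" "x \<in> V" "E p x"
      using e(2) sym unfolding edges_def by auto
    have "x \<notin> leftover S'" using ind[OF D(1)] p x unfolding indep_def by blast
    then obtain T where T: "T \<in> S'" "x \<in> T" using x unfolding leftover_def by blast
    obtain u w v where uwv: "T = {u, w, v}" "E u w" "\<not> E u v" "\<not> E w v"
      "\<And>r. r \<in> leftover S' \<Longrightarrow> \<not> E v r" "\<And>r. r \<in> leftover S' \<Longrightarrow> \<not> E w r"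
      using leftover_shape[OF D(1) T(1) ind] by blast
    have "x = u" using T(2) uwv p x(3) sym by blast
    then have pu: "E u p" "e = {u, p}" using x sym by auto
    have g: "gull {u, p, v}" using pu uwv p sym by (intro gullI) blast+
    have sub: "{u, p, v} \<subseteq> T \<union> leftover S'" using uwv(1) p by auto
    have c: "core (insert {u, p, v} (S' - {T})) = (core S' - {{u, w}}) \<union> {{u, p}}"
      using swap(3)[OF D(1) T(1) g sub] edges_gull[OF uwv(2-4)] edges_gull[of u p v] pu uwv p sym
      by (metis)
    have "p \<noteq> w" using leftover_disjoint[OF T(1)] p uwv(1) by blast
    have "{u, w} \<notin> N'"
    proof
      assume "{u, w} \<in> N'"
      then have "e = {u, w}" using pair_matching_eqI[OF D(3) e(1), of "{u, w}" u] pu by simp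
      then show False using pu(2) \<open>p \<noteq> w\<close> uwv(2) irrefl by (auto simp: doubleton_eq_iff)
    qed
    have "p \<notin> \<Union>S'" using p unfolding leftover_def by blast
    then have "{u, p} \<notin> core S'" using core_matching(3)[OF D(1)] by blast
    have "core (insert {u, p, v} (S' - {T})) \<inter> N' = insert {u, p} (core S' \<inter> N')"
      unfolding c using \<open>{u, w} \<notin> N'\<close> e(1) pu(2) by auto
    moreover have "finite (core S' \<inter> N')" using D(3) unfolding pair_matching_def by simp
    ultimately have "card (core (insert {u, p, v} (S' - {T})) \<inter> N') = Suc (card (core S' \<inter> N'))"
      using \<open>{u, p} \<notin> core S'\<close> by simp
    then show False using best[OF o swap(1)[OF D(1) T(1) g sub] D(2-4)] by simp
  qed
  note D = optD[OF opt]
  \<comment> \<open>\<open>N\<close> covers \<open>2t + 2\<close> vertices, the core only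
    \<open>2t\<close>.\<close>
  have "\<not> \<Union>N \<subseteq> \<Union>(core S)"
  proof
    assume "\<Union>N \<subseteq> \<Union>(core S)"
    then have "card (\<Union>N) \<le> card (\<Union>(core S))"
      using pair_matching_finite_Union[OF core_matching(1)[OF D(1)]] card_mono by blast
    then show False
      using pair_matching_card_Union[OF D(3)] pair_matching_card_Union[OF core_matching(1)[OF D(1)]]
        core_matching(2)[OF D(1)] D(4) by simp
  qed
  then obtain p where p: "p \<in> \<Union>N" "p \<notin> \<Union>(core S)" by blast
  have pV: "p \<in> V" using p(1) D(2) edge_subset by blast
  have "p \<notin> leftover S" using avoids[OF opt] p(1) by blast
  then obtain Tp where Tp: "Tp \<in> S" "p \<in> Tp" using pV unfolding leftover_def by blast
  obtain u w v where T0: "Tp = {u, w, v}" "E u w" "\<not> E u v" "\<not> E w v"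
      "\<And>r. r \<in> leftover S \<Longrightarrow> \<not> E v r" "\<And>r. r \<in> leftover S \<Longrightarrow> \<not> E w r"
    using leftover_shape[OF D(1) Tp(1) ind] by blast
  have uw_core: "{u, w} \<in> core S"
    using edges_gull[OF T0(2-4)] Tp(1) T0(1) unfolding core_def by blast
  then have "p = v" using p(2) Tp(2) T0(1) by blast
  \<comment> \<open>This is the forbidden outcome of an exchange: one core edge turns from
    \<open>{a, b}\<close> into \<open>{a, r}\<close> and \<open>v\<close> becomes leftover. If
    \<open>{a, b}\<close> is not in \<open>N\<close>, the overlap does not drop, but the new core
    contains \<open>r\<close>, against \<open>covers\<close>. If it is in \<open>N\<close>, turning
    it in \<open>N\<close> as well keeps the overlap, and \<open>N\<close> still covers the leftover
    vertex \<open>v\<close>, against \<open>avoids\<close>.\<close>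
  have step: False
    if "max_packing S'" "core S' = (core S - {{a, b}}) \<union> {{a, r}}" "{a, b} \<in> core S" "r \<in> leftover S"
      "v \<in> leftover S'" for S' a b r
  proof -
    have rN: "r \<notin> \<Union>N" using avoids[OF opt] that(4) by blast
    have rS: "{a, r} \<notin> core S" using that(4) core_matching(3)[OF D(1)] unfolding leftover_def by blast
    have fin: "finite (core S)" "finite N"
      using D(3) core_matching(1)[OF D(1)] unfolding pair_matching_def by auto
    show False
    proof (cases "{a, b} \<in> N")
      case False
      have "core S \<inter> N \<subseteq> core S' \<inter> N" using False that(2) by auto
      then have "card (core S \<inter> N) \<le> card (core S' \<inter> N)"
        using fin by (intro card_mono) auto
      then have "opt S' N" using optI[OF that(1) D(2-4)] by blast
      then show False using covers[of S' N] that(2) rN by auto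
    next
      case True
      let ?N = "insert {a, r} (N - {{a, b}})"
      have ar: "E a r" "a \<in> V" "r \<in> V"
      proof -
        have "{a, r} \<in> core S'" using that(2) by simp
        then have "{a, r} \<in> edges V"
          unfolding core_def using max_packing_subset[OF that(1)] edges_mono by blast
        then show "E a r" "a \<in> V" "r \<in> V" using edge_mem by auto
      qed
      have new: "{a, r} \<notin> N" using rN by blast
      have "pair_matching ?N"
      proof (rule pair_matching_insert)
        show "pair_matching (N - {{a, b}})" using pair_matching_subset[OF D(3)] by blast
        show "card {a, r} = 2" using ar irrefl by (metis card_2_iff)
        fix f assume "f \<in> N - {{a, b}}"
        then show "{a, r} \<inter> f = {}"
          using rN pair_matching_eqI[OF D(3) True, of f a] by auto
      qed
      moreover have "card ?N = Suc t"
        using new True fin D(4) by (simp add: card_Diff_singleton)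
      moreover have "?N \<subseteq> edges V" using D(2) ar edge_mem by auto
      moreover have "core S' \<inter> ?N = insert {a, r} (core S \<inter> N - {{a, b}})"
        using that(2) by auto
      moreover from this have "card (core S' \<inter> ?N) = card (core S \<inter> N)"
      proof -
        have "{a, r} \<notin> core S \<inter> N - {{a, b}}" using rS by blast
        moreover have "Suc (card (core S \<inter> N - {{a, b}})) = card (core S \<inter> N)"
          using fin that(3) True by (intro card_Suc_Diff1) auto
        ultimately show ?thesis
          using \<open>core S' \<inter> ?N = _\<close> fin by simp
      qed
      ultimately have "opt S' ?N" using optI[OF that(1)] by simp
      moreover have "v \<in> \<Union>?N"
      proof -
        have "v \<notin> {a, b}" using that(3) p(2) \<open>p = v\<close> by blast
        then show ?thesis using p(1) \<open>p = v\<close> by auto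
      qed
      ultimately show False using avoids that(5) by blast
    qed
  qed
  \<comment> \<open>Otherwise \<open>{u, w, r}\<close> could replace \<open>Tp\<close>, leaving the
    core unchanged and setting \<open>v\<close> free.\<close>
  have u_full: "E u r" if r: "r \<in> leftover S" for r
  proof (rule ccontr)
    assume "\<not> E u r"
    then have g: "gull {u, w, r}" and e: "edges {u, w, r} = {{u, w}}"
      using T0 r edges_gull by (auto intro: gullI)
    have sub: "{u, w, r} \<subseteq> Tp \<union> leftover S" using T0(1) r by auto
    note sw = swap[OF D(1) Tp(1) g sub]
    have "core (insert {u, w, r} (S - {Tp})) = core S"
      using sw(3) e edges_gull[OF T0(2-4)] T0(1) uw_core by auto
    then have "opt (insert {u, w, r} (S - {Tp})) N"
      using optI[OF sw(1) D(2-4)] by simp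
    moreover have "v \<in> leftover (insert {u, w, r} (S - {Tp}))"
      using sw(2) T0 r leftover_disjoint[OF Tp(1)] sym irrefl by auto
    ultimately show False using avoids p(1) \<open>p = v\<close> by blast
  qed
  have u_hits: "\<exists>y\<in>T. E u y" if T: "T \<in> S" for T
  proof (rule ccontr)
    assume no: "\<not> (\<exists>y\<in>T. E u y)"
    then have TTp: "T \<noteq> Tp" using T0 by auto
    obtain u' w' v' where T': "T = {u', w', v'}" "E u' w'" "\<not> E u' v'" "\<not> E w' v'"
      "\<And>r. r \<in> leftover S \<Longrightarrow> \<not> E v' r" "\<And>r. r \<in> leftover S \<Longrightarrow> \<not> E w' r"
      using leftover_shape[OF D(1) T ind] by blast
    have dj: "x \<notin> Tp" if "x \<in> T" for x using max_packing_disjoint[OF D(1) T Tp(1)] that TTp by blast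
    have nv: "v \<notin> leftover S" "w \<notin> leftover S" "u \<notin> leftover S" using leftover_disjoint[OF Tp(1)] T0(1) by auto
    have nv': "v' \<notin> leftover S" "w' \<notin> leftover S" "u' \<notin> leftover S" using leftover_disjoint[OF T] T'(1) by auto
    have neq: "v \<noteq> u" "v \<noteq> w" "u \<noteq> w" using T0 sym irrefl by blast+
    have neq': "v' \<noteq> u'" "v' \<noteq> w'" "u' \<noteq> w'" using T' sym irrefl by blast+
    have u'w': "{u', w'} \<in> core S"
      using edges_gull[OF T'(2-4)] T T'(1) unfolding core_def by blast
    show False
    \<comment> \<open>Both cases use two swaps that end with \<open>v\<close> in the leftover. If
      \<open>u'\<close> is adjacent to the whole leftover, \<open>{u', r, v'}\<close> frees
      \<open>w'\<close>, which then replaces \<open>v\<close> beside \<open>u\<close> and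
      \<open>w\<close>. Otherwise \<open>{u', w', r'}\<close> frees \<open>v'\<close>, which enables
      the gull \<open>{u, r, v'}\<close>.\<close>
    proof (cases "\<forall>r\<in>leftover S. E u' r")
      case True
      obtain r r2 where r: "r \<in> leftover S" "r2 \<in> leftover S" "r \<noteq> r2"
        using card_leftover_ge[OF D(1)] by (metis Suc_1 card_le_Suc0_iff_eq finite_leftover not_less_eq_eq numeral_3_eq_3 One_nat_def le_SucI)
      have g: "gull {u', r, v'}" and e: "edges {u', r, v'} = {{u', r}}"
      proof -
        have "E u' r" "\<not> E r v'" using True r(1) T'(5) sym by blast+
        then show "gull {u', r, v'}" "edges {u', r, v'} = {{u', r}}"
          using T'(3) gullI edges_gull by simp_all
      qed
      have sub: "{u', r, v'} \<subseteq> T \<union> leftover S" using T'(1) r by auto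
      note sw = swap[OF D(1) T g sub]
      let ?S = "insert {u', r, v'} (S - {T})"
      have Tp': "Tp \<in> ?S" using Tp TTp by auto
      have w'R: "w' \<in> leftover ?S" "r2 \<in> leftover ?S"
        using sw(2) T'(1) r nv' neq' by auto
      \<comment> \<open>After the first swap \<open>u\<close> still has the leftover neighbour
        \<open>r2\<close>, so it is the distinguished vertex of \<open>Tp\<close>; hence
        \<open>w\<close> is nonadjacent to the new leftover vertex \<open>w'\<close>.\<close>
      obtain a b c where abc: "Tp = {a, b, c}" "E a b" "\<not> E a c" "\<not> E b c"
        "\<And>r. r \<in> leftover ?S \<Longrightarrow> \<not> E c r" "\<And>r. r \<in> leftover ?S \<Longrightarrow> \<not> E b r"
        using leftover_shape[OF sw(1) Tp' ind] by blast
      have "E u r2" using u_full r by blast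
      then have "u \<noteq> b" "u \<noteq> c" using abc(5,6) w'R(2) by auto
      moreover have "u \<in> {a, b, c}" "w \<in> {a, b, c}" using abc(1) T0(1) by auto
      ultimately have "w \<in> {b, c}" using neq by auto
      then have ww: "\<not> E w w'" using abc(5,6) w'R(1) by blast
      have g2: "gull {u, w, w'}" and e2: "edges {u, w, w'} = {{u, w}}"
        using T0 ww no T'(1) edges_gull by (auto intro!: gullI)
      have sub2: "{u, w, w'} \<subseteq> Tp \<union> leftover ?S" using T0(1) w'R by auto
      note sw2 = swap[OF sw(1) Tp' g2 sub2]
      have "core (insert {u, w, w'} (?S - {Tp})) = core S - {{u', w'}} \<union> {{u', r}}"
      proof -
        have "edges Tp \<subseteq> core ?S" using Tp' unfolding core_def by blast
        then have "{u, w} \<in> core ?S" using edges_gull[OF T0(2-4)] T0(1) by simp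
        then have "core (insert {u, w, w'} (?S - {Tp})) = core ?S"
          using sw2(3) e2 edges_gull[OF T0(2-4)] T0(1) by auto
        then show ?thesis using sw(3) e edges_gull[OF T'(2-4)] T'(1) by simp
      qed
      moreover have "v \<in> leftover (insert {u, w, w'} (?S - {Tp}))"
        using sw2(2) T0(1) neq dj[of w'] T'(1) by auto
      ultimately show False using step[OF sw2(1) _ u'w' r(1)] by blast
    next
      case False
      then obtain r' where r': "r' \<in> leftover S" "\<not> E u' r'" by blast
      obtain r where r: "r \<in> leftover S" "r \<noteq> r'"
        using card_leftover_ge[OF D(1)] by (metis Suc_1 card_le_Suc0_iff_eq finite_leftover not_less_eq_eq numeral_3_eq_3 One_nat_def le_SucI)
      have g: "gull {u', w', r'}" and e: "edges {u', w', r'} = {{u', w'}}"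
        using r' T' edges_gull by (auto intro!: gullI)
      have sub: "{u', w', r'} \<subseteq> T \<union> leftover S" using T'(1) r' by auto
      note sw = swap[OF D(1) T g sub]
      let ?S = "insert {u', w', r'} (S - {T})"
      have Tp': "Tp \<in> ?S" using Tp TTp by auto
      have v'R: "v' \<in> leftover ?S" "r \<in> leftover ?S"
        using sw(2) T'(1) r r' nv' neq' by auto
      have g2: "gull {u, r, v'}" and e2: "edges {u, r, v'} = {{u, r}}"
      proof -
        have "E u r" "\<not> E r v'" "\<not> E u v'" using u_full r(1) T'(1,5) no sym by blast+
        then show "gull {u, r, v'}" "edges {u, r, v'} = {{u, r}}"
          using gullI edges_gull by simp_all
      qed
      have sub2: "{u, r, v'} \<subseteq> Tp \<union> leftover ?S" using T0(1) v'R by auto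
      note sw2 = swap[OF sw(1) Tp' g2 sub2]
      have "core (insert {u, r, v'} (?S - {Tp})) = core S - {{u, w}} \<union> {{u, r}}"
      proof -
        have "core ?S = core S"
          using sw(3) e edges_gull[OF T'(2-4)] T'(1) u'w' by auto
        then show ?thesis using sw2(3) e2 edges_gull[OF T0(2-4)] T0(1) by simp
      qed
      moreover have "v \<in> leftover (insert {u, r, v'} (?S - {Tp}))"
        using sw2(2) T0(1) neq dj[of v'] T'(1) r nv by auto
      ultimately show False using step[OF sw2(1) _ uw_core r(1)] by blast
    qed
  qed
  define h where "h T = (SOME y. y \<in> T \<and> E u y)" for T
  have h: "h T \<in> T" "E u (h T)" if "T \<in> S" for T
    using someI_ex[of "\<lambda>y. y \<in> T \<and> E u y"] u_hits[OF that] unfolding h_def by blast+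
  have "inj_on h S"
    by (rule inj_onI) (metis h(1) max_packing_disjoint[OF D(1)])
  then have "card (h ` S) = t" using D(1) card_image unfolding max_packing_def by metis
  moreover have "h ` S \<inter> leftover S = {}" using h(1) leftover_disjoint by blast
  moreover have "finite (h ` S)" using max_packing_finite[OF D(1)] by simp
  \<comment> \<open>Since \<open>t < k\<close>, this number exceeds the degree bound
    \<open>k + s\<close>.\<close>
  ultimately have "card (h ` S \<union> leftover S) = t + (3 * (k - t) + s)"
    using card_leftover[OF D(1)] finite_leftover by (simp add: card_Un_disjoint)
  moreover have "h ` S \<union> leftover S \<subseteq> {y \<in> V. E u y}"
    using h u_full max_packing_subset[OF D(1)] unfolding leftover_def by blast
  then have "card (h ` S \<union> leftover S) \<le> card {y \<in> V. E u y}"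
    using finV by (intro card_mono) auto
  moreover have "u \<in> V" using max_packing_subset[OF D(1) Tp(1)] T0(1) by blast
  ultimately show False using degree[of u] t_less by simp
qed

end

section \<open>Complete bipartite leftovers with at least two vertices on each side\<close>

text \<open>If no disjoint pairs exist, any pair split by \<open>f\<close> leaves \<open>g\<close>
  constant outside it. Should \<open>g\<close> distinguish one member of such a pair from the rest,
  varying the pair shows that this member is alone under both \<open>f\<close> and \<open>g\<close>.
  Otherwise both members agree with the rest and \<open>g\<close> is constant.\<close>

lemma two_cuts:
  fixes f g :: "'a \<Rightarrow> bool"
  assumes R: "card R \<ge> 4"
    and f: "a \<in> R" "b \<in> R" "f a \<noteq> f b" and g: "a' \<in> R" "b' \<in> R" "g a' \<noteq> g b'"
  shows "(\<exists>c1\<in>R. \<exists>c2\<in>R. \<exists>d1\<in>R. \<exists>d2\<in>R. f c1 \<noteq> f c2 \<and> g d1 \<noteq> g d2 \<and> {c1, c2} \<inter> {d1, d2} = {}) \<or>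
    (\<exists>c\<in>R. \<forall>r\<in>R - {c}. f r \<noteq> f c \<and> g r \<noteq> g c)"
proof (rule ccontr)
  assume n: "\<not> ?thesis"
  then have c: "g d1 = g d2" if "c1 \<in> R" "c2 \<in> R" "f c1 \<noteq> f c2" "d1 \<in> R - {c1, c2}" "d2 \<in> R - {c1, c2}"
    for c1 c2 d1 d2
    using that by blast
  have iso: False if c12: "c1 \<in> R" "c2 \<in> R" "f c1 \<noteq> f c2" "e \<in> R - {c1, c2}" "g c1 \<noteq> g e" for c1 c2 e
  proof -
    have fe: "f r = f c2 \<and> g r = g e" if r: "r \<in> R - {c1, c2}" for r
    proof
      show "g r = g e" using c[of c1 c2 r e] that c12(1-4) by blast
      show "f r = f c2"
      proof (rule ccontr)
        assume "f r \<noteq> f c2"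
        have "\<not> R \<subseteq> {c1, c2, r}" using ex_not_in_list[of "[c1, c2, r]" R] R by auto
        then obtain e' where "e' \<in> R - {c1, c2, r}" by blast
        moreover from this have "g e' = g e" using c[of c1 c2 e' e] c12(1-4) by blast
        moreover have "c1 \<noteq> c2" using c12(3) by blast
        ultimately show False
          using c[of r c2 c1 e'] \<open>f r \<noteq> f c2\<close> r c12(1,2,5) by auto
      qed
    qed
    have "\<not> R \<subseteq> {c1, c2, e}" using ex_not_in_list[of "[c1, c2, e]" R] R by auto
    then obtain e' where e': "e' \<in> R - {c1, c2, e}" by blast
    have "g c2 = g e'"
      using c[of c1 e c2 e'] fe[of e] fe[of e'] e' that by auto
    then have "f r \<noteq> f c1 \<and> g r \<noteq> g c1" if "r \<in> R - {c1}" for r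
      using fe[of r] fe[of e'] e' that c12(3,5) by (cases "r = c2") auto
    then show False using n c12(1) by blast
  qed
  have "\<not> R \<subseteq> {a, b}" using ex_not_in_list[of "[a, b]" R] R by auto
  then obtain e where e: "e \<in> R - {a, b}" by blast
  have "g a = g e" "g b = g e"
    using iso[of a b e] iso[of b a e] f e by auto
  moreover have "g r = g e" if "r \<in> R - {a, b}" for r using c[of a b r e] that f e by blast
  ultimately show False using g by (metis DiffI insertE singletonD)
qed

context gull_deficit
begin

text \<open>
  \<open>Q True\<close> and \<open>Q False\<close> collect the vertices that look to the leftover like members of \<open>A\<close> and of
  \<open>B\<close>; the others, \<open>W\<close>, are mixed. A mixed vertex \<open>x\<close> splits the leftover by \<open>cut x\<close> in such a way
  that \<open>{x, r, r'}\<close> is a gull iff \<open>r\<close> and \<open>r'\<close> are on different sides, so a gull contains at most one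
  mixed vertex. A non-adjacent pair from \<open>Q True \<times> Q False\<close> forms a gull with every leftover vertex.
  By the biclique bound and Koenig's theorem there are more disjoint such pairs than gulls without mixed
  vertex, and exchanging along a larger matching of pairs that covers the old ones destroys at most
  two gulls with a mixed vertex, which can be rebuilt.
\<close>

lemma no_two_sided_leftover:
  assumes S: "max_packing S" and AB: "leftover S = A \<union> B" "\<And>a b. a \<in> A \<Longrightarrow> b \<in> B \<Longrightarrow> E a b"
    and cA: "card A \<ge> 2" and cB: "card B \<ge> 2"
  shows False
proof -
  define R where "R = leftover S"
  have finR: "finite R" unfolding R_def by (rule finite_leftover)
  then have finAB: "finite A" "finite B" using AB(1) unfolding R_def by auto
  have RV: "R \<subseteq> V" unfolding R_def leftover_def by blast
  obtain a0 b0 where ab0: "a0 \<in> A" "b0 \<in> B"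
    using cA cB by (metis all_not_in_conv card.empty not_numeral_le_zero)
  have AB_dj: "A \<inter> B = {}" using AB(2) irrefl by blast
  have cR: "card R \<ge> 4"
    using AB(1) AB_dj finAB cA cB unfolding R_def by (simp add: card_Un_disjoint)
  have Radj: "E r r' \<longleftrightarrow> (r \<in> A) \<noteq> (r' \<in> A)" if "r \<in> R" "r' \<in> R" for r r'
  proof -
    have "r \<in> A \<or> r \<in> B" "r' \<in> A \<or> r' \<in> B" using that AB(1) unfolding R_def by auto
    moreover have "\<not> E x y" if "x \<in> A" "y \<in> A" for x y
      using AB(2)[OF that(1) ab0(2)] AB(2)[OF that(2) ab0(2)] no_triangle sym by blast
    moreover have "\<not> E x y" if "x \<in> B" "y \<in> B" for x y
      using AB(2)[OF ab0(1) that(1)] AB(2)[OF ab0(1) that(2)] no_triangle sym by blast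
    ultimately show ?thesis using AB(2) AB_dj sym by blast
  qed
  have opp: "\<exists>r\<in>R. (r \<in> A) \<noteq> v" for v
    using ab0 AB AB_dj unfolding R_def by (cases v) auto
  have same: "\<exists>r\<in>R. (r \<in> A) = v \<and> r \<noteq> c" for v c
  proof -
    have "\<not> A \<subseteq> {c}" "\<not> B \<subseteq> {c}" using cA cB card_mono[of "{c}" A] card_mono[of "{c}" B] by auto
    then show ?thesis using AB(1) AB_dj unfolding R_def by (cases v) auto
  qed
  \<comment> \<open>The flag \<open>True\<close> stands for \<open>A\<close> and
    \<open>False\<close> for \<open>B\<close>.\<close>
  define Q where "Q v = {c \<in> V. \<forall>r\<in>R - {c}. E c r \<longleftrightarrow> v \<noteq> (r \<in> A)}" for v
  have QE: "E c r \<longleftrightarrow> v \<noteq> (r \<in> A)" if "c \<in> Q v" "r \<in> R" "r \<noteq> c" for c r v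
    using that unfolding Q_def by blast
  have QV: "Q v \<subseteq> V" for v unfolding Q_def by blast
  have finQ: "finite (Q v)" for v using QV finV finite_subset by blast
  have RQ: "r \<in> Q (r \<in> A)" if "r \<in> R" for r
    using that RV Radj unfolding Q_def by blast
  have Quniq: "v = v'" if "c \<in> Q v" "c \<in> Q v'" for c v v'
    using QE[OF that(1)] QE[OF that(2)] same[of v c] by metis
  have QR: "(c \<in> A) = v" if "c \<in> Q v" "c \<in> R" for c v
    using Quniq[OF that(1) RQ[OF that(2)]] by simp
  have Qind: "\<not> E c c'" if "c \<in> Q v" "c' \<in> Q v" for c c' v
  proof -
    obtain r where r: "r \<in> R" "(r \<in> A) \<noteq> v" using opp by blast
    then have "r \<noteq> c" "r \<noteq> c'" using QR that by blast+
    then have "E c r" "E c' r" using QE[OF that(1) r(1)] QE[OF that(2) r(1)] r(2) by auto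
    then show ?thesis using no_triangle sym by blast
  qed
  \<comment> \<open>A triple is a gull iff it spans exactly one \<open>E\<close>-edge. Flipping
    adjacency by the class of the other vertex merges the two cases: nonadjacent vertices of one
    class, and adjacent vertices of opposite classes, which have no common neighbour.\<close>
  have crossing: "gull {x, c, c'} \<longleftrightarrow> (v \<noteq> E x c) \<noteq> (v' \<noteq> E x c')"
    if c: "c \<in> Q v" "c' \<in> Q v'" and adj: "v = v' \<or> E c c'" and d: "x \<noteq> c" "x \<noteq> c'" "c \<noteq> c'" for x c c' v v'
  proof -
    have cnt: "gull {x, c, c'} \<longleftrightarrow> (E x c \<and> \<not> E x c' \<and> \<not> E c c') \<or> (\<not> E x c \<and> E x c' \<and> \<not> E c c')
       \<or> (\<not> E x c \<and> \<not> E x c' \<and> E c c')"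
    proof
      assume "gull {x, c, c'}"
      then obtain u w y where "{x, c, c'} = {u, w, y}" "E u w" "\<not> E u y" "\<not> E w y"
        unfolding gull_def by blast
      moreover from this have "u \<noteq> w" "u \<noteq> y" "w \<noteq> y" using irrefl sym by blast+
      ultimately show "(E x c \<and> \<not> E x c' \<and> \<not> E c c') \<or> (\<not> E x c \<and> E x c' \<and> \<not> E c c')
       \<or> (\<not> E x c \<and> \<not> E x c' \<and> E c c')"
        using d sym_iff by (smt (verit, ccfv_threshold) insert_iff singletonD)
    next
      assume "(E x c \<and> \<not> E x c' \<and> \<not> E c c') \<or> (\<not> E x c \<and> E x c' \<and> \<not> E c c')
       \<or> (\<not> E x c \<and> \<not> E x c' \<and> E c c')"
      then show "gull {x, c, c'}"
        using gullI[of x c c'] gullI[of x c' c] gullI[of c c' x] sym_iff by (auto simp: insert_commute)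
    qed
    show ?thesis
    proof (cases "v = v'")
      case True
      then have "\<not> E c c'" using Qind c by blast
      then show ?thesis using cnt True by blast
    next
      case False
      then have "E c c'" using adj by blast
      moreover from this have "\<not> (E x c \<and> E x c')" using no_triangle sym by blast
      ultimately show ?thesis using cnt False by blast
    qed
  qed
  have jgull: "gull {p, q, r}" if "p \<in> Q True" "q \<in> Q False" "\<not> E p q" "r \<in> R" "r \<noteq> p" "r \<noteq> q" for p q r
    using QE[OF that(1,4,5)] QE[OF that(2,4,6)] that(3) gullI[of q r p] gullI[of p r q] sym_iff
    by (cases "r \<in> A") (auto simp: insert_commute)
  define W where "W = V - Q True - Q False"
  have notW: "\<exists>v. c \<in> Q v" if "c \<in> V" "c \<notin> W" for c
    using that unfolding W_def by blast
  have QW: "c \<notin> W" if "c \<in> Q v" for c v using that unfolding W_def by (cases v) auto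
  have WR: "x \<notin> R" if "x \<in> W" for x using that RQ QW by blast
  define cut where "cut x r \<longleftrightarrow> (r \<in> A) \<noteq> E x r" for x r
  have mixed: "\<exists>r\<in>R. \<exists>r'\<in>R. cut x r \<noteq> cut x r'" if "x \<in> W" for x
  proof (rule ccontr)
    assume n: "\<not> ?thesis"
    obtain r0 where "r0 \<in> R" using opp by blast
    then have eq: "cut x r = cut x r0" if "r \<in> R" for r using n that by blast
    have "E x r \<longleftrightarrow> cut x r0 \<noteq> (r \<in> A)" if "r \<in> R" for r
      using eq[OF that] unfolding cut_def[of x r] by blast
    then have "x \<in> Q (cut x r0)"
      using \<open>x \<in> W\<close> unfolding Q_def W_def by simp
    then show False using QW that by blast
  qed
  have Wgull: "gull {x, r, r'}" if "x \<in> W" "r \<in> R" "r' \<in> R" "cut x r \<noteq> cut x r'" for x r r'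
  proof -
    have "x \<noteq> r" "x \<noteq> r'" "r \<noteq> r'" using that WR by blast+
    moreover have "(r \<in> A) = (r' \<in> A) \<or> E r r'" using Radj that by blast
    ultimately show ?thesis
      using crossing[OF RQ RQ] that unfolding cut_def by blast
  qed
  \<comment> \<open>A cut isolating \<open>c\<close> has only one possible form: \<open>x\<close> is
    adjacent to the rest of the side of \<open>c\<close> and to nothing else in \<open>R\<close>,
    because \<open>x\<close> cannot be adjacent to both \<open>c\<close> and
    \<open>b\<close>.\<close>
  have isolated: "E x c2 \<and> \<not> E x c \<and> \<not> E x b"
    if "c \<in> R" "\<forall>r\<in>R - {c}. cut x r \<noteq> cut x c" "c2 \<in> R" "c2 \<noteq> c" "(c2 \<in> A) = (c \<in> A)"
      "b \<in> R" "(b \<in> A) \<noteq> (c \<in> A)" for x c c2 b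
  proof -
    have "E c b" using Radj that by blast
    then have "\<not> (E x c \<and> E x b)" using no_triangle sym by blast
    moreover have "cut x c2 \<noteq> cut x c" "cut x b \<noteq> cut x c" using that by auto
    ultimately show ?thesis using that unfolding cut_def by blast
  qed
  \<comment> \<open>If the two cuts split disjoint pairs, two gulls result at once. Otherwise both
    isolate the same \<open>c\<close>, and a vertex \<open>z\<close> of \<open>T\<close> adjacent to
    just one of the mixed vertices yields \<open>{c, b, x'}\<close> and
    \<open>{y', c2, z}\<close>.\<close>
  have one_mixed: "x = y" if T: "T \<in> S" "x \<in> T" "y \<in> T" "x \<in> W" "y \<in> W" for T x y
  proof (rule ccontr)
    assume "x \<noteq> y"
    have TR: "T \<inter> R = {}" using leftover_disjoint[OF T(1)] unfolding R_def by blast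
    obtain a b where ab: "a \<in> R" "b \<in> R" "cut x a \<noteq> cut x b" using mixed T(4) by blast
    obtain a' b' where ab': "a' \<in> R" "b' \<in> R" "cut y a' \<noteq> cut y b'" using mixed T(5) by blast
    consider c1 c2 d1 d2 where "c1 \<in> R" "c2 \<in> R" "d1 \<in> R" "d2 \<in> R" "cut x c1 \<noteq> cut x c2"
        "cut y d1 \<noteq> cut y d2" "{c1, c2} \<inter> {d1, d2} = {}"
      | c where "c \<in> R" "\<forall>r\<in>R - {c}. cut x r \<noteq> cut x c \<and> cut y r \<noteq> cut y c"
      using two_cuts[OF cR ab ab'] by blast
    then show False
    proof cases
      case 1
      have "gull {x, c1, c2}" "gull {y, d1, d2}" using Wgull 1 T by auto
      moreover have "{x, c1, c2} \<inter> {y, d1, d2} = {}"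
        using 1 T WR \<open>x \<noteq> y\<close> by auto
      moreover have "{x, c1, c2} \<union> {y, d1, d2} \<subseteq> T \<union> leftover S" using 1 T unfolding R_def by auto
      ultimately show False using no_two_gulls[OF S T(1)] by blast
    next
      case 2
      obtain c2 where c2: "c2 \<in> R" "(c2 \<in> A) = (c \<in> A)" "c2 \<noteq> c" using same by blast
      obtain b where b: "b \<in> R" "(b \<in> A) \<noteq> (c \<in> A)" using opp by blast
      have x: "E x c2" "\<not> E x c" "\<not> E x b" and y: "E y c2" "\<not> E y c" "\<not> E y b"
        using isolated[OF 2(1) _ c2(1,3,2) b] 2(2) by blast+
      have cb: "E c b" "b \<noteq> c2" "b \<noteq> c" using Radj 2(1) b c2 by blast+
      have "\<not> E x y" using x y no_triangle sym by blast
      have final: False if "x' \<in> T" "y' \<in> T" "z \<in> T" "x' \<noteq> y'" "x' \<noteq> z" "E x' z" "\<not> E y' z"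
        "E x' c2" "\<not> E x' c" "\<not> E x' b" "E y' c2" for x' y' z
      proof -
        have "gull {c, b, x'}" using cb that sym_iff by (intro gullI) auto
        moreover have "\<not> E z c2" using that no_triangle by blast
        then have "gull {y', c2, z}" using that sym_iff by (intro gullI) auto
        moreover have "{c, b, x'} \<inter> {y', c2, z} = {}"
          using that TR c2 b cb 2(1) by auto
        moreover have "{c, b, x'} \<union> {y', c2, z} \<subseteq> T \<union> leftover S"
          using that 2(1) b c2 unfolding R_def by auto
        ultimately show False using no_two_gulls[OF S T(1)] by blast
      qed
      obtain u w v where uwv: "T = {u, w, v}" "E u w" "\<not> E u v" "\<not> E w v"
        using max_packing_gull[OF S T(1)] unfolding gull_def by blast
      have neq: "u \<noteq> w" using uwv irrefl by blast
      \<comment> \<open>The gull \<open>T\<close> has a single edge and \<open>x\<close>,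
        \<open>y\<close> are nonadjacent, so exactly one of them is an end of that edge;
        \<open>z\<close> is its other end.\<close>
      have "(\<exists>z\<in>T. E x z \<and> \<not> E y z) \<or> (\<exists>z\<in>T. E y z \<and> \<not> E x z)"
        using T(2,3) \<open>x \<noteq> y\<close> \<open>\<not> E x y\<close> uwv sym_iff irrefl by (metis insertE insertI1 insertI2 singletonD)
      then show False
        using final[of x y] final[of y x] T(2,3) x y \<open>x \<noteq> y\<close> irrefl by metis
    qed
  qed
  \<comment> \<open>A nonadjacent pair from opposite classes forms a gull with a third leftover
    vertex, disjoint from a gull \<open>{x, r, r'}\<close>.\<close>
  have mixed_gull_adj: "v = v' \<or> E p p'"
    if T: "T \<in> S" "x \<in> T" "x \<in> W" "p \<in> T" "p' \<in> T" "p \<in> Q v" "p' \<in> Q v'" for T x p p' v v'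
  proof (rule ccontr)
    assume n: "\<not> (v = v' \<or> E p p')"
    obtain r r' where r: "r \<in> R" "r' \<in> R" "cut x r \<noteq> cut x r'" using mixed T(3) by blast
    have TR: "T \<inter> R = {}" using leftover_disjoint[OF T(1)] unfolding R_def by blast
    have "\<not> R \<subseteq> {r, r'}" using ex_not_in_list[of "[r, r']" R] cR by auto
    then obtain r3 where r3: "r3 \<in> R" "r3 \<noteq> r" "r3 \<noteq> r'" by blast
    have "r3 \<noteq> p" "r3 \<noteq> p'" using r3 TR T by auto
    have "gull {p, p', r3}"
    proof (cases v)
      case True
      then have "v' = False" using n by simp
      then show ?thesis using jgull[of p p' r3] T True n r3 \<open>r3 \<noteq> p\<close> \<open>r3 \<noteq> p'\<close> by simp
    next
      case False
      then have "v' = True" using n by simp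
      then have "gull {p', p, r3}" using jgull[of p' p r3] T False n r3 \<open>r3 \<noteq> p\<close> \<open>r3 \<noteq> p'\<close> sym_iff by simp
      then show ?thesis by (simp add: insert_commute)
    qed
    moreover have "gull {x, r, r'}" using Wgull r T by blast
    moreover have "{p, p', r3} \<inter> {x, r, r'} = {}"
      using r r3 TR T QW WR by auto
    moreover have "{p, p', r3} \<union> {x, r, r'} \<subseteq> T \<union> leftover S" using r r3 T unfolding R_def by auto
    ultimately show False using no_two_gulls[OF S T(1)] by blast
  qed
  define S0 where "S0 = {T \<in> S. T \<inter> W = {}}"
  define F where "F = {{p, q} | p q. p \<in> Q True \<and> q \<in> Q False \<and> \<not> E p q}"
  \<comment> \<open>The edge of the gull joins opposite classes, and the third vertex is opposite to
    one of its ends but adjacent to neither.\<close>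
  have unmixed_pair: "\<exists>e\<in>F. e \<subseteq> T" if T: "T \<in> S0" for T
  proof -
    have TS: "T \<in> S" using T unfolding S0_def by blast
    obtain u w y where uwy: "T = {u, w, y}" "E u w" "\<not> E u y" "\<not> E w y"
      using max_packing_gull[OF S TS] unfolding gull_def by blast
    have "c \<notin> W" "c \<in> V" if "c \<in> T" for c using T that max_packing_subset[OF S TS] unfolding S0_def by auto
    then obtain v v' v'' where v: "u \<in> Q v" "w \<in> Q v'" "y \<in> Q v''"
      using notW uwy(1) by (metis insertI1 insertI2)
    have "v \<noteq> v'" using Qind uwy(2) v by blast
    have "\<exists>a\<in>T. \<exists>b\<in>T. \<exists>i. a \<in> Q i \<and> b \<in> Q (\<not> i) \<and> \<not> E a b"
    proof (cases "v'' = v")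
      case True
      then show ?thesis using v uwy \<open>v \<noteq> v'\<close> sym_iff
        by (intro bexI[of _ y] bexI[of _ w] exI[of _ v]) auto
    next
      case False
      then show ?thesis using v uwy \<open>v \<noteq> v'\<close> sym_iff
        by (intro bexI[of _ y] bexI[of _ u] exI[of _ v'']) auto
    qed
    then obtain a b i where ab: "a \<in> T" "b \<in> T" "a \<in> Q i" "b \<in> Q (\<not> i)" "\<not> E a b" by blast
    have "(\<exists>p\<in>T. \<exists>q\<in>T. p \<in> Q True \<and> q \<in> Q False \<and> \<not> E p q)"
    proof (cases i)
      case True
      then show ?thesis using ab by (intro bexI[of _ a] bexI[of _ b]) auto
    next
      case False
      then show ?thesis using ab sym_iff by (intro bexI[of _ b] bexI[of _ a]) auto
    qed
    then obtain a b where ab: "a \<in> T" "b \<in> T" "a \<in> Q True" "b \<in> Q False" "\<not> E a b" by blast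
    then have "{a, b} \<in> F" unfolding F_def by blast
    then show ?thesis using ab(1,2) by (intro bexI[of _ "{a, b}"]) auto
  qed
  then obtain jp where jp: "\<And>T. T \<in> S0 \<Longrightarrow> jp T \<in> F \<and> jp T \<subseteq> T" by metis
  have finS: "finite S" using max_packing_finite[OF S] .
  have S0S: "S0 \<subseteq> S" unfolding S0_def by blast
  have Q_dj: "Q True \<inter> Q False = {}" using Quniq by blast
  have finF: "finite F"
  proof -
    have "F \<subseteq> Pow V" unfolding F_def using QV by auto
    then show ?thesis using finV finite_subset by blast
  qed
  have bip: "bipartite_edges (Q True) (Q False) F"
    unfolding bipartite_edges_def using finF Q_dj unfolding F_def by blast
  have F2: "card e = 2" if "e \<in> F" for e
    using that Q_dj unfolding F_def by (force simp: card_2_iff)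
  have FR: "r \<notin> \<Union>F" if r: "r \<in> R" for r
  proof
    assume "r \<in> \<Union>F"
    then obtain p q where pq: "p \<in> Q True" "q \<in> Q False" "\<not> E p q" "r = p \<or> r = q"
      unfolding F_def by blast
    have "p \<noteq> q" using pq Q_dj by blast
    from pq(4) show False
    proof
      assume "r = p"
      then show False using QE[OF pq(2) r] QR[OF pq(1)] pq(3) r \<open>p \<noteq> q\<close> sym by auto
    next
      assume "r = q"
      then show False using QE[OF pq(1) r] QR[OF pq(2)] pq(3) r \<open>p \<noteq> q\<close> by auto
    qed
  qed
  have cW: "card W + card S0 \<le> t"
  proof -
    have "\<exists>T. T \<in> S \<and> x \<in> T" if "x \<in> W" for x
      using that WR[OF that] unfolding W_def R_def leftover_def by blast
    then obtain h where h: "\<And>x. x \<in> W \<Longrightarrow> h x \<in> S \<and> x \<in> h x" by metis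
    have "inj_on h W" by (rule inj_onI) (metis h one_mixed)
    moreover have "h ` W \<subseteq> S - S0" using h unfolding S0_def by blast
    ultimately have "card W \<le> card (S - S0)"
      using finS by (metis card_inj_on_le finite_Diff)
    moreover have "card (S - S0) = card S - card S0" "card S0 \<le> card S"
      using S0S finS by (simp_all add: card_Diff_subset finite_subset card_mono)
    ultimately show ?thesis using S unfolding max_packing_def by linarith
  qed
  have cV: "3 * k + s \<le> card (Q True) + card (Q False) + card W"
  proof -
    have "V = Q True \<union> Q False \<union> W" using QV unfolding W_def by blast
    then have "card V \<le> card (Q True \<union> Q False) + card W" using card_Un_le by metis
    also have "\<dots> \<le> card (Q True) + card (Q False) + card W" using card_Un_le by simp
    finally show ?thesis using card_V by simp
  qed
  have cQ: "card (Q v) \<le> k + s" for v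
  proof -
    obtain r where r: "r \<in> R" "(r \<in> A) \<noteq> v" using opp by blast
    have "Q v \<subseteq> {y \<in> V. E r y}"
    proof
      fix c assume c: "c \<in> Q v"
      then have "r \<noteq> c" using QR r by blast
      then show "c \<in> {y \<in> V. E r y}" using QE[OF c r(1)] r(2) c QV sym by blast
    qed
    then have "card (Q v) \<le> card {y \<in> V. E r y}" using finV by (intro card_mono) auto
    then show ?thesis using degree[of r] r(1) RV by auto
  qed
  \<comment> \<open>Counting \<open>V\<close> with \<open>|W| \<le> t - |S0|\<close> and classes of
    size at most \<open>k + s\<close> gives \<open>|S0| \<le> s + t - k\<close>, hence
    \<open>|R| - |S0| \<ge> 4 (k - t)\<close>. The four spare vertices serve one additional pair
    and, in \<open>finish\<close>, up to three vertices for rebuilding.\<close>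
  have room: "card S0 + 4 \<le> card R"
    using cV cQ[of True] cQ[of False] cW card_leftover[OF S] t_less unfolding R_def by linarith
  \<comment> \<open>Removing a cover with at most \<open>|S0|\<close> vertices would leave a
    biclique on at least \<open>3k + s - t > 2k + s\<close> vertices. Its sides contain
    \<open>a0\<close> and \<open>b0\<close>, as no leftover vertex lies on an edge of
    \<open>F\<close>.\<close>
  have cover: "Suc (card S0) \<le> card K" if K: "K \<subseteq> \<Union>F" "\<And>e. e \<in> F \<Longrightarrow> e \<inter> K \<noteq> {}" for K
  proof (rule ccontr)
    assume small: "\<not> ?thesis"
    have "\<Union>F \<subseteq> V" unfolding F_def using QV by auto
    then have finK: "finite K" using K(1) finV by (meson finite_subset)
    have "b0 \<notin> A" using AB_dj ab0 by blast
    then have "a0 \<in> Q True - K" "b0 \<in> Q False - K"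
      using RQ[of a0] RQ[of b0] ab0 AB(1) AB_dj FR[of a0] FR[of b0] K(1) unfolding R_def by auto
    moreover have "E p q" if "p \<in> Q True - K" "q \<in> Q False - K" for p q
    proof (rule ccontr)
      assume "\<not> E p q"
      then have "{p, q} \<in> F" using that unfolding F_def by blast
      then show False using K(2)[of "{p, q}"] that by auto
    qed
    ultimately have "card (Q True - K) + card (Q False - K) \<le> 2 * k + s"
      using biclique[of "Q True - K" "Q False - K"] QV by blast
    moreover have "card (Q True) + card (Q False) \<le> card (Q True - K) + card (Q False - K) + card K"
    proof -
      have "card (Q True \<union> Q False) = card (Q True) + card (Q False)"
        using finQ Q_dj by (simp add: card_Un_disjoint)
      moreover have "card (Q True \<union> Q False) \<le> card ((Q True - K) \<union> (Q False - K) \<union> K)"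
        using finQ finK by (intro card_mono) auto
      moreover have "\<dots> \<le> card ((Q True - K) \<union> (Q False - K)) + card K" by (rule card_Un_le)
      moreover have "\<dots> \<le> card (Q True - K) + card (Q False - K) + card K" using card_Un_le by simp
      ultimately show ?thesis by linarith
    qed
    ultimately show False using cV cW small t_less by linarith
  qed
  obtain M where M: "M \<subseteq> F" "pair_matching M" "card M = Suc (card S0)"
    using konig[OF bip cover] by blast
  have inj_jp: "inj_on jp S0"
  proof (rule inj_onI)
    fix T T' assume T: "T \<in> S0" "T' \<in> S0" "jp T = jp T'"
    obtain c where "c \<in> jp T" using jp[OF T(1)] F2 by fastforce
    then show "T = T'" using jp[OF T(1)] jp[OF T(2)] T(3) max_packing_disjoint[OF S, of T T' c] T S0S by auto
  qed
  have J0: "pair_matching (jp ` S0)"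
    unfolding pair_matching_def
  proof (intro conjI ballI)
    show "finite (jp ` S0)" using finS S0S finite_subset by blast
    show "disjoint (jp ` S0)"
    proof (rule pairwiseI)
      fix a b assume "a \<in> jp ` S0" "b \<in> jp ` S0" "a \<noteq> b"
      then obtain T T' where T: "T \<in> S0" "T' \<in> S0" "a = jp T" "b = jp T'" "T \<noteq> T'" by blast
      then have "T \<inter> T' = {}" using max_packing_disjoint[OF S, of T T'] S0S by blast
      then show "disjnt a b" unfolding disjnt_def using jp[OF T(1)] jp[OF T(2)] T by blast
    qed
    fix e assume "e \<in> jp ` S0" then show "card e = 2" using jp F2 by blast
  qed
  have cJ0: "card (jp ` S0) = card S0" using card_image[OF inj_jp] .
  obtain J where J: "J \<subseteq> jp ` S0 \<union> M" "pair_matching J" "card J = Suc (card S0)" "\<Union>(jp ` S0) \<subseteq> \<Union>J"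
    using pair_matching_extend[OF J0 M(2)] M(3) cJ0 by auto
  have JF: "J \<subseteq> F" using J(1) M(1) jp by blast
  have side: "card (\<Union>N \<inter> Q v) = card N" if N: "N \<subseteq> F" "pair_matching N" for N v
  proof -
    have "\<Union>N \<inter> Q v = (\<Union>e\<in>N. e \<inter> Q v)" by blast
    also have "card \<dots> = (\<Sum>e\<in>N. card (e \<inter> Q v))"
    proof (rule card_UN_disjoint)
      show "finite N" using N unfolding pair_matching_def by blast
      show "\<forall>e\<in>N. finite (e \<inter> Q v)" using finQ by blast
      show "\<forall>e\<in>N. \<forall>e'\<in>N. e \<noteq> e' \<longrightarrow> (e \<inter> Q v) \<inter> (e' \<inter> Q v) = {}"
        using pair_matching_eqI[OF N(2)] by blast
    qed
    also have "\<dots> = (\<Sum>e\<in>N. 1)"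
    proof (rule sum.cong)
      fix e assume "e \<in> N"
      then obtain p q where "e = {p, q}" "p \<in> Q True" "q \<in> Q False" using N(1) unfolding F_def by blast
      then have "e \<inter> Q v = (if v then {p} else {q})" using Q_dj by auto
      then show "card (e \<inter> Q v) = 1" by simp
    qed simp
    finally show ?thesis by simp
  qed
  have new: "\<exists>c. c \<in> \<Union>J \<and> c \<notin> \<Union>(jp ` S0) \<and> c \<in> Q v" for v
  proof (rule ccontr)
    assume "\<not> ?thesis"
    then have "\<Union>J \<inter> Q v \<subseteq> \<Union>(jp ` S0) \<inter> Q v" by blast
    then have "card (\<Union>J \<inter> Q v) \<le> card (\<Union>(jp ` S0) \<inter> Q v)" using finQ by (intro card_mono) auto
    moreover have "jp ` S0 \<subseteq> F" using jp by blast
    ultimately show False using side[OF JF J(2)] side[OF _ J0] J(3) cJ0 by simp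
  qed
  obtain p where p: "p \<in> \<Union>J" "p \<notin> \<Union>(jp ` S0)" "p \<in> Q True" using new by blast
  obtain q where q: "q \<in> \<Union>J" "q \<notin> \<Union>(jp ` S0)" "q \<in> Q False" using new by blast
  have pq: "p \<noteq> q" using p q Q_dj by blast
  \<comment> \<open>Each edge of \<open>J\<close> has one end in either class, and \<open>J\<close>
    has one edge more than the old pairs, whose vertices it all covers. So only \<open>p\<close> and
    \<open>q\<close> are new, and they are the only threat to gulls outside
    \<open>S0\<close>.\<close>
  have J_eq: "\<Union>J = \<Union>(jp ` S0) \<union> {p, q}"
  proof -
    have "card (\<Union>(jp ` S0) \<union> {p, q}) = card (\<Union>(jp ` S0)) + card {p, q}"
      using pair_matching_finite_Union[OF J0] p q by (intro card_Un_disjoint) auto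
    also have "\<dots> = card (\<Union>J)"
      using pair_matching_card_Union[OF J0] pair_matching_card_Union[OF J(2)] J(3) cJ0 pq by simp
    finally show ?thesis
      using p q J(4) pair_matching_finite_Union[OF J(2)] card_subset_eq[of "\<Union>J" "\<Union>(jp ` S0) \<union> {p, q}"] by auto
  qed
  have pqR: "p \<notin> R" "q \<notin> R" using FR JF p q by blast+
  define D where "D = {T \<in> S - S0. p \<in> T \<or> q \<in> T}"
  \<comment> \<open>\<open>G\<close> rebuilds the damaged gulls without \<open>p\<close> and
    \<open>q\<close>. Each pair of \<open>J\<close> then receives its own leftover vertex outside
    \<open>G\<close>, and \<open>|S0| + 1\<close> gulls take the place of
    \<open>|S0|\<close>.\<close>
  have finish: False if G: "packing ((\<Union>D - {p, q}) \<union> R) G" "card G = card D" "card (\<Union>G \<inter> R) \<le> 3" for G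
  proof -
    have finJ: "finite J" using J(2) unfolding pair_matching_def by blast
    have "card J \<le> card (R - \<Union>G)"
    proof -
      have "card (R - \<Union>G) = card R - card (R \<inter> \<Union>G)" using finR by (simp add: card_Diff_subset_Int)
      then show ?thesis using G(3) room J(3) by (simp add: Int_commute)
    qed
    then obtain g where g: "g ` J \<subseteq> R - \<Union>G" "inj_on g J"
      using card_le_inj[OF finJ, of "R - \<Union>G"] finR by blast
    have eR: "e \<inter> R = {}" if "e \<in> J" for e using FR JF that by blast
    define f where "f e = insert (g e) e" for e
    have fR: "f e - R = e" "f e \<inter> R = {g e}" if "e \<in> J" for e
      using eR[OF that] g that unfolding f_def by blast+
    have inj_f: "inj_on f J" by (rule inj_onI) (metis fR(1))
    have DS: "D \<subseteq> S" "D \<inter> S0 = {}" unfolding D_def by auto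
    have sepD: "\<Union>S0 \<inter> \<Union>D = {}"
    proof (rule ccontr)
      assume "\<Union>S0 \<inter> \<Union>D \<noteq> {}"
      then obtain c T T' where "T \<in> S0" "T' \<in> D" "c \<in> T" "c \<in> T'" by blast
      then show False using max_packing_disjoint[OF S, of T T' c] S0S DS by blast
    qed
    have J0S: "\<Union>(jp ` S0) \<subseteq> \<Union>S0" using jp by blast
    have GV: "\<Union>G \<subseteq> (\<Union>D - {p, q}) \<union> R" using G(1) unfolding packing_def by blast
    have Rsep: "\<Union>S0 \<inter> R = {}" using S0S unfolding R_def leftover_def by blast
    have eG: "e \<inter> \<Union>G = {}" if "e \<in> J" for e
    proof -
      have "e \<subseteq> \<Union>S0 \<union> {p, q}" using J_eq J0S that by blast
      then show ?thesis using GV eR[OF that] sepD Rsep pqR by blast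
    qed
    have fG: "f e \<inter> \<Union>G = {}" if "e \<in> J" for e
      using eG[OF that] g that unfolding f_def by blast
    have pS: "c \<in> \<Union>(S0 \<union> D)" if c: "c \<in> {p, q}" for c
    proof -
      have "c \<in> V" "c \<notin> R" using c p q QV pqR by auto
      then obtain T where "T \<in> S" "c \<in> T" unfolding R_def leftover_def by blast
      then show ?thesis using c unfolding D_def by blast
    qed
    have "packing (\<Union>(S0 \<union> D) \<union> leftover S) (f ` J \<union> G)"
    proof (rule packingI)
      fix T assume T: "T \<in> f ` J \<union> G"
      show "gull T"
      proof (cases "T \<in> G")
        case True then show ?thesis using G(1) unfolding packing_def by blast
      next
        case False
        then obtain e where e: "e \<in> J" "T = f e" using T by blast
        then obtain a b where ab: "e = {a, b}" "a \<in> Q True" "b \<in> Q False" "\<not> E a b"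
          using JF unfolding F_def by blast
        have "g e \<in> R" using g e by blast
        moreover from this have "g e \<noteq> a" "g e \<noteq> b" using eR[OF e(1)] ab by auto
        ultimately have "gull {a, b, g e}" using jgull ab by blast
        moreover have "T = {a, b, g e}" using e ab unfolding f_def by auto
        ultimately show ?thesis by simp
      qed
      show "T \<subseteq> \<Union>(S0 \<union> D) \<union> leftover S"
      proof (cases "T \<in> G")
        case True then show ?thesis using GV unfolding R_def by blast
      next
        case False
        then obtain e where e: "e \<in> J" "T = f e" using T by blast
        have "e \<subseteq> \<Union>(S0 \<union> D)"
        proof
          fix c assume "c \<in> e"
          then have "c \<in> \<Union>(jp ` S0) \<or> c \<in> {p, q}" using J_eq e(1) by blast
          then show "c \<in> \<Union>(S0 \<union> D)" using J0S pS by blast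
        qed
        then show ?thesis using e g unfolding f_def R_def by blast
      qed
    next
      fix T T' c assume T: "T \<in> f ` J \<union> G" "T' \<in> f ` J \<union> G" "c \<in> T" "c \<in> T'"
      have *: "f e = f e'" if "e \<in> J" "e' \<in> J" "c \<in> f e" "c \<in> f e'" for e e'
      proof -
        have "e = e'"
        proof (cases "c \<in> R")
          case True
          then have "c \<in> f e \<inter> R" "c \<in> f e' \<inter> R" using that(3,4) by auto
          then have "g e = c" "g e' = c"
            unfolding fR(2)[OF that(1)] fR(2)[OF that(2)] by simp_all
          then show ?thesis using g(2) that(1,2) by (simp add: inj_onD)
        next
          case False
          then have "c \<in> e" "c \<in> e'" using fR(1) that by blast+
          then show ?thesis using pair_matching_eqI[OF J(2)] that(1,2) by blast
        qed
        then show ?thesis by simp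
      qed
      consider "T \<in> f ` J" "T' \<in> f ` J" | "T \<in> G" "T' \<in> G" | "T \<in> f ` J" "T' \<in> G" | "T \<in> G" "T' \<in> f ` J"
        using T by blast
      then show "T = T'"
      proof cases
        case 1 then show ?thesis using * T(3,4) by blast
      next
        case 2 then show ?thesis using packing_disjoint[OF G(1)] T(3,4) by blast
      next
        case 3 then show ?thesis using fG T(3,4) by blast
      next
        case 4 then show ?thesis using fG T(3,4) by blast
      qed
    qed
    then have "card (f ` J \<union> G) \<le> card (S0 \<union> D)"
      using exchange_le[OF S, of "S0 \<union> D"] S0S DS by blast
    moreover have "f ` J \<inter> G = {}"
    proof (rule ccontr)
      assume "f ` J \<inter> G \<noteq> {}"
      then obtain e where e: "e \<in> J" "f e \<in> G" by blast
      then show False using fG[OF e(1)] unfolding f_def by blast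
    qed
    moreover have "finite G"
    proof (rule packing_finite[OF _ G(1)])
      have "\<Union>D - {p, q} \<union> R \<subseteq> V" using DS(1) max_packing_subset[OF S] RV by blast
      then show "finite (\<Union>D - {p, q} \<union> R)" using finV finite_subset by blast
    qed
    ultimately have "card J + card G \<le> card (S0 \<union> D)"
      using finJ card_image[OF inj_f] by (simp add: card_Un_disjoint)
    moreover have "card (S0 \<union> D) \<le> card S0 + card D" by (rule card_Un_le)
    ultimately show False using J(3) G(2) by simp
  qed
  have DW: "\<exists>x\<in>T. x \<in> W" if "T \<in> D" for T using that unfolding D_def S0_def by blast
  have DS: "T \<in> S" if "T \<in> D" for T using that unfolding D_def by blast
  have xpq: "x \<notin> {p, q}" if "x \<in> W" for x using that p q QW by blast
  have D_cases: "T = T'" if "T \<in> D" "T' \<in> D" "p \<in> T \<longleftrightarrow> p \<in> T'" for T T'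
    using that max_packing_disjoint[OF S DS DS, of T T'] unfolding D_def by blast
  consider "D = {}" | T where "D = {T}" | T1 T2 where "D = {T1, T2}" "T1 \<noteq> T2" "p \<in> T1" "q \<in> T2"
  proof -
    assume a1: "D = {} \<Longrightarrow> thesis" and a2: "\<And>T. D = {T} \<Longrightarrow> thesis"
      and a3: "\<And>T1 T2. D = {T1, T2} \<Longrightarrow> T1 \<noteq> T2 \<Longrightarrow> p \<in> T1 \<Longrightarrow> q \<in> T2 \<Longrightarrow> thesis"
    show thesis
    proof (cases "\<exists>T1 \<in> D. \<exists>T2\<in>D. T1 \<noteq> T2")
      case False
      then have "D = {} \<or> (\<exists>T. D = {T})" by blast
      then show ?thesis using a1 a2 by blast
    next
      case True
      then obtain T1 T2 where T: "T1 \<in> D" "T2 \<in> D" "T1 \<noteq> T2" "p \<in> T1" "p \<notin> T2"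
        using D_cases by metis
      have "q \<in> T2" using T unfolding D_def by blast
      moreover have "D = {T1, T2}" using T D_cases by blast
      ultimately show ?thesis using a3 T by blast
    qed
  qed
  then show False
  proof cases
    case 1
    then show False using finish[of "{}"] packing_empty by simp
  next
    case (2 T)
    then obtain x where x: "x \<in> T" "x \<in> W" using DW by blast
    obtain r r' where r: "r \<in> R" "r' \<in> R" "cut x r \<noteq> cut x r'" using mixed x(2) by blast
    have "packing ((\<Union>D - {p, q}) \<union> R) {{x, r, r'}}"
      using Wgull[OF x(2) r] x r xpq[OF x(2)] 2 by (intro packingI) auto
    moreover have "card ({x, r, r'} \<inter> R) \<le> 3"
      by (rule order_trans[OF card_mono[of "{x, r, r'}"]]) (auto simp: card_insert_if)
    ultimately show False using finish[of "{{x, r, r'}}"] 2 by simp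
  next
    case (3 T1 T2)
    have third: "\<exists>x p1 v1. T = {x, c, p1} \<and> x \<in> W \<and> p1 \<in> Q v1 \<and> x \<noteq> c \<and> x \<noteq> p1 \<and> c \<noteq> p1"
      if T: "T \<in> D" "c \<in> T" "c \<in> {p, q}" for T c
    proof -
      obtain x where x: "x \<in> T" "x \<in> W" using DW[OF T(1)] by blast
      have "card T = 3" using card_gull max_packing_gull[OF S DS[OF T(1)]] by blast
      moreover have "x \<noteq> c" using xpq[OF x(2)] T(3) by blast
      ultimately have "card (T - {x, c}) = 1"
        using x T(2) by (simp add: card_Diff_subset)
      then obtain p1 where p1: "T - {x, c} = {p1}" using card_1_singletonE by blast
      have "p1 \<notin> W" using one_mixed[OF DS[OF T(1)] x(1) _ x(2), of p1] p1 by blast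
      moreover have "p1 \<in> V" using p1 max_packing_subset[OF S DS[OF T(1)]] by blast
      ultimately obtain v1 where "p1 \<in> Q v1" using notW by blast
      moreover have "T = {x, c, p1}" using p1 x T(2) by blast
      moreover have "x \<noteq> p1" "c \<noteq> p1" using p1 by blast+
      ultimately show ?thesis using x \<open>x \<noteq> c\<close> by blast
    qed
    have TD: "T1 \<in> D" "T2 \<in> D" using 3 by auto
    obtain x p1 v1 where x: "T1 = {x, p, p1}" "x \<in> W" "p1 \<in> Q v1" "x \<noteq> p" "x \<noteq> p1" "p \<noteq> p1"
      using third[OF TD(1) 3(3)] by blast
    obtain y q1 v2 where y: "T2 = {y, q, q1}" "y \<in> W" "q1 \<in> Q v2" "y \<noteq> q" "y \<noteq> q1" "q \<noteq> q1"
      using third[OF TD(2) 3(4)] by blast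
    have T12: "T1 \<inter> T2 = {}" using max_packing_disjoint[OF S DS[OF TD(1)] DS[OF TD(2)]] 3(2) by blast
    have TR: "T1 \<inter> R = {}" "T2 \<inter> R = {}"
      using leftover_disjoint[OF DS[OF TD(1)]] leftover_disjoint[OF DS[OF TD(2)]] unfolding R_def by blast+
    have gx: "gull {x, p1, c}" if c: "c \<in> R" "cut x c \<noteq> (v1 \<noteq> E x p1)" for c
    proof -
      have "c \<noteq> p1" "x \<noteq> c" using c TR x(1) by auto
      then show ?thesis
        using crossing[OF x(3) RQ[OF c(1)]] QE[OF x(3) c(1)] x(5) c unfolding cut_def by blast
    qed
    have gy: "gull {y, q1, c}" if c: "c \<in> R" "cut y c \<noteq> (v2 \<noteq> E y q1)" for c
    proof -
      have "c \<noteq> q1" "y \<noteq> c" using c TR y(1) by auto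
      then show ?thesis
        using crossing[OF y(3) RQ[OF c(1)]] QE[OF y(3) c(1)] y(5) c unfolding cut_def by blast
    qed
    show False
    \<comment> \<open>Since the cuts are not constant, some leftover \<open>c\<close> completes
      \<open>{x, p1}\<close> to a gull and some \<open>d\<close> completes \<open>{y, q1}\<close>.
      If they cannot be chosen distinct, a single vertex is the only choice for both, so both cuts
      isolate it.\<close>
    proof (cases "\<exists>c\<in>R. \<exists>d\<in>R. c \<noteq> d \<and> cut x c \<noteq> (v1 \<noteq> E x p1) \<and> cut y d \<noteq> (v2 \<noteq> E y q1)")
      case True
      then obtain c d where cd: "c \<in> R" "d \<in> R" "c \<noteq> d" "cut x c \<noteq> (v1 \<noteq> E x p1)"
        "cut y d \<noteq> (v2 \<noteq> E y q1)" by blast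
      have dj: "{x, p1, c} \<inter> {y, q1, d} = {}" using T12 TR cd x(1) y(1) by auto
      then have neq: "{x, p1, c} \<noteq> {y, q1, d}" by auto
      have "p1 \<notin> {p, q}" "q1 \<notin> {p, q}" "x \<notin> {p, q}" "y \<notin> {p, q}"
        using x y T12 xpq by auto
      then have "packing ((\<Union>D - {p, q}) \<union> R) {{x, p1, c}, {y, q1, d}}"
        using gx[OF cd(1,4)] gy[OF cd(2,5)] dj x(1) y(1) 3(1) cd(1,2)
        by (intro packingI) auto
      moreover have "(\<Union>{{x, p1, c}, {y, q1, d}}) \<inter> R \<subseteq> {c, d}" using TR x(1) y(1) by auto
      then have "card ((\<Union>{{x, p1, c}, {y, q1, d}}) \<inter> R) \<le> card {c, d}" by (intro card_mono) auto
      then have "card ((\<Union>{{x, p1, c}, {y, q1, d}}) \<inter> R) \<le> 3" using cd(3) by simp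
      moreover have "card {{x, p1, c}, {y, q1, d}} = card D" using neq 3(1,2) by simp
      ultimately show False using finish by blast
    next
      case False
      then have no: "cut x c = (v1 \<noteq> E x p1) \<or> cut y d = (v2 \<noteq> E y q1)"
        if "c \<in> R" "d \<in> R" "c \<noteq> d" for c d
        using that by meson
      obtain c where c: "c \<in> R" "cut x c \<noteq> (v1 \<noteq> E x p1)" using mixed[OF x(2)] by blast
      obtain d where d: "d \<in> R" "cut y d \<noteq> (v2 \<noteq> E y q1)" using mixed[OF y(2)] by blast
      have "c = d" using no[of c d] c d by blast
      have isox: "\<forall>r\<in>R - {c}. cut x r \<noteq> cut x c"
      proof
        fix r assume "r \<in> R - {c}"
        then have "cut x r = (v1 \<noteq> E x p1)"
          using no[of r c] d \<open>c = d\<close> by auto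
        then show "cut x r \<noteq> cut x c" using c(2) by simp
      qed
      have isoy: "\<forall>r\<in>R - {c}. cut y r \<noteq> cut y c"
      proof
        fix r assume "r \<in> R - {c}"
        then have "cut y r = (v2 \<noteq> E y q1)"
          using no[of c r] c by auto
        then show "cut y r \<noteq> cut y c" using d(2) \<open>c = d\<close> by simp
      qed
      obtain c2 where c2: "c2 \<in> R" "(c2 \<in> A) = (c \<in> A)" "c2 \<noteq> c" using same by blast
      obtain b where b: "b \<in> R" "(b \<in> A) \<noteq> (c \<in> A)" using opp by blast
      have Ex: "E x c2" "\<not> E x c" using isolated[OF c(1) isox c2(1,3,2) b] by auto
      have Ey: "E y c2" "\<not> E y c" using isolated[OF c(1) isoy c2(1,3,2) b] by auto
      have "gull {x, p, p1}" "gull {y, q, q1}"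
        using max_packing_gull[OF S DS[OF TD(1)]] max_packing_gull[OF S DS[OF TD(2)]] x(1) y(1) by auto
      moreover have "True = v1 \<or> E p p1" "False = v2 \<or> E q q1"
        using mixed_gull_adj[OF DS[OF TD(1)] _ x(2) _ _ p(3) x(3)] x(1)
          mixed_gull_adj[OF DS[OF TD(2)] _ y(2) _ _ q(3) y(3)] y(1) by auto
      ultimately have "(True \<noteq> E x p) \<noteq> (v1 \<noteq> E x p1)" "(False \<noteq> E y q) \<noteq> (v2 \<noteq> E y q1)"
        using crossing[OF p(3) x(3)] crossing[OF q(3) y(3)] x(4-6) y(4-6) by blast+
      then have kx: "cut x c = (\<not> E x p)" and ky: "cut y c = E y q" using c d \<open>c = d\<close> by blast+
      have "c2 \<noteq> p" "c2 \<noteq> q" using c2(1) TR x(1) y(1) by auto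
      then have "E p c2 \<longleftrightarrow> c2 \<notin> A" "E q c2 \<longleftrightarrow> c2 \<in> A" using QE[OF p(3) c2(1)] QE[OF q(3) c2(1)] by auto
      moreover have "cut x c \<longleftrightarrow> c2 \<in> A" "cut y c \<longleftrightarrow> c2 \<in> A" unfolding cut_def using Ex Ey c2(2) by auto
      \<comment> \<open>If \<open>c2\<close> lies in \<open>A\<close>, then \<open>y\<close>,
        \<open>q\<close>, \<open>c2\<close> form a triangle; otherwise \<open>x\<close>,
        \<open>p\<close>, \<open>c2\<close> do.\<close>
      ultimately show False using kx ky Ex Ey no_triangle sym by blast
    qed
  qed
qed

end

section \<open>The five-cycle with an isolated vertex\<close>

context triangle_free
begin

lemma packing_triple:
  assumes "gull G1" "gull G2" "gull G3" "G1 \<inter> G2 = {}" "G1 \<inter> G3 = {}" "G2 \<inter> G3 = {}"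
    "G1 \<union> G2 \<union> G3 \<subseteq> U"
  shows "\<exists>Y. packing U Y \<and> card Y = 3"
proof -
  have "G1 \<noteq> G2" "G1 \<noteq> G3" "G2 \<noteq> G3" using assms(1-6) gull_nonempty by auto
  then have "card {G1, G2, G3} = 3" by simp
  moreover have "packing U {G1, G2, G3}"
    using assms unfolding packing_def by (auto simp: pairwise_insert disjnt_def)
  ultimately show ?thesis by blast
qed

text \<open>
  The complement of a five-wheel is a five-cycle with an isolated vertex. It has six vertices but no
  two disjoint gulls, and it is the only obstacle that the counting arguments do not see.
\<close>

lemma five_wheel_plus_gull_aux:
  assumes C: "E c p" "E p q" "E q r" "E r s" "E s c"
    and v: "\<not> E c v" "\<not> E p v" "\<not> E q v" "\<not> E r v" "\<not> E s v"
    and xyz: "E x y" "\<not> E x z" "\<not> E y z"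
    and d: "{c, p, q, r, s, v} \<inter> {x, y, z} = {}" "v \<notin> {c, p, q, r, s}"
    and xc: "\<not> E x c" "\<not> E y c"
  shows "\<exists>Y. packing {c, p, q, r, s, v, x, y, z} Y \<and> card Y = 3"
proof -
  let ?U = "{c, p, q, r, s, v, x, y, z}"
  have C': "\<not> E c q" "\<not> E c r" "\<not> E p r" "\<not> E p s" "\<not> E q s"
    "E p c" "E q p" "E r q" "E s r" "E c s" "E y x"
    using C xyz no_triangle sym by blast+
  have C'': "\<not> E q c" "\<not> E r c" "\<not> E r p" "\<not> E s p" "\<not> E s q" using C' sym by blast+
  have dist: "distinct [c, p, q, r, s, v, x, y, z]"
    using d C C' xyz irrefl by auto
  have P: ?thesis if "E a b" "\<not> E a e" "\<not> E b e" "E a' b'" "\<not> E a' e'" "\<not> E b' e'"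
    "E a'' b''" "\<not> E a'' e''" "\<not> E b'' e''"
    "distinct [a, b, e, a', b', e', a'', b'', e'']"
    "set [a, b, e, a', b', e', a'', b'', e''] \<subseteq> ?U" for a b e a' b' e' a'' b'' e''
    using that by (intro packing_triple[of "{a, b, e}" "{a', b', e'}" "{a'', b'', e''}"] gullI) auto
  \<comment> \<open>Unless \<open>z\<close> is adjacent to both \<open>p\<close> and
    \<open>s\<close>, the gull \<open>{x, y, c}\<close> can be kept while the path
    \<open>p q r s\<close> together with \<open>v\<close> and \<open>z\<close> splits into two
    gulls.\<close>
  consider "\<not> E z r" "\<not> E z s" | "\<not> E z p" "\<not> E z q" | "E z p" "E z r" | "E z q" "E z s" | "E z p" "E z s"
    using C no_triangle sym by blast
  then show ?thesis
  proof cases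
    case 1
    then show ?thesis using P[of x y c p q v r s z] xyz xc C v dist sym_iff by auto
  next
    case 2
    then show ?thesis using P[of x y c r s v p q z] xyz xc C v dist sym_iff by auto
  next
    case 3
    then have "\<not> E z s" using C no_triangle sym by blast
    then show ?thesis using P[of x y c z p s q r v] 3 xyz xc C C' v dist sym_iff by auto
  next
    case 4
    then have "\<not> E z p" using C no_triangle sym by blast
    then show ?thesis using P[of x y c z s p q r v] 4 xyz xc C C' C'' v dist sym_iff by auto
  next
    case 5
    then have z: "\<not> E z q" "\<not> E z r" "\<not> E z c" using C no_triangle sym by blast+
    have z': "\<not> E q z" "\<not> E r z" "\<not> E c z" using z sym by blast+
    show ?thesis
    proof (cases "E v z")
      case True
      then show ?thesis using P[of x y c v z q r s p] z 5 xyz xc C C' C'' v dist sym_iff by auto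
    next
      case False
      \<comment> \<open>Either some vertex of the path \<open>p q r s\<close> is nonadjacent to both
        \<open>x\<close> and \<open>y\<close>, or its vertices are adjacent to \<open>x\<close> and
        \<open>y\<close> alternately.\<close>
      consider "\<not> E x q" "\<not> E y q" | "\<not> E x p" "\<not> E y p" | "\<not> E x s" "\<not> E y s" | "\<not> E x r" "\<not> E y r"
        | "E x p" "E y q" "E x r" "E y s" | "E y p" "E x q" "E y r" "E x s"
        using C C' xyz no_triangle by (meson sym)
      then show ?thesis
      proof cases
        case 1
        then show ?thesis using P[of x y q z p r s c v] z 5 xyz xc C C' C'' v dist by auto
      next
        case 2
        then show ?thesis using P[of x y p s c v q r z] z' 5 xyz xc C C' C'' v dist by auto
      next
        case 3
        then show ?thesis using P[of x y s c p v q r z] z' 5 xyz xc C C' C'' v dist by auto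
      next
        case 4
        then show ?thesis using P[of x y r z s q c p v] z 5 xyz xc C C' C'' v dist by auto
      next
        case a: 5
        have "\<not> E z y" "\<not> E p y" "\<not> E c x" "\<not> E s x" using a xyz xc no_triangle sym by blast+
        then show ?thesis using P[of z p y c s x q r v] 5 C C' v dist by auto
      next
        case a: 6
        have "\<not> E z x" "\<not> E p x" "\<not> E c y" "\<not> E s y" using a xyz xc no_triangle sym by blast+
        then show ?thesis using P[of z p x c s y q r v] 5 C C' v dist by auto
      qed
    qed
  qed
qed

text \<open>The neighbourhoods of the adjacent vertices \<open>x\<close> and \<open>y\<close> are
  disjoint and independent. An odd cycle is not the union of two independent sets, so some cycle
  vertex is adjacent to neither; a rotation makes it the vertex \<open>c\<close> of the auxiliary
  lemma.\<close>

lemma five_wheel_plus_gull: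
  assumes C: "E c p" "E p q" "E q r" "E r s" "E s c"
    and v: "\<not> E c v" "\<not> E p v" "\<not> E q v" "\<not> E r v" "\<not> E s v"
    and xyz: "E x y" "\<not> E x z" "\<not> E y z"
    and d: "{c, p, q, r, s, v} \<inter> {x, y, z} = {}" "v \<notin> {c, p, q, r, s}"
  shows "\<exists>Y. packing {c, p, q, r, s, v, x, y, z} Y \<and> card Y = 3"
proof -
  have "\<not> (E x a \<and> E x b)" "\<not> (E y a \<and> E y b)" "\<not> (E x a \<and> E y a)" if "E a b" for a b
    using that xyz(1) no_triangle sym by blast+
  then consider "\<not> E x c" "\<not> E y c" | "\<not> E x p" "\<not> E y p" | "\<not> E x q" "\<not> E y q"
    | "\<not> E x r" "\<not> E y r" | "\<not> E x s" "\<not> E y s"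
    using C by metis
  then show ?thesis
  proof cases
    case 1
    show ?thesis by (rule five_wheel_plus_gull_aux[OF C v xyz d 1])
  next
    case 2
    have "\<exists>Y. packing {p, q, r, s, c, v, x, y, z} Y \<and> card Y = 3"
      using d by (intro five_wheel_plus_gull_aux[OF C(2-5,1) v(2-5,1) xyz _ _ 2]) auto
    moreover have "{p, q, r, s, c, v, x, y, z} = {c, p, q, r, s, v, x, y, z}" by auto
    ultimately show ?thesis by simp
  next
    case 3
    have "\<exists>Y. packing {q, r, s, c, p, v, x, y, z} Y \<and> card Y = 3"
      using d by (intro five_wheel_plus_gull_aux[OF C(3-5,1,2) v(3-5,1,2) xyz _ _ 3]) auto
    moreover have "{q, r, s, c, p, v, x, y, z} = {c, p, q, r, s, v, x, y, z}" by auto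
    ultimately show ?thesis by simp
  next
    case 4
    have "\<exists>Y. packing {r, s, c, p, q, v, x, y, z} Y \<and> card Y = 3"
      using d by (intro five_wheel_plus_gull_aux[OF C(4,5,1-3) v(4,5,1-3) xyz _ _ 4]) auto
    moreover have "{r, s, c, p, q, v, x, y, z} = {c, p, q, r, s, v, x, y, z}" by auto
    ultimately show ?thesis by simp
  next
    case 5
    have "\<exists>Y. packing {s, c, p, q, r, v, x, y, z} Y \<and> card Y = 3"
      using d by (intro five_wheel_plus_gull_aux[OF C(5,1-4) v(5,1-4) xyz _ _ 5]) auto
    moreover have "{s, c, p, q, r, v, x, y, z} = {c, p, q, r, s, v, x, y, z}" by auto
    ultimately show ?thesis by simp
  qed
qed

end

section \<open>Leftovers inducing a star\<close>

context gull_deficit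
begin

text \<open>Both outcomes come from forbidding two disjoint gulls inside \<open>T\<close> and the
  star. If \<open>v\<close> has a neighbour in \<open>A\<close>, it is adjacent to all of
  \<open>A\<close>, and then so is \<open>u\<close> or \<open>w\<close>. Otherwise every leaf is
  adjacent to \<open>u\<close> or \<open>w\<close>, neither of these is adjacent to all leaves, and
  a third leaf would make a second gull possible; this leaves the five-cycle
  \<open>b a u w a'\<close> with \<open>v\<close> isolated.\<close>

lemma star_shape [consumes 7, case_names biclique wheel]:
  assumes S: "max_packing S" and R: "leftover S = insert b A" "b \<notin> A" "\<forall>a\<in>A. E b a" "card A \<ge> 2"
    and T: "T \<in> S" "\<forall>c\<in>T. \<not> E b c"
  obtains (biclique) u w v where "T = {u, w, v}" "E u w" "\<not> E u v" "\<not> E w v"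
      "\<And>a. a \<in> A \<Longrightarrow> E u a \<and> E v a \<and> \<not> E w a"
  | (wheel) u w v a a' where "T = {u, w, v}" "E u w" "\<not> E u v" "\<not> E w v" "A = {a, a'}" "a \<noteq> a'"
      "E u a" "E w a'" "\<not> E v a" "\<not> E v a'"
proof -
  have R3: "E b a" if "a \<in> A" for a using R(3) that by blast
  obtain u w v where uwv: "T = {u, w, v}" "E u w" "\<not> E u v" "\<not> E w v"
    using max_packing_gull[OF S T(1)] unfolding gull_def by blast
  have b: "\<not> E u b" "\<not> E w b" "\<not> E v b" using T(2) uwv(1) sym by auto
  have Aind: "\<not> E a a'" if "a \<in> A" "a' \<in> A" for a a'
    using R3[OF that(1)] R3[OF that(2)] no_triangle sym by blast
  have TR: "c \<notin> A" "c \<noteq> b" if "c \<in> T" for c using leftover_disjoint[OF T(1) that] R(1) by auto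
  have dist: "u \<noteq> w" "u \<noteq> v" "w \<noteq> v" using uwv irrefl sym by blast+
  have two: False if "E x1 x2" "\<not> E x1 x3" "\<not> E x2 x3" "E y1 y2" "\<not> E y1 y3" "\<not> E y2 y3"
    "{x1, x2, x3} \<inter> {y1, y2, y3} = {}" "{x1, x2, x3, y1, y2, y3} \<subseteq> T \<union> insert b A" for x1 x2 x3 y1 y2 y3
    using no_two_gulls[OF S T(1) gullI[OF that(1-3)] gullI[OF that(4-6)] that(7)] that(8) R(1) by auto
  have other: "\<exists>a'\<in>A. a' \<noteq> a" for a
    using ex_not_in_list[of "[a]" A] R(4) by simp
  then obtain a0 where a0: "a0 \<in> A" by blast
  have uv_dj: "\<not> (E u a \<and> E w a)" for a using uwv(2) no_triangle by blast
  show ?thesis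
  proof (cases "E v a0")
    case True
    have vA: "E v a" if "a \<in> A" for a
    proof (rule ccontr)
      assume "\<not> E v a"
      then show False
        using two[of u w b v a0 a] uwv b True a0 that Aind TR dist R(2) by auto
    qed
    have no: "E u a \<or> E w a'" if "a \<in> A" "a' \<in> A" "a \<noteq> a'" for a a'
    proof (rule ccontr)
      assume "\<not> ?thesis"
      then show False
        using two[of v a u b a' w] vA that uwv b R(2) R3 TR dist sym_iff by auto
    qed
    show ?thesis
    proof (cases "\<forall>a\<in>A. E u a")
      case full: True
      have "E u a \<and> E v a \<and> \<not> E w a" if "a \<in> A" for a using vA full uv_dj that by blast
      then show ?thesis using biclique[of u w v] uwv by blast
    next
      case False
      then obtain a1 where a1: "a1 \<in> A" "\<not> E u a1" by blast
      have w1: "E w a" if "a \<in> A" "a \<noteq> a1" for a using no[OF a1(1) that(1)] that(2) a1(2) by auto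
      have "E w a1"
      proof (rule ccontr)
        assume "\<not> E w a1"
        obtain a2 where "a2 \<in> A" "a2 \<noteq> a1" using other by blast
        then show False using no[of a2 a1] a1 \<open>\<not> E w a1\<close> w1[of a2] uv_dj by blast
      qed
      then have "E w a \<and> E v a \<and> \<not> E u a" if "a \<in> A" for a using w1 vA uv_dj that by blast
      moreover have "T = {w, u, v}" using uwv(1) by auto
      ultimately show ?thesis using biclique[of w u v] uwv sym by blast
    qed
  next
    case False
    have vA: "\<not> E v a" if "a \<in> A" for a
    proof
      assume "E v a"
      then show False
        using two[of u w b v a a0] uwv b False a0 that Aind TR dist R(2) by auto
    qed
    have cov: "E u a \<or> E w a" if a: "a \<in> A" for a
    proof (rule ccontr)
      assume "\<not> ?thesis"
      moreover obtain a' where "a' \<in> A" "a' \<noteq> a" using other by blast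
      ultimately show False
        using two[of b a' v u w a] a uwv b R(2) R3 vA TR dist sym_iff by auto
    qed
    have notfull: "\<exists>a\<in>A. \<not> E x a" if xy: "{x, y} = {u, w}" "x \<noteq> y" for x y
    proof (rule ccontr)
      assume "\<not> ?thesis"
      then have full: "\<And>a. a \<in> A \<Longrightarrow> E x a" by blast
      have xin: "x \<in> T" "y \<in> T" using xy uwv(1) by auto
      have "\<not> E x v" "x \<noteq> v" "y \<noteq> v" using xy uwv dist by (auto simp: doubleton_eq_iff)
      have "E x y" using xy uwv(2) sym by (auto simp: doubleton_eq_iff)
      have "\<not> E y b" using xy b by (auto simp: doubleton_eq_iff)
      have "\<not> E y a0" using full[OF a0] \<open>E x y\<close> no_triangle by blast
      obtain a' where a': "a' \<in> A" "a' \<noteq> a0" using other by blast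
      then show False
        using two[of b a0 y x a' v] a0 full vA R(2) R3 \<open>\<not> E x v\<close> \<open>\<not> E y b\<close> \<open>\<not> E y a0\<close> TR[OF xin(1)] TR[OF xin(2)]
          TR[of v] uwv(1) xy(2) \<open>y \<noteq> v\<close> \<open>x \<noteq> v\<close> xin sym_iff by auto
    qed
    obtain a2 where a2: "a2 \<in> A" "\<not> E u a2" using notfull[of u w] dist by blast
    obtain a1 where a1: "a1 \<in> A" "\<not> E w a1" using notfull[of w u] dist by (auto simp: insert_commute)
    have e: "E u a1" "E w a2" "a1 \<noteq> a2" using cov a1 a2 by blast+
    have "A = {a1, a2}"
    proof (rule ccontr)
      assume "A \<noteq> {a1, a2}"
      then obtain a3 where "a3 \<in> A" "a3 \<noteq> a1" "a3 \<noteq> a2" using a1 a2 by blast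
      then show False
        using two[of u a1 a2 b a3 v] a1 a2 e Aind vA R(2) R3 b uwv(1) TR dist sym_iff by auto
    qed
    then show ?thesis using wheel[of u w v a1 a2] uwv e vA a1 a2 by blast
  qed
qed

text \<open>\<open>T\<close> and the leftover form a five-cycle with an isolated vertex. Any further
  gull would combine with it into three gulls instead of two; without one, \<open>t = 1\<close>,
  \<open>k = 2\<close> and \<open>s = 0\<close>, the case excluded by
  \<open>no_five_cycle\<close>.\<close>

lemma no_wheel_leftover:
  assumes S: "max_packing S" and R: "leftover S = {b, a, a'}" "E b a" "E b a'" "a \<noteq> a'"
    and T: "T \<in> S" "\<And>c. c \<in> T \<Longrightarrow> \<not> E b c" "T = {u, w, v}" "E u w" "\<not> E u v" "\<not> E w v"
    and ua: "E u a" "E w a'" "\<not> E v a" "\<not> E v a'"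
  shows False
proof -
  have TR: "T \<inter> {b, a, a'} = {}" using leftover_disjoint[OF T(1)] R(1) by blast
  have C: "E b a" "E a u" "E u w" "E w a'" "E a' b" using R ua T sym by blast+
  have v: "\<not> E b v" "\<not> E a v" "\<not> E u v" "\<not> E w v" "\<not> E a' v" using T ua sym by blast+
  show False
  proof (cases "\<exists>T'\<in>S. T' \<noteq> T")
    case True
    then obtain T' where T': "T' \<in> S" "T' \<noteq> T" by blast
    obtain x y z where xyz: "T' = {x, y, z}" "E x y" "\<not> E x z" "\<not> E y z"
      using max_packing_gull[OF S T'(1)] unfolding gull_def by blast
    have "T \<inter> T' = {}" using max_packing_disjoint[OF S T(1) T'(1)] T'(2) by blast
    moreover have "T' \<inter> {b, a, a'} = {}" using leftover_disjoint[OF T'(1)] R(1) by blast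
    ultimately have "{b, a, u, w, a', v} \<inter> {x, y, z} = {}" using xyz(1) T(3) by auto
    moreover have "v \<notin> {b, a, u, w, a'}" using T TR irrefl sym by auto
    ultimately obtain Y where Y: "packing {b, a, u, w, a', v, x, y, z} Y" "card Y = 3"
      using five_wheel_plus_gull[OF C v xyz(2-4)] by blast
    have "{b, a, u, w, a', v, x, y, z} = \<Union>{T, T'} \<union> leftover S" using R(1) T(3) xyz(1) by auto
    then have "card Y \<le> card {T, T'}" using exchange_le[OF S, of "{T, T'}"] Y(1) T(1) T'(1) by simp
    then show False using Y(2) T'(2) by simp
  next
    case False
    then have "S = {T}" using T(1) by blast
    then have "t = 1" using S unfolding max_packing_def by auto
    have "b \<noteq> a" "b \<noteq> a'" using R(2,3) irrefl by blast+
    then have "card (leftover S) = 3" using R(1,4) by simp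
    then have "k = 2" "s = 0" using card_leftover[OF S] \<open>t = 1\<close> t_less by auto
    moreover have "{b, a, u, w, a'} \<subseteq> V"
      using R(1) max_packing_subset[OF S T(1)] T(3) unfolding leftover_def by blast
    ultimately show False using no_five_cycle[of b a u w a'] C by blast
  qed
qed

lemma card_neighbours_split:
  assumes S: "max_packing S" "X \<subseteq> S" and P: "finite P"
  shows "card (P \<inter> \<Union>X) = (\<Sum>T\<in>X. card (T \<inter> P))"
proof -
  have "P \<inter> \<Union>X = (\<Union>T\<in>X. T \<inter> P)" by blast
  also have "card \<dots> = (\<Sum>T\<in>X. card (T \<inter> P))"
  proof (rule card_UN_disjoint)
    show "finite X" using S max_packing_finite finite_subset by blast
    show "\<forall>T\<in>X. finite (T \<inter> P)" using P by simp
    show "\<forall>T\<in>X. \<forall>T'\<in>X. T \<noteq> T' \<longrightarrow> (T \<inter> P) \<inter> (T' \<inter> P) = {}"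
      using max_packing_disjoint[OF S(1)] S(2) by blast
  qed
  finally show ?thesis .
qed

text \<open>By the degree bound some gull \<open>T\<close> avoids the neighbours of
  \<open>b\<close>. Once the wheel is excluded, two vertices \<open>u\<close>, \<open>v\<close> of
  \<open>T\<close> are adjacent to all of \<open>A\<close>. With three or more leaves, one swap
  produces a two-sided leftover; with two leaves, the degrees of \<open>b\<close> and
  \<open>a1\<close> are bounded together.\<close>

lemma no_star_leftover:
  assumes S: "max_packing S" and R: "leftover S = insert b A" "b \<notin> A" "\<And>a. a \<in> A \<Longrightarrow> E b a"
  shows False
proof -
  have finA: "finite A" using finite_leftover[of S] R(1) by simp
  have cA: "Suc (card A) = 3 * (k - t) + s" using card_leftover[OF S] R(1,2) finA by simp
  then have cA2: "card A \<ge> 2" using t_less by simp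
  have bV: "b \<in> V" "A \<subseteq> V" using R(1) unfolding leftover_def by blast+
  have "\<exists>T\<in>S. \<forall>c\<in>T. \<not> E b c"
  proof (rule ccontr)
    assume "\<not> ?thesis"
    then have "\<And>T. T \<in> S \<Longrightarrow> \<exists>c. c \<in> T \<and> E b c" by blast
    then obtain h where h: "\<And>T. T \<in> S \<Longrightarrow> h T \<in> T \<and> E b (h T)" by metis
    have "inj_on h S" by (rule inj_onI) (metis h max_packing_disjoint[OF S])
    then have "card (h ` S) = t" using S card_image unfolding max_packing_def by metis
    moreover have "h ` S \<inter> A = {}" using h leftover_disjoint R(1) by blast
    moreover have "finite (h ` S)" using max_packing_finite[OF S] by simp
    ultimately have "card (h ` S \<union> A) = t + card A" using finA by (simp add: card_Un_disjoint)
    moreover have "h ` S \<union> A \<subseteq> {y \<in> V. E b y}" using h R(3) bV max_packing_subset[OF S] by blast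
    then have "card (h ` S \<union> A) \<le> card {y \<in> V. E b y}" using finV by (intro card_mono) auto
    ultimately show False using degree[OF bV(1)] cA t_less by simp
  qed
  then obtain T where T: "T \<in> S" "\<And>c. c \<in> T \<Longrightarrow> \<not> E b c" by blast
  have TR: "T \<inter> insert b A = {}" using leftover_disjoint[OF T(1)] R(1) by blast
  have RA: "\<forall>a\<in>A. E b a" and Tb: "\<forall>c\<in>T. \<not> E b c" using R(3) T(2) by auto
  from S R(1,2) RA cA2 T(1) Tb show False
  proof (cases rule: star_shape)
    case (wheel u w v a a')
    then show False
      using no_wheel_leftover[of S b a a' T u w v] S R T by auto
  next
    case (biclique u w v)
    note B = this
    have b: "\<not> E u b" "\<not> E w b" "\<not> E v b" using T(2) B(1) sym by auto
    have dist: "u \<noteq> w" "u \<noteq> v" "w \<noteq> v" using B irrefl sym by blast+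
    show False
    proof (cases "card A \<ge> 3")
      case True
      obtain a where a: "a \<in> A" using True by (metis all_not_in_conv card.empty not_numeral_le_zero)
      have g: "gull {b, a, w}" using R(3)[OF a] b B(5)[OF a] sym by (intro gullI) blast+
      have sub: "{b, a, w} \<subseteq> T \<union> leftover S" using B(1) a R(1) by auto
      note sw = swap[OF S T(1) g sub]
      have "leftover (insert {b, a, w} (S - {T})) = (A - {a}) \<union> {u, v}"
        using sw(2) R(1,2) B(1) TR dist a by auto
      moreover have "E x y" if "x \<in> A - {a}" "y \<in> {u, v}" for x y
        using that B(5) sym by blast
      moreover have "card (A - {a}) \<ge> 2" "card {u, v} \<ge> 2" using True a dist by auto
      ultimately show False
        using no_two_sided_leftover[OF sw(1), of "A - {a}" "{u, v}"] by blast
    next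
      case False
      then have "card A = 2" using cA2 by simp
      then obtain a1 a2 where A: "A = {a1, a2}" "a1 \<noteq> a2" by (meson card_2_iff)
      have kt: "k = Suc t" "s = 0" using cA \<open>card A = 2\<close> t_less by auto
      define Nb where "Nb = {y \<in> V. E b y}"
      define Na where "Na = {y \<in> V. E a1 y}"
      have finN: "finite Nb" "finite Na" unfolding Nb_def Na_def using finV by auto
      \<comment> \<open>A gull avoiding the neighbours of \<open>b\<close> contains two neighbours
        of \<open>a1\<close> by \<open>star_shape\<close>. For a gull avoiding the neighbours of
        \<open>a1\<close>, replacing \<open>T\<close> by \<open>{v, a2, w}\<close> first turns the
        leftover into a star with centre \<open>a1\<close> and leaves \<open>b\<close>,
        \<open>u\<close>.\<close>
      have hits: "2 \<le> card (T' \<inter> Nb) + card (T' \<inter> Na)" if T': "T' \<in> S - {T}" for T'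
      proof -
        have T'S: "T' \<in> S" using T' by blast
        have T'V: "T' \<subseteq> V" using max_packing_subset[OF S T'S] .
        have pos: "card (T' \<inter> X) \<ge> 1" if "T' \<inter> X \<noteq> {}" "finite X" for X
          using that by (simp add: Suc_leI card_gt_0_iff)
        have two: "card (T' \<inter> X) \<ge> 2" if "x \<in> T' \<inter> X" "y \<in> T' \<inter> X" "x \<noteq> y" "finite X" for x y X
        proof -
          have "card {x, y} \<le> card (T' \<inter> X)" using that by (intro card_mono) auto
          then show ?thesis using that(3) by simp
        qed
        consider "T' \<inter> Nb = {}" | "T' \<inter> Na = {}" | "T' \<inter> Nb \<noteq> {}" "T' \<inter> Na \<noteq> {}" by blast
        then show ?thesis
        proof cases
          case 1
          then have anti: "\<And>c. c \<in> T' \<Longrightarrow> \<not> E b c" using T'V unfolding Nb_def by blast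
          then have anti': "\<forall>c\<in>T'. \<not> E b c" by blast
          from S R(1,2) RA cA2 T'S anti' show ?thesis
          proof (cases rule: star_shape)
            case (wheel u' w' v' a a')
            then show ?thesis using no_wheel_leftover[of S b a a' T' u' w' v'] S R T'S anti by auto
          next
            case (biclique u' w' v')
            then have "u' \<in> T' \<inter> Na" "v' \<in> T' \<inter> Na" "u' \<noteq> v'"
              using A T'V sym unfolding Na_def by auto
            then show ?thesis using two finN(2) by fastforce
          qed
        next
          case 2
          then have anti: "\<And>c. c \<in> T' \<Longrightarrow> \<not> E a1 c" using T'V unfolding Na_def by blast
          have g: "gull {v, a2, w}" using B A sym by (intro gullI) auto
          have sub: "{v, a2, w} \<subseteq> T \<union> leftover S" using B(1) A R(1) by auto
          note sw = swap[OF S T(1) g sub]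
          have R': "leftover (insert {v, a2, w} (S - {T})) = insert a1 {b, u}"
            using sw(2) R(1,2) B(1) TR dist A by auto
          have a1: "a1 \<notin> {b, u}" "\<And>a. a \<in> {b, u} \<Longrightarrow> E a1 a" "b \<noteq> u"
            using A R(2,3) B(1,5) TR sym by auto
          have c2: "card {b, u} \<ge> 2" using a1(3) by simp
          have T'': "T' \<in> insert {v, a2, w} (S - {T})" using T' by blast
          have a1': "\<forall>a\<in>{b, u}. E a1 a" and anti': "\<forall>c\<in>T'. \<not> E a1 c" using a1(2) anti by auto
          from sw(1) R' a1(1) a1' c2 T'' anti' show ?thesis
          proof (cases rule: star_shape)
            case (wheel u' w' v' a a')
            have Rw: "leftover (insert {v, a2, w} (S - {T})) = {a1, a, a'}" using R' wheel(5) by simp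
            have Ea: "E a1 a" "E a1 a'" using a1(2) wheel(5) by auto
            have False
              by (rule no_wheel_leftover[OF sw(1) Rw Ea wheel(6) T'' anti wheel(1-4) wheel(7-10)])
            then show ?thesis ..
          next
            case (biclique u' w' v')
            then have "u' \<in> T' \<inter> Nb" "v' \<in> T' \<inter> Nb" "u' \<noteq> v'"
              using T'V sym unfolding Nb_def by auto
            then show ?thesis using two finN(1) by fastforce
          qed
        next
          case 3
          then show ?thesis using pos[of Nb] pos[of Na] finN by simp
        qed
      qed
      have sum: "2 * (t - 1) \<le> card (Nb \<inter> \<Union>(S - {T})) + card (Na \<inter> \<Union>(S - {T}))"
      proof -
        have "card (S - {T}) = t - 1" using T(1) S max_packing_finite[OF S] unfolding max_packing_def by simp
        then have "2 * (t - 1) = (\<Sum>T'\<in>S - {T}. 2)" by simp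
        also have "\<dots> \<le> (\<Sum>T'\<in>S - {T}. card (T' \<inter> Nb) + card (T' \<inter> Na))"
          using hits by (rule sum_mono)
        also have "\<dots> = card (Nb \<inter> \<Union>(S - {T})) + card (Na \<inter> \<Union>(S - {T}))"
          using card_neighbours_split[OF S _ finN(1), of "S - {T}"] card_neighbours_split[OF S _ finN(2), of "S - {T}"]
          by (simp add: sum.distrib)
        finally show ?thesis .
      qed
      have sep: "(\<Union>(S - {T})) \<inter> (T \<union> leftover S) = {}"
        using max_packing_disjoint[OF S _ T(1)] unfolding leftover_def by blast
      have "card (Nb \<inter> \<Union>(S - {T})) + 2 \<le> k + s"
      proof -
        have sub: "(Nb \<inter> \<Union>(S - {T})) \<union> {a1, a2} \<subseteq> Nb" using R(3) A bV unfolding Nb_def by auto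
        have "card ((Nb \<inter> \<Union>(S - {T})) \<union> {a1, a2}) = card (Nb \<inter> \<Union>(S - {T})) + card {a1, a2}"
          using finN sep R(1) A by (intro card_Un_disjoint) auto
        then show ?thesis using card_mono[OF finN(1) sub] degree[OF bV(1)] A(2) unfolding Nb_def by simp
      qed
      moreover have "card (Na \<inter> \<Union>(S - {T})) + 3 \<le> k + s"
      proof -
        have "{b, u, v} \<subseteq> Na"
          using R(3) A bV B(1,5) max_packing_subset[OF S T(1)] sym unfolding Na_def by auto
        then have sub: "(Na \<inter> \<Union>(S - {T})) \<union> {b, u, v} \<subseteq> Na" by auto
        have "card ((Na \<inter> \<Union>(S - {T})) \<union> {b, u, v}) = card (Na \<inter> \<Union>(S - {T})) + card {b, u, v}"
          using finN sep R(1) B(1) by (intro card_Un_disjoint) auto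
        moreover have "card {b, u, v} = 3" using TR B(1) dist by auto
        moreover have "a1 \<in> V" using A bV by auto
        ultimately show ?thesis using card_mono[OF finN(2) sub] degree[of a1] unfolding Na_def by simp
      qed
      moreover have "t \<ge> 1" using T(1) S max_packing_finite[OF S] unfolding max_packing_def
        by (metis One_nat_def Suc_leI card_gt_0_iff empty_iff)
      \<comment> \<open>Outside the other \<open>t - 1\<close> gulls \<open>b\<close> has two
        neighbours and \<open>a1\<close> has three, so at most \<open>2k - 5 = 2t - 3\<close>
        incidences remain where \<open>2 (t - 1)\<close> are needed.\<close>
      ultimately show False using sum kt by linarith
    qed
  qed
qed

text \<open>The leftover contains no gull, so each of its vertices is adjacent to exactly one end of
  an edge \<open>a0 b0\<close>. The same reasoning for the edge \<open>a b0\<close> with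
  \<open>a\<close> in \<open>A\<close> joins \<open>A\<close> completely to
  \<open>B\<close>.\<close>

lemma no_deficit:
  assumes N0: "N0 \<subseteq> edges V" "pair_matching N0" "card N0 = Suc t"
  shows False
proof -
  obtain S where S: "max_packing S" "\<not> indep (leftover S)" using exists_leftover_edge[OF N0] by blast
  then obtain a0 b0 where ab: "a0 \<in> leftover S" "b0 \<in> leftover S" "E a0 b0" unfolding indep_def by blast
  have nogull: False if "E x y" "\<not> E x z" "\<not> E y z" "{x, y, z} \<subseteq> leftover S" for x y z
    using exchange_le[OF S(1), of "{}" "{{x, y, z}}"] gullI[OF that(1-3)] that(4)
    unfolding packing_def by simp
  define A where "A = {x \<in> leftover S. E x b0}"
  define B where "B = {x \<in> leftover S. E x a0}"
  have ABin: "a0 \<in> A" "b0 \<in> B" using ab sym unfolding A_def B_def by auto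
  have R: "leftover S = A \<union> B"
  proof
    show "leftover S \<subseteq> A \<union> B"
    proof
      fix x assume "x \<in> leftover S"
      then show "x \<in> A \<union> B" using nogull[of a0 b0 x] ab sym_iff unfolding A_def B_def by auto
    qed
  qed (auto simp: A_def B_def)
  have comp: "E a b" if "a \<in> A" "b \<in> B" for a b
  proof (rule ccontr)
    assume "\<not> E a b"
    moreover have "\<not> E b0 b" using that(2) ab(3) no_triangle sym unfolding B_def by blast
    ultimately show False using nogull[of a b0 b] that ab unfolding A_def B_def by auto
  qed
  have dj: "A \<inter> B = {}" using comp irrefl by blast
  have fin: "finite A" "finite B" using finite_leftover[of S] R by auto
  show False
  proof (cases "card A \<ge> 2 \<and> card B \<ge> 2")
    case True
    then show False using no_two_sided_leftover[OF S(1) R comp] by blast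
  next
    case False
    then consider "card A \<le> 1" | "card B \<le> 1" by linarith
    then show False
    proof cases
      case 1
      then have "A = {a0}" using ABin fin card_le_Suc0_iff_eq[of A] by auto
      then have star: "leftover S = insert a0 B" "a0 \<notin> B" "\<And>a. a \<in> B \<Longrightarrow> E a0 a" using R dj comp by auto
      show False by (rule no_star_leftover[OF S(1) star])
    next
      case 2
      then have "B = {b0}" using ABin fin card_le_Suc0_iff_eq[of B] by auto
      then have star: "leftover S = insert b0 A" "b0 \<notin> A" "\<And>a. a \<in> A \<Longrightarrow> E b0 a" using R dj comp sym by auto
      show False by (rule no_star_leftover[OF S(1) star])
    qed
  qed
qed

end

context triangle_free
begin

text \<open>A largest packing \<open>S\<close> with fewer than \<open>k\<close> gulls would be an
  instance of \<open>gull_deficit\<close>; \<open>|S| + 1\<close> edges of \<open>N\<close> then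
  contradict it.\<close>

lemma gull_packing:
  assumes "finite V" "card V = 3 * k + s"
    and degree: "\<And>x. x \<in> V \<Longrightarrow> card {y \<in> V. E x y} \<le> k + s"
    and biclique: "\<And>A B. A \<subseteq> V \<Longrightarrow> B \<subseteq> V \<Longrightarrow> A \<noteq> {} \<Longrightarrow> B \<noteq> {} \<Longrightarrow>
      (\<And>a b. a \<in> A \<Longrightarrow> b \<in> B \<Longrightarrow> E a b) \<Longrightarrow> card A + card B \<le> 2 * k + s"
    and excl: "\<And>c p q r s'. k = 2 \<Longrightarrow> s = 0 \<Longrightarrow> {c, p, q, r, s'} \<subseteq> V \<Longrightarrow>
      E c p \<Longrightarrow> E p q \<Longrightarrow> E q r \<Longrightarrow> E r s' \<Longrightarrow> E s' c \<Longrightarrow> False"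
    and N: "N \<subseteq> edges V" "pair_matching N" "k \<le> card N"
  shows "\<exists>S. packing V S \<and> card S = k"
proof -
  define P where "P S \<longleftrightarrow> packing V S" for S
  have "card S < Suc (card (Pow V))" if "P S" for S
  proof -
    have "S \<subseteq> Pow V" using that unfolding P_def packing_def by blast
    then show ?thesis using assms(1) card_mono le_imp_less_Suc by (metis finite_Pow_iff)
  qed
  then obtain S where S: "P S" "\<And>S'. P S' \<Longrightarrow> card S' \<le> card S"
    using ex_has_greatest_nat[of P "{}" card "Suc (card (Pow V))"] packing_empty unfolding P_def by metis
  have "k \<le> card S"
  proof (rule ccontr)
    assume less: "\<not> k \<le> card S"
    interpret gull_deficit E V k s "card S"
    proof unfold_locales
      show "finite V" "card V = 3 * k + s" "card S < k" "\<exists>S'. packing V S' \<and> card S' = card S"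
        using assms(1,2) S less unfolding P_def by auto
      show "\<And>S'. packing V S' \<Longrightarrow> card S' \<le> card S" using S(2) unfolding P_def .
    qed (fact degree biclique excl)+
    obtain N0 where N0: "N0 \<subseteq> N" "card N0 = Suc (card S)"
      using N(3) less by (metis Suc_leI le_trans not_le obtain_subset_with_card_n)
    then have pm: "N0 \<subseteq> edges V" "pair_matching N0" using pair_matching_subset[OF N(2)] N(1) by auto
    show False by (rule no_deficit[OF pm N0(2)])
  qed
  then obtain S' where "S' \<subseteq> S" "card S' = k" by (meson obtain_subset_with_card_n)
  moreover from this have "packing V S'"
    using S(1) unfolding P_def packing_def by (meson pairwise_subset subsetD)
  ultimately show ?thesis by blast
qed

end

context triangle_free
begin

section \<open>Complete minors\<close>

text \<open>Each of these shapes has a vertex that is adjacent in the graph to the rest of the set,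
  which later gives connectedness.\<close>

definition branch :: "'a set \<Rightarrow> bool" where
  "branch B \<longleftrightarrow> (\<exists>x. B = {x}) \<or> (\<exists>x y. B = {x, y} \<and> x \<noteq> y \<and> \<not> E x y) \<or> gull B"

text \<open>Since members are disjoint, \<open>\<not> E x y\<close> between two of them is an
  adjacency of the graph.\<close>

definition model :: "'a set \<Rightarrow> 'a set set \<Rightarrow> bool" where
  "model U M \<longleftrightarrow> disjoint M \<and> (\<forall>B\<in>M. branch B \<and> B \<subseteq> U) \<and>
     (\<forall>B\<in>M. \<forall>B'\<in>M. B \<noteq> B' \<longrightarrow> (\<exists>x\<in>B. \<exists>y\<in>B'. \<not> E x y))"

lemma branch_nonempty: "branch B \<Longrightarrow> B \<noteq> {}"
  unfolding branch_def using gull_nonempty by auto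

lemma model_finite: "finite U \<Longrightarrow> model U M \<Longrightarrow> finite M"
  unfolding model_def by (meson Pow_iff finite_Pow_iff finite_subset subsetI)

lemma model_mono: "model U M \<Longrightarrow> U \<subseteq> W \<Longrightarrow> model W M"
  unfolding model_def by (meson order_trans)

lemma indep_subset: "indep Z \<Longrightarrow> Y \<subseteq> Z \<Longrightarrow> indep Y"
  unfolding indep_def by blast

lemma indep_neighbours: "indep {y \<in> U. E x y}"
  unfolding indep_def using no_triangle sym by blast

lemma model_union:
  assumes M: "model U M" "model U M'" and dj: "\<Union>M \<inter> \<Union>M' = {}"
    and touch: "\<And>B B'. B \<in> M \<Longrightarrow> B' \<in> M' \<Longrightarrow> \<exists>x\<in>B. \<exists>y\<in>B'. \<not> E x y"
  shows "model U (M \<union> M')" "M \<inter> M' = {}"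
proof -
  have d: "B \<inter> B' = {}" if "B \<in> M" "B' \<in> M'" for B B' using dj that by blast
  show "M \<inter> M' = {}"
  proof (rule ccontr)
    assume "M \<inter> M' \<noteq> {}"
    then obtain B where "B \<in> M" "B \<in> M'" by blast
    then show False using d[of B B] M(1) branch_nonempty unfolding model_def by auto
  qed
  show "model U (M \<union> M')"
    unfolding model_def
  proof (intro conjI ballI impI)
    show "disjoint (M \<union> M')"
    proof (rule pairwiseI)
      fix B B' assume BB: "B \<in> M \<union> M'" "B' \<in> M \<union> M'" "B \<noteq> B'"
      have dd: "disjoint M" "disjoint M'" using M unfolding model_def by auto
      consider "B \<in> M" "B' \<in> M" | "B \<in> M'" "B' \<in> M'" | "B \<in> M" "B' \<in> M'" | "B \<in> M'" "B' \<in> M"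
        using BB by auto
      then show "disjnt B B'"
      proof cases
        case 1 then show ?thesis using dd(1) BB(3) by (simp add: pairwiseD)
      next
        case 2 then show ?thesis using dd(2) BB(3) by (simp add: pairwiseD)
      next
        case 3 then show ?thesis using d unfolding disjnt_def by simp
      next
        case 4 then show ?thesis using d[of B' B] unfolding disjnt_def by (simp add: Int_commute)
      qed
    qed
    fix B assume B: "B \<in> M \<union> M'"
    then show "branch B" "B \<subseteq> U" using M unfolding model_def by auto
    fix B' assume B': "B' \<in> M \<union> M'" "B \<noteq> B'"
    consider "B \<in> M" "B' \<in> M" | "B \<in> M'" "B' \<in> M'" | "B \<in> M" "B' \<in> M'" | "B \<in> M'" "B' \<in> M"
      using B B' by auto
    then show "\<exists>x\<in>B. \<exists>y\<in>B'. \<not> E x y"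
    proof cases
      case 1 then show ?thesis using M(1) B'(2) unfolding model_def by blast
    next
      case 2 then show ?thesis using M(2) B'(2) unfolding model_def by blast
    next
      case 3 then show ?thesis using touch by blast
    next
      case 4 then show ?thesis using touch[of B' B] sym by blast
    qed
  qed
qed

lemma model_singletons:
  assumes "indep Z" "Z \<subseteq> U"
  shows "model U ((\<lambda>z. {z}) ` Z)" "card ((\<lambda>z. {z}) ` Z) = card Z" "\<Union>((\<lambda>z. {z}) ` Z) = Z"
proof -
  show "model U ((\<lambda>z. {z}) ` Z)"
    using assms unfolding model_def indep_def branch_def by (auto simp: pairwise_def disjnt_def)
  show "card ((\<lambda>z. {z}) ` Z) = card Z" by (simp add: card_image)
qed simp

text \<open>A \<open>y\<close> related by \<open>E\<close> to both ends of the edge of the gull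
  would close a triangle.\<close>

lemma gull_dominating:
  assumes "gull T"
  shows "\<exists>x\<in>T. \<not> E x y"
proof -
  obtain u w v where "T = {u, w, v}" "E u w" using assms unfolding gull_def by blast
  then show ?thesis using no_triangle[of u w y] by auto
qed

lemma model_gulls_and_clique:
  assumes S: "packing (U - Z) S" and Z: "indep Z" "Z \<subseteq> U" and fin: "finite U"
  shows "\<exists>M. model U M \<and> card M = card S + card Z"
proof -
  have "model U S"
    unfolding model_def
  proof (intro conjI ballI impI)
    show "disjoint S" using S unfolding packing_def by blast
    fix B assume B: "B \<in> S"
    then show "branch B" "B \<subseteq> U" using S unfolding packing_def branch_def by auto
    fix B' assume "B' \<in> S" "B \<noteq> B'"
    then have "B' \<noteq> {}" using S gull_nonempty[of B'] unfolding packing_def by auto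
    then obtain y where "y \<in> B'" by blast
    then show "\<exists>x\<in>B. \<exists>y\<in>B'. \<not> E x y"
      using S B gull_dominating[of B y] unfolding packing_def by auto
  qed
  moreover note sing = model_singletons[OF Z]
  have "\<exists>x\<in>T. \<exists>y\<in>B. \<not> E x y" if "T \<in> S" "B \<in> (\<lambda>z. {z}) ` Z" for T B
    using that S gull_dominating unfolding packing_def by blast
  moreover have "\<Union>S \<inter> \<Union>((\<lambda>z. {z}) ` Z) = {}"
    using S unfolding packing_def by auto
  ultimately have m: "model U (S \<union> (\<lambda>z. {z}) ` Z)" "S \<inter> (\<lambda>z. {z}) ` Z = {}"
    using model_union[OF _ sing(1)] by blast+
  have "finite S" "finite Z"
    using packing_finite[OF _ S] Z fin finite_subset by auto
  then have "card (S \<union> (\<lambda>z. {z}) ` Z) = card S + card Z"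
    using m(2) sing(2) by (simp add: card_Un_disjoint)
  then show ?thesis using m(1) by blast
qed

text \<open>A vertex with \<open>j + 1\<close> neighbours has an independent neighbourhood of that
  size. Otherwise deleting a vertex with its neighbours costs at most \<open>j + 1\<close> vertices,
  which is the step between consecutive triangular numbers.\<close>

lemma ramsey_triangle_free:
  assumes "finite U" "j * (j + 1) div 2 \<le> card U"
  shows "\<exists>Z\<subseteq>U. indep Z \<and> card Z = j"
  using assms
proof (induction j arbitrary: U)
  case 0
  then show ?case by (intro exI[of _ "{}"]) (auto simp: indep_def)
next
  case (Suc j)
  have arith: "Suc j * (Suc j + 1) div 2 = j * (j + 1) div 2 + Suc j"
  proof -
    have "Suc j * (Suc j + 1) = j * (j + 1) + Suc j * 2" by simp
    then show ?thesis by (metis div_mult_self3 zero_neq_numeral add.commute)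
  qed
  then have "card U > 0" using Suc.prems by linarith
  then obtain v where v: "v \<in> U" by (metis card.empty all_not_in_conv less_irrefl)
  define N where "N = {y \<in> U. E v y}"
  have finN: "finite N" unfolding N_def using Suc.prems by simp
  show ?case
  proof (cases "Suc j \<le> card N")
    case True
    then obtain Z where "Z \<subseteq> N" "card Z = Suc j" by (meson obtain_subset_with_card_n)
    then show ?thesis
      using indep_subset[OF indep_neighbours[of U v]] unfolding N_def
      by (metis (no_types, lifting) mem_Collect_eq subset_iff)
  next
    case False
    let ?W = "U - insert v N"
    have "card (insert v N) \<le> Suc j" using False finN by (simp add: card_insert_if)
    moreover have "card U - card (insert v N) \<le> card ?W"
      using finN by (intro diff_card_le_card_Diff) auto
    ultimately have "j * (j + 1) div 2 \<le> card ?W" using Suc.prems(2) arith by linarith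
    then obtain Z where Z: "Z \<subseteq> ?W" "indep Z" "card Z = j"
      using Suc.IH[of ?W] Suc.prems(1) by auto
    have "finite Z" using Z(1) Suc.prems(1) finite_subset by blast
    moreover have "v \<notin> Z" using Z(1) by blast
    moreover have "indep (insert v Z)"
      using Z(1,2) irrefl sym unfolding indep_def N_def by blast
    ultimately show ?thesis using Z v by (intro exI[of _ "insert v Z"]) auto
  qed
qed

text \<open>The members of \<open>A\<close> together with pairs matching \<open>X\<close> with \<open>B\<close>; maximality supplies Hall's condition.\<close>

lemma half_biclique_model:
  assumes fin: "finite U" and AB: "A \<subseteq> U" "B \<subseteq> U" "A \<noteq> {}" "B \<noteq> {}" "\<And>a b. a \<in> A \<Longrightarrow> b \<in> B \<Longrightarrow> E a b"
    and max: "\<And>A' B'. A' \<subseteq> U \<Longrightarrow> B' \<subseteq> U \<Longrightarrow> A' \<noteq> {} \<Longrightarrow> B' \<noteq> {} \<Longrightarrow>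
      (\<And>a b. a \<in> A' \<Longrightarrow> b \<in> B' \<Longrightarrow> E a b) \<Longrightarrow> card A' + card B' \<le> card A + card B"
    and X: "X \<subseteq> U - (A \<union> B)" "\<And>x a. x \<in> X \<Longrightarrow> a \<in> A \<Longrightarrow> \<not> E x a"
  shows "\<exists>M. model U M \<and> card M = card A + min (card X) (card B)"
proof -
  have finABX: "finite A" "finite B" "finite X" using fin AB X finite_subset by (blast, blast, blast)
  obtain a0 b0 where ab0: "a0 \<in> A" "b0 \<in> B" using AB by blast
  have indA: "indep A" and indB: "indep B"
    unfolding indep_def using AB(5) ab0 no_triangle sym by blast+
  have ABd: "A \<inter> B = {}" using AB(5) irrefl by blast
  define F where "F = {{x, b} | x b. x \<in> X \<and> b \<in> B \<and> \<not> E x b}"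
  have XB: "X \<inter> B = {}" "X \<inter> A = {}" using X by auto
  have "F \<subseteq> Pow U" unfolding F_def using X AB by auto
  then have bip: "bipartite_edges X B F"
    using finite_subset[of F "Pow U"] fin XB unfolding bipartite_edges_def F_def by blast
  have cover: "min (card X) (card B) \<le> card K" if K: "K \<subseteq> \<Union>F" "\<And>e. e \<in> F \<Longrightarrow> e \<inter> K \<noteq> {}" for K
  proof (rule ccontr)
    assume small: "\<not> ?thesis"
    have KXB: "K \<subseteq> X \<union> B" using K(1) unfolding F_def by auto
    have "\<Union>F \<subseteq> U" unfolding F_def using X AB by auto
    then have finK: "finite K" using K(1) fin by (meson finite_subset)
    \<comment> \<open>A cover smaller than both \<open>X\<close> and \<open>B\<close> would make
      \<open>A \<union> (X - K)\<close> and \<open>B - K\<close> a larger biclique.\<close>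
    have "\<not> X \<subseteq> K" "\<not> B \<subseteq> K" using small card_mono[OF finK] by (metis min.coboundedI1 min.coboundedI2)+
    then have ne: "A \<union> (X - K) \<noteq> {}" "B - K \<noteq> {}" using AB by auto
    have adj: "E a b" if "a \<in> A \<union> (X - K)" "b \<in> B - K" for a b
    proof (cases "a \<in> A")
      case True then show ?thesis using AB(5) that by blast
    next
      case False
      show ?thesis
      proof (rule ccontr)
        assume "\<not> E a b"
        then have "{a, b} \<in> F" using that False unfolding F_def by blast
        then show False using K(2)[of "{a, b}"] that False by auto
      qed
    qed
    have "card (A \<union> (X - K)) + card (B - K) \<le> card A + card B"
    proof (rule max)
      show "A \<union> (X - K) \<subseteq> U" "B - K \<subseteq> U" using AB X by auto
    qed (use ne adj in auto)
    moreover have "card (A \<union> (X - K)) = card A + card (X - K)"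
      using finABX XB by (intro card_Un_disjoint) auto
    moreover have "card (X - K) + card (B - K) + card K \<ge> card X + card B"
    proof -
      have "card X + card B = card (X \<union> B)" using finABX XB by (simp add: card_Un_disjoint)
      also have "\<dots> \<le> card ((X - K) \<union> (B - K) \<union> K)" using finABX finK by (intro card_mono) auto
      also have "\<dots> \<le> card ((X - K) \<union> (B - K)) + card K" by (rule card_Un_le)
      also have "\<dots> \<le> card (X - K) + card (B - K) + card K" using card_Un_le by simp
      finally show ?thesis by simp
    qed
    ultimately show False using small by auto
  qed
  obtain N where N: "N \<subseteq> F" "pair_matching N" "card N = min (card X) (card B)"
    using konig[OF bip cover] by blast
  have NF: "\<exists>x b. e = {x, b} \<and> x \<in> X \<and> b \<in> B \<and> \<not> E x b" if "e \<in> N" for e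
    using that N(1) unfolding F_def by blast
  have "model U N"
    unfolding model_def
  proof (intro conjI ballI impI)
    show "disjoint N" using N(2) unfolding pair_matching_def by blast
    fix e assume e: "e \<in> N"
    then obtain x b where xb: "e = {x, b}" "x \<in> X" "b \<in> B" "\<not> E x b" using NF by blast
    then have "x \<noteq> b" using XB by blast
    then show "branch e" unfolding branch_def using xb by blast
    show "e \<subseteq> U" using xb X AB by auto
    fix e' assume "e' \<in> N" "e \<noteq> e'"
    then obtain x' b' where "e' = {x', b'}" "b' \<in> B" using NF by blast
    then show "\<exists>x\<in>e. \<exists>y\<in>e'. \<not> E x y" using xb indB unfolding indep_def by blast
  qed
  moreover note sing = model_singletons[OF indA AB(1)]
  have "\<exists>x\<in>e. \<exists>y\<in>B'. \<not> E x y" if "e \<in> N" "B' \<in> (\<lambda>z. {z}) ` A" for e B'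
    using NF[OF that(1)] that(2) X(2) by blast
  moreover have "\<Union>N \<inter> \<Union>((\<lambda>z. {z}) ` A) = {}"
  proof -
    have "\<Union>N \<subseteq> X \<union> B" using NF by blast
    then show ?thesis using XB ABd by auto
  qed
  ultimately have m: "model U (N \<union> (\<lambda>z. {z}) ` A)" "N \<inter> (\<lambda>z. {z}) ` A = {}"
    using model_union[OF _ sing(1)] by blast+
  have "finite N" using N(2) unfolding pair_matching_def by blast
  then have "card (N \<union> (\<lambda>z. {z}) ` A) = card A + min (card X) (card B)"
    using m(2) sing(2) finABX N(3) by (simp add: card_Un_disjoint)
  then show ?thesis using m(1) by blast
qed

text \<open>Outside a largest biclique, the vertices \<open>X\<close> have no neighbour in
  \<open>A\<close>; the others, \<open>Y\<close>, have one and hence none in \<open>B\<close>. The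
  two half models have \<open>|A| + min |X| |B|\<close> and \<open>|B| + min |Y| |A|\<close>
  members. If a minimum is \<open>|B|\<close> or \<open>|A|\<close>, the bound on
  \<open>|A| + |B|\<close> suffices; otherwise the two numbers sum to at least
  \<open>2m + 1\<close>.\<close>

lemma biclique_model:
  assumes fin: "finite U" "card U = 2 * m + 1"
    and AB: "A0 \<subseteq> U" "B0 \<subseteq> U" "A0 \<noteq> {}" "B0 \<noteq> {}" "\<And>a b. a \<in> A0 \<Longrightarrow> b \<in> B0 \<Longrightarrow> E a b"
    and big: "m + 1 \<le> card A0 + card B0"
  shows "\<exists>M. model U M \<and> m + 1 \<le> card M"
proof -
  define P where "P = (\<lambda>(A, B). A \<subseteq> U \<and> B \<subseteq> U \<and> A \<noteq> {} \<and> B \<noteq> {} \<and> (\<forall>a\<in>A. \<forall>b\<in>B. E a b))"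
  define f where "f = (\<lambda>(A :: 'a set, B :: 'a set). card A + card B)"
  have P0: "P (A0, B0)" unfolding P_def using AB by auto
  have "f y < Suc (2 * card U)" if "P y" for y
  proof -
    obtain A B where y: "y = (A, B)" by force
    have "card A \<le> card U" "card B \<le> card U" using that fin(1) card_mono unfolding P_def y by auto
    then show ?thesis unfolding f_def y by simp
  qed
  then obtain y where y: "P y" "\<And>z. P z \<Longrightarrow> f z \<le> f y"
    using ex_has_greatest_nat[of P "(A0, B0)" f "Suc (2 * card U)"] P0 by metis
  obtain A B where yAB: "y = (A, B)" by force
  have A: "A \<subseteq> U" "B \<subseteq> U" "A \<noteq> {}" "B \<noteq> {}" "\<And>a b. a \<in> A \<Longrightarrow> b \<in> B \<Longrightarrow> E a b"
    using y(1) unfolding P_def yAB by auto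
  have B: "\<And>a b. a \<in> B \<Longrightarrow> b \<in> A \<Longrightarrow> E a b" using A(5) sym by blast
  have max: "card A' + card B' \<le> card A + card B" if "A' \<subseteq> U" "B' \<subseteq> U" "A' \<noteq> {}" "B' \<noteq> {}"
      "\<And>a b. a \<in> A' \<Longrightarrow> b \<in> B' \<Longrightarrow> E a b" for A' B'
    using y(2)[of "(A', B')"] that unfolding P_def f_def yAB by auto
  have max': "card A' + card B' \<le> card B + card A" if "A' \<subseteq> U" "B' \<subseteq> U" "A' \<noteq> {}" "B' \<noteq> {}"
      "\<And>a b. a \<in> A' \<Longrightarrow> b \<in> B' \<Longrightarrow> E a b" for A' B'
    using max[OF that] by simp
  have big': "m + 1 \<le> card A + card B" using y(2)[OF P0] big unfolding f_def yAB by simp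
  define X where "X = {x \<in> U - (A \<union> B). \<forall>a\<in>A. \<not> E x a}"
  define Y where "Y = U - (A \<union> B) - X"
  have X1: "X \<subseteq> U - (A \<union> B)" "\<And>x a. x \<in> X \<Longrightarrow> a \<in> A \<Longrightarrow> \<not> E x a" unfolding X_def by auto
  have Y1: "Y \<subseteq> U - (B \<union> A)" unfolding Y_def by auto
  have Y2: "\<not> E x b" if xb: "x \<in> Y" "b \<in> B" for x b
  proof -
    obtain a where "a \<in> A" "E x a" using xb(1) unfolding Y_def X_def by blast
    then show ?thesis using A(5) xb(2) no_triangle by blast
  qed
  obtain M1 where M1: "model U M1" "card M1 = card A + min (card X) (card B)"
    using half_biclique_model[OF fin(1) A max X1] by blast
  obtain M2 where M2: "model U M2" "card M2 = card B + min (card Y) (card A)"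
    using half_biclique_model[OF fin(1) A(2,1,4,3) B max' Y1 Y2] by blast
  have "card U \<le> card A + card B + card X + card Y"
  proof -
    have "U = A \<union> B \<union> (X \<union> Y)" using A X1 unfolding Y_def by auto
    then have "card U \<le> card (A \<union> B) + card (X \<union> Y)" using card_Un_le by metis
    also have "\<dots> \<le> card A + card B + (card X + card Y)" using card_Un_le add_mono by blast
    finally show ?thesis by simp
  qed
  then have "m + 1 \<le> card M1 \<or> m + 1 \<le> card M2" using M1(2) M2(2) big' fin(2) by linarith
  then show ?thesis using M1(1) M2(1) by blast
qed

section \<open>Gallai's lemma\<close>

definition max_matching :: "'a set \<Rightarrow> 'a set set \<Rightarrow> bool" where
  "max_matching U M \<longleftrightarrow> M \<subseteq> edges U \<and> pair_matching M \<and>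
     (\<forall>N. N \<subseteq> edges U \<and> pair_matching N \<longrightarrow> card N \<le> card M)"

lemma ex_max_matching:
  assumes "finite U"
  shows "\<exists>M. max_matching U M"
proof -
  define P where "P M \<longleftrightarrow> M \<subseteq> edges U \<and> pair_matching M" for M
  have "P {}" unfolding P_def pair_matching_def by simp
  moreover have "card M < Suc (card (edges U))" if "P M" for M
    using that finite_edges[OF assms] card_mono unfolding P_def by (simp add: card_mono le_imp_less_Suc)
  ultimately obtain M where "P M" "\<And>N. P N \<Longrightarrow> card N \<le> card M"
    using ex_has_greatest_nat[of P "{}" card "Suc (card (edges U))"] by metis
  then show ?thesis unfolding max_matching_def P_def by blast
qed

text \<open>Suppose \<open>M\<close> misses \<open>x\<close> and \<open>z\<close>, and let
  \<open>N\<close> be a maximum matching missing \<open>y\<close> with greatest overlap with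
  \<open>M\<close>. \<open>N\<close> covers \<open>x\<close> and \<open>z\<close>, so
  \<open>M\<close> covers some \<open>u\<close> other than \<open>y\<close> that \<open>N\<close>
  misses. Trading an edge of \<open>N\<close> for the \<open>M\<close>-edge at \<open>u\<close>
  raises the overlap and still misses \<open>y\<close>.\<close>

lemma max_matching_cover_trans:
  assumes xy: "\<And>M. max_matching U M \<Longrightarrow> x \<in> \<Union>M \<or> y \<in> \<Union>M"
    and yz: "\<And>M. max_matching U M \<Longrightarrow> y \<in> \<Union>M \<or> z \<in> \<Union>M"
    and crit: "max_matching U N0" "y \<notin> \<Union>N0"
    and "x \<noteq> z" and M: "max_matching U M"
  shows "x \<in> \<Union>M \<or> z \<in> \<Union>M"
proof (rule ccontr)
  assume "\<not> ?thesis"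
  then have xM: "x \<notin> \<Union>M" "z \<notin> \<Union>M" by auto
  have pmM: "pair_matching M" "M \<subseteq> edges U" using M unfolding max_matching_def by auto
  define P where "P N \<longleftrightarrow> max_matching U N \<and> y \<notin> \<Union>N" for N
  have "card (M \<inter> N) < Suc (card M)" for N
    using pmM(1) unfolding pair_matching_def by (simp add: card_mono le_imp_less_Suc)
  then obtain N where N: "P N" "\<And>N'. P N' \<Longrightarrow> card (M \<inter> N') \<le> card (M \<inter> N)"
    using ex_has_greatest_nat[of P N0 "\<lambda>N. card (M \<inter> N)" "Suc (card M)"] crit unfolding P_def by metis
  have mN: "max_matching U N" "y \<notin> \<Union>N" using N(1) unfolding P_def by auto
  have pmN: "pair_matching N" "N \<subseteq> edges U" using mN(1) unfolding max_matching_def by auto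
  have "x \<in> \<Union>N" "z \<in> \<Union>N" using xy[OF mN(1)] yz[OF mN(1)] mN(2) by auto
  have cards: "card (\<Union>M) = card (\<Union>N)"
    using M mN(1) pair_matching_card_Union[OF pmM(1)] pair_matching_card_Union[OF pmN(1)]
    unfolding max_matching_def by (simp add: le_antisym)
  note fin = pair_matching_finite_Union[OF pmM(1)] pair_matching_finite_Union[OF pmN(1)]
  \<comment> \<open>Otherwise \<open>M\<close> would lose \<open>x\<close> and \<open>z\<close>
    against \<open>N\<close> and gain at most \<open>y\<close>, although both cover equally many
    vertices.\<close>
  have "\<not> \<Union>M - \<Union>N \<subseteq> {y}"
  proof
    assume "\<Union>M - \<Union>N \<subseteq> {y}"
    then have "\<Union>M \<subseteq> insert y (\<Union>N - {x, z})" using xM by blast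
    then have "card (\<Union>M) \<le> card (insert y (\<Union>N - {x, z}))" using fin by (intro card_mono) auto
    also have "\<dots> \<le> Suc (card (\<Union>N - {x, z}))" by (rule card_insert_le_m1[THEN order_trans]) (auto simp: card_insert_if fin)
    also have "card (\<Union>N - {x, z}) = card (\<Union>N) - 2"
      using \<open>x \<in> \<Union>N\<close> \<open>z \<in> \<Union>N\<close> \<open>x \<noteq> z\<close> fin by (simp add: card_Diff_subset)
    finally have "card (\<Union>N) \<le> Suc (card (\<Union>N) - 2)" using cards by simp
    moreover have "card {x, z} \<le> card (\<Union>N)" using \<open>x \<in> \<Union>N\<close> \<open>z \<in> \<Union>N\<close> fin by (intro card_mono) auto
    ultimately show False using \<open>x \<noteq> z\<close> by simp
  qed
  then obtain u where u: "u \<in> \<Union>M" "u \<notin> \<Union>N" "u \<noteq> y" by blast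
  then obtain e where e: "e \<in> M" "u \<in> e" by blast
  have e2: "card e = 2" using pmM(1) e unfolding pair_matching_def by blast
  then obtain w where w: "e = {u, w}" "w \<noteq> u" using e(2) card_2_obtain_other by metis
  have "e \<notin> N" using u e by blast
  have finN: "finite N" "finite M" using pmN pmM unfolding pair_matching_def by auto
  have "w \<in> \<Union>N"
  proof (rule ccontr)
    assume "w \<notin> \<Union>N"
    then have "pair_matching (insert e N)" using w u e2 by (intro pair_matching_insert[OF pmN(1)]) auto
    moreover have "insert e N \<subseteq> edges U" using pmN(2) pmM(2) e by blast
    ultimately have "card (insert e N) \<le> card N" using mN(1) unfolding max_matching_def by blast
    then show False using finN \<open>e \<notin> N\<close> by simp
  qed
  then obtain f where f: "f \<in> N" "w \<in> f" by blast
  have "f \<notin> M"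
  proof
    assume "f \<in> M"
    then have "e = f" using pair_matching_eqI[OF pmM(1) e(1), of f w] f w by simp
    then show False using \<open>e \<notin> N\<close> f by simp
  qed
  let ?N = "insert e (N - {f})"
  have pm: "pair_matching ?N"
  proof (rule pair_matching_insert[OF pair_matching_subset[OF pmN(1)] e2])
    fix g assume "g \<in> N - {f}"
    then show "e \<inter> g = {}" using w u pair_matching_eqI[OF pmN(1) f(1), of g w] f by auto
  qed auto
  have "card ?N = card N" using finN f \<open>e \<notin> N\<close> by (metis DiffD1 card_Suc_Diff1 card_insert_disjoint finite_Diff)
  moreover have "?N \<subseteq> edges U" using pmN(2) pmM(2) e by blast
  ultimately have "max_matching U ?N" using pm mN(1) unfolding max_matching_def by simp
  moreover have "y \<notin> \<Union>?N" using mN(2) u(3) w \<open>w \<in> \<Union>N\<close> by auto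
  ultimately have "card (M \<inter> ?N) \<le> card (M \<inter> N)" using N(2) unfolding P_def by blast
  moreover have "M \<inter> ?N = insert e (M \<inter> N)" using e \<open>f \<notin> M\<close> by blast
  ultimately show False using finN \<open>e \<notin> N\<close> by simp
qed

text \<open>No maximum matching misses two adjacent vertices. Transitivity spreads this over the
  connected \<open>U\<close>, so a maximum matching missing \<open>v\<close> covers everything
  else.\<close>

lemma gallai:
  assumes fin: "finite U"
    and conn: "\<And>W. W \<subseteq> U \<Longrightarrow> W \<noteq> {} \<Longrightarrow> W \<noteq> U \<Longrightarrow> \<exists>x\<in>W. \<exists>y\<in>U - W. E x y"
    and crit: "\<And>v. v \<in> U \<Longrightarrow> \<exists>M. max_matching U M \<and> v \<notin> \<Union>M"
    and v: "v \<in> U"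
  obtains M where "M \<subseteq> edges U" "pair_matching M" "\<Union>M = U - {v}"
proof -
  define W where "W = {y \<in> U. y = v \<or> (\<forall>M. max_matching U M \<longrightarrow> v \<in> \<Union>M \<or> y \<in> \<Union>M)}"
  have "W = U"
  proof (rule ccontr)
    assume "W \<noteq> U"
    then obtain y z where yz: "y \<in> W" "z \<in> U - W" "E y z"
      using conn[of W] v unfolding W_def by blast
    have adj: "y \<in> \<Union>M \<or> z \<in> \<Union>M" if M: "max_matching U M" for M
    proof (rule ccontr)
      assume n: "\<not> ?thesis"
      have pm: "pair_matching M" "M \<subseteq> edges U" using M unfolding max_matching_def by auto
      have ed: "{y, z} \<in> edges U" using yz edge_mem unfolding W_def by auto
      have "pair_matching (insert {y, z} M)"
        using n by (intro pair_matching_insert[OF pm(1) card_edge[OF ed]]) auto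
      then have "card (insert {y, z} M) \<le> card M" using M pm ed unfolding max_matching_def by blast
      moreover have "{y, z} \<notin> M" "finite M" using n pm unfolding pair_matching_def by auto
      ultimately show False by simp
    qed
    have "v \<noteq> z" using yz v unfolding W_def by blast
    have "v \<in> \<Union>M \<or> z \<in> \<Union>M" if M: "max_matching U M" for M
    proof (cases "y = v")
      case True then show ?thesis using adj[OF M] by simp
    next
      case False
      then have vy: "\<And>M. max_matching U M \<Longrightarrow> v \<in> \<Union>M \<or> y \<in> \<Union>M" using yz(1) unfolding W_def by blast
      obtain N where N: "max_matching U N" "y \<notin> \<Union>N" using crit yz(1) unfolding W_def by blast
      show ?thesis by (rule max_matching_cover_trans[OF vy adj N \<open>v \<noteq> z\<close> M])
    qed
    then show False using yz(2) unfolding W_def by blast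
  qed
  obtain M where M: "max_matching U M" "v \<notin> \<Union>M" using crit[OF v] by blast
  have "\<Union>M \<subseteq> U" using M(1) edge_subset unfolding max_matching_def by blast
  moreover have "y \<in> \<Union>M" if "y \<in> U" "y \<noteq> v" for y
    using that \<open>W = U\<close> M unfolding W_def by blast
  ultimately have "\<Union>M = U - {v}" using M(2) by blast
  then show ?thesis using that M(1) unfolding max_matching_def by blast
qed

text \<open>The ratio \<open>33 / 124\<close> is \<open>1/4 + 1/62\<close>. The assumed absence of a
  model is itself a source of bounds: it gives \<open>|Z| \<le> m\<close> and limits the
  bicliques.\<close>

lemma factor_critical_model:
  assumes fin: "finite U" "U \<noteq> {}"
    and fc: "\<And>v. v \<in> U \<Longrightarrow> \<exists>M. M \<subseteq> edges U \<and> pair_matching M \<and> \<Union>M = U - {v}"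
    and ratio: "\<exists>Z\<subseteq>U. indep Z \<and> 33 * card U \<le> 124 * card Z"
    and m: "card U = 2 * m + 1"
  shows "\<exists>M. model U M \<and> m + 1 \<le> card M"
proof (rule ccontr)
  assume none: "\<not> ?thesis"
  define P where "P Z \<longleftrightarrow> Z \<subseteq> U \<and> indep Z" for Z
  have "P {}" unfolding P_def indep_def by simp
  moreover have "card Z < Suc (card U)" if "P Z" for Z
    using that fin card_mono unfolding P_def by (simp add: card_mono le_imp_less_Suc)
  ultimately obtain Z where Z: "P Z" "\<And>Z'. P Z' \<Longrightarrow> card Z' \<le> card Z"
    using ex_has_greatest_nat[of P "{}" card "Suc (card U)"] by metis
  have ZU: "Z \<subseteq> U" "indep Z" using Z(1) unfolding P_def by auto
  have finZ: "finite Z" using ZU fin finite_subset by blast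
  have ram: "j \<le> card Z" if "j * (j + 1) div 2 \<le> card U" for j
    using ramsey_triangle_free[OF fin(1) that] Z(2) unfolding P_def by metis
  have rat: "33 * card U \<le> 124 * card Z"
  proof -
    obtain Y where Y: "Y \<subseteq> U" "indep Y" "33 * card U \<le> 124 * card Y" using ratio by blast
    then have "card Y \<le> card Z" using Z(2) unfolding P_def by blast
    then show ?thesis using Y(3) by linarith
  qed
  \<comment> \<open>Failure means \<open>2|Z| \<le> m + 1\<close>; the ratio then gives
    \<open>66m + 33 \<le> 62m + 62\<close>, so \<open>m \<le> 7\<close>. These orders contradict the
    Ramsey bound with a suitable \<open>j \<le> 5\<close>.\<close>
  have large: "m + 2 \<le> 2 * card Z"
  proof (rule ccontr)
    assume small: "\<not> ?thesis"
    then have "m \<le> 7" using rat m by linarith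
    then have "m \<in> {0, 1, 2, 3, 4, 5, 6, 7}" by auto
    then show False
      using ram[of 1] ram[of 2] ram[of 3] ram[of 4] ram[of 5] m small by auto
  qed
  have "card Z \<le> m"
    using model_singletons(1,2)[OF ZU(2,1)] none by (metis not_less_eq_eq Suc_eq_plus1)
  define k where "k = m + 1 - card Z"
  define s where "s = 2 * card Z - m - 2"
  have ks: "card Z = k + s + 1" "m = 2 * k + s" unfolding k_def s_def using large \<open>card Z \<le> m\<close> by linarith+
  have cV: "card (U - Z) = 3 * k + s" using ZU finZ m ks by (simp add: card_Diff_subset)
  have degU: "card {y \<in> U. E x y} \<le> card Z" for x
    using Z(2)[of "{y \<in> U. E x y}"] indep_neighbours unfolding P_def by auto
  have hitZ: "\<exists>z\<in>Z. E x z" if x: "x \<in> U - Z" for x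
  proof (rule ccontr)
    assume "\<not> ?thesis"
    then have "P (insert x Z)" using ZU x irrefl sym unfolding P_def indep_def by blast
    then show False using Z(2)[of "insert x Z"] x finZ by simp
  qed
  \<comment> \<open>A neighbourhood is independent, hence has at most \<open>|Z|\<close> elements,
    and by maximality of \<open>Z\<close> one of them lies in \<open>Z\<close>.\<close>
  have degree: "card {y \<in> U - Z. E x y} \<le> k + s" if x: "x \<in> U - Z" for x
  proof -
    obtain z where z: "z \<in> Z" "E x z" using hitZ[OF x] by blast
    have "insert z {y \<in> U - Z. E x y} \<subseteq> {y \<in> U. E x y}" using z ZU by blast
    then have "card (insert z {y \<in> U - Z. E x y}) \<le> card Z"
      using card_mono[of "{y \<in> U. E x y}"] degU[of x] fin by (metis (no_types, lifting) finite_Collect_conjI finite_subset le_trans mem_Collect_eq subsetI Collect_mem_eq)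
    then show ?thesis using z ks(1) fin by simp
  qed
  have biclique: "card A + card B \<le> 2 * k + s"
    if "A \<subseteq> U - Z" "B \<subseteq> U - Z" "A \<noteq> {}" "B \<noteq> {}" "\<And>a b. a \<in> A \<Longrightarrow> b \<in> B \<Longrightarrow> E a b" for A B
  proof (rule ccontr)
    assume "\<not> ?thesis"
    then have "m + 1 \<le> card A + card B" using ks by linarith
    moreover have "A \<subseteq> U" "B \<subseteq> U" using that by auto
    ultimately show False using biclique_model[OF fin(1) m _ _ that(3-5)] none by blast
  qed
  \<comment> \<open>Here \<open>|Z| = 3\<close> bounds all degrees by three. Each cycle vertex
    already has two neighbours on the cycle, so it has exactly one in \<open>Z\<close>. If two of
    them shared it, exchanging it for the two would enlarge \<open>Z\<close>; hence five vertices
    would need distinct neighbours among three.\<close>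
  have excl: False if cyc: "k = 2" "s = 0" "{c, p, q, r, s'} \<subseteq> U - Z" "E c p" "E p q" "E q r" "E r s'" "E s' c"
    for c p q r s'
  proof -
    have cZ: "card Z = 3" using ks that by simp
    let ?C = "{c, p, q, r, s'}"
    have nad: "\<not> E c q" "\<not> E c r" "\<not> E p r" "\<not> E p s'" "\<not> E q s'"
      using that no_triangle sym by blast+
    have neq: "c \<noteq> q" "p \<noteq> r" "q \<noteq> s'" "r \<noteq> c" "s' \<noteq> p" "c \<noteq> p" "p \<noteq> q" "q \<noteq> r" "r \<noteq> s'" "s' \<noteq> c"
      using cyc(4-8) nad sym irrefl by blast+
    then have cC: "card ?C = 5" by (simp add: eq_commute)
    have two: "\<exists>y\<in>?C. \<exists>y'\<in>?C. y \<noteq> y' \<and> E x y \<and> E x y'" if "x \<in> ?C" for x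
    proof -
      have "E p c" "E q p" "E r q" "E s' r" "E c s'"
        using cyc(4-8) sym by blast+
      then show ?thesis
        using that neq cyc(4-8) by auto
    qed
    have uniq: "z = z'" if x: "x \<in> ?C" and z: "z \<in> Z" "z' \<in> Z" "E x z" "E x z'" for x z z'
    proof (rule ccontr)
      assume "z \<noteq> z'"
      obtain y y' where y: "y \<in> ?C" "y' \<in> ?C" "y \<noteq> y'" "E x y" "E x y'" using two[OF x] by blast
      have yZ: "y \<in> U - Z" "y' \<in> U - Z" using y(1,2) cyc(3) by blast+
      have "card {y, y', z, z'} = 4" using y(3) \<open>z \<noteq> z'\<close> z yZ by (auto simp: card_insert_if)
      moreover have "{y, y', z, z'} \<subseteq> {y \<in> U. E x y}" using y z yZ ZU by blast
      then have "card {y, y', z, z'} \<le> card {y \<in> U. E x y}" using fin by (intro card_mono) auto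
      ultimately show False using degU[of x] cZ by linarith
    qed
    have "\<And>x. x \<in> ?C \<Longrightarrow> \<exists>z. z \<in> Z \<and> E x z" using hitZ cyc(3) by blast
    then obtain g where g: "\<And>x. x \<in> ?C \<Longrightarrow> g x \<in> Z \<and> E x (g x)" by metis
    have "inj_on g ?C"
    proof (rule inj_onI, rule ccontr)
      fix x y assume xy: "x \<in> ?C" "y \<in> ?C" "g x = g y" "x \<noteq> y"
      have "\<not> E x y" using g[OF xy(1)] g[OF xy(2)] xy(3) no_triangle sym by metis
      have xyZ: "x \<in> U - Z" "y \<in> U - Z" using xy cyc(3) by blast+
      have free: "\<not> E a z" if "a \<in> {x, y}" "z \<in> Z - {g x}" for a z
        using uniq[of a z "g a"] g[of a] that xy by auto
      let ?Y = "insert x (insert y (Z - {g x}))"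
      have "P ?Y"
        unfolding P_def indep_def
      proof (intro conjI ballI)
        show "?Y \<subseteq> U" using ZU xyZ by blast
        fix a b assume ab: "a \<in> ?Y" "b \<in> ?Y"
        consider "a \<in> {x, y}" "b \<in> {x, y}" | "a \<in> {x, y}" "b \<in> Z - {g x}"
          | "b \<in> {x, y}" "a \<in> Z - {g x}" | "a \<in> Z" "b \<in> Z" using ab by auto
        then show "\<not> E a b"
        proof cases
          case 1 then show ?thesis using \<open>\<not> E x y\<close> sym irrefl by auto
        next
          case 2 then show ?thesis using free by blast
        next
          case 3 then show ?thesis using free[of b a] sym by blast
        next
          case 4 then show ?thesis using ZU(2) unfolding indep_def by blast
        qed
      qed
      moreover have "card ?Y = 4" using g[OF xy(1)] finZ cZ xyZ xy(4) by (simp add: card_insert_if)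
      ultimately show False using Z(2)[of ?Y] cZ by simp
    qed
    then have "card ?C \<le> card Z" using g finZ by (intro card_inj_on_le[of g]) auto
    then show False using cC cZ by simp
  qed
  have "card Z > 0" using large by linarith
  then obtain z where z: "z \<in> Z" by (metis card.empty all_not_in_conv less_irrefl)
  then obtain M where M: "M \<subseteq> edges U" "pair_matching M" "\<Union>M = U - {z}"
    using fc[of z] ZU(1) by auto
  define N where "N = {e \<in> M. e \<inter> Z = {}}"
  have NE: "N \<subseteq> edges (U - Z)"
  proof
    fix e assume e: "e \<in> N"
    then have "e \<in> edges U" using M(1) unfolding N_def by auto
    then obtain x y where "e = {x, y}" "x \<in> U" "y \<in> U" "E x y" unfolding edges_def by auto
    then show "e \<in> edges (U - Z)" using e unfolding N_def edges_def by blast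
  qed
  have pmN: "pair_matching N" by (rule pair_matching_subset[OF M(2)]) (auto simp: N_def)
  \<comment> \<open>As \<open>M\<close> misses \<open>z\<close>, at most \<open>|Z| - 1\<close> of
    its \<open>m\<close> edges meet \<open>Z\<close>, and \<open>m - (|Z| - 1) = k\<close>.\<close>
  have "k \<le> card N"
  proof -
    have finM: "finite M" using M(2) unfolding pair_matching_def by blast
    have "2 * card M = card (U - {z})" using pair_matching_card_Union[OF M(2)] M(3) by simp
    also have "\<dots> = 2 * m" using m z ZU fin by (simp add: subset_iff)
    finally have cM: "card M = m" by simp
    define h where "h e = (SOME x. x \<in> e \<inter> Z)" for e
    have h: "h e \<in> e \<inter> Z" if "e \<in> M - N" for e
    proof -
      have "\<exists>x. x \<in> e \<inter> Z" using that unfolding N_def by blast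
      then show ?thesis unfolding h_def by (rule someI_ex)
    qed
    have "inj_on h (M - N)"
    proof (rule inj_onI)
      fix e f assume "e \<in> M - N" "f \<in> M - N" "h e = h f"
      then show "e = f" using h[of e] h[of f] pair_matching_eqI[OF M(2), of e f "h e"] by auto
    qed
    moreover have "h ` (M - N) \<subseteq> Z - {z}"
    proof
      fix x assume "x \<in> h ` (M - N)"
      then obtain e where "e \<in> M - N" "x = h e" by blast
      then have "x \<in> \<Union>M" "x \<in> Z" using h by blast+
      then show "x \<in> Z - {z}" using M(3) by blast
    qed
    ultimately have "card (M - N) \<le> card (Z - {z})" using finZ by (intro card_inj_on_le) auto
    moreover have "card (M - N) = card M - card N"
      using finM unfolding N_def by (intro card_Diff_subset) auto
    ultimately show ?thesis using cM z finZ ks by simp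
  qed
  have "\<exists>S. packing (U - Z) S \<and> card S = k"
    by (rule gull_packing[OF _ cV degree biclique excl NE pmN \<open>k \<le> card N\<close>]) (use fin in auto)
  then obtain S where S: "packing (U - Z) S" "card S = k" by blast
  obtain B where "model U B" "card B = card S + card Z"
    using model_gulls_and_clique[OF S(1) ZU(2,1) fin(1)] by blast
  then show False using none S(2) ks by auto
qed

text \<open>The ratio is assumed for every subset so that the induction can pass to smaller vertex
  sets. The inequality compares a model with the number of colours that a matching provides.\<close>

lemma matching_model:
  assumes "finite U"
    and "\<And>W. W \<subseteq> U \<Longrightarrow> \<exists>Z\<subseteq>W. indep Z \<and> 33 * card W \<le> 124 * card Z"
  shows "\<exists>M B. M \<subseteq> edges U \<and> pair_matching M \<and> model U B \<and> card U \<le> card B + card M"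
  using assms
proof (induction U rule: finite_psubset_induct)
  case (psubset U)
  have IH: "\<exists>M B. M \<subseteq> edges W \<and> pair_matching M \<and> model W B \<and> card W \<le> card B + card M" if "W \<subset> U" for W
    using psubset.IH[OF that] psubset.prems that by (meson order_trans psubset_imp_subset)
  obtain M where M: "max_matching U M" using ex_max_matching[OF psubset.hyps] by blast
  have MM: "M \<subseteq> edges U" "pair_matching M" using M unfolding max_matching_def by auto
  consider "U = {}" | v where "v \<in> U" "\<And>N. max_matching U N \<Longrightarrow> v \<in> \<Union>N"
    | W where "W \<subseteq> U" "W \<noteq> {}" "W \<noteq> U" "\<And>x y. x \<in> W \<Longrightarrow> y \<in> U - W \<Longrightarrow> \<not> E x y"
    | "U \<noteq> {}" "\<And>v. v \<in> U \<Longrightarrow> \<exists>N. max_matching U N \<and> v \<notin> \<Union>N"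
        "\<And>W. W \<subseteq> U \<Longrightarrow> W \<noteq> {} \<Longrightarrow> W \<noteq> U \<Longrightarrow> \<exists>x\<in>W. \<exists>y\<in>U - W. E x y"
    by meson
  then show ?case
  proof cases
    case 1
    then show ?thesis using MM by (intro exI[of _ M] exI[of _ "{}"]) (auto simp: model_def)
  next
    \<comment> \<open>A maximum matching cannot avoid \<open>v\<close>, so restoring
      \<open>v\<close> gains one matching edge and the model need not grow.\<close>
    case (2 v)
    obtain N B where N: "N \<subseteq> edges (U - {v})" "pair_matching N" "model (U - {v}) B" "card (U - {v}) \<le> card B + card N"
      using IH[of "U - {v}"] 2(1) by blast
    have NU: "N \<subseteq> edges U" using N(1) edges_mono[of "U - {v}" U] by blast
    have "v \<notin> \<Union>N" using N(1) edge_subset by blast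
    then have "\<not> max_matching U N" using 2(2) by blast
    then have "card N < card M" using NU N(2) M unfolding max_matching_def by (meson leI order_trans)
    moreover have "card (U - {v}) = card U - 1" using 2(1) psubset.hyps by simp
    ultimately have "card U \<le> card B + card M" using N(4) by linarith
    then show ?thesis using MM model_mono[OF N(3), of U] by blast
  next
    \<comment> \<open>Without \<open>E\<close>-edges between them, \<open>W\<close> and
      \<open>U - W\<close> are completely joined in the graph; models as well as matchings can be
      united.\<close>
    case (3 W)
    obtain N1 B1 where N1: "N1 \<subseteq> edges W" "pair_matching N1" "model W B1" "card W \<le> card B1 + card N1"
      using IH[of W] 3 by blast
    obtain N2 B2 where N2: "N2 \<subseteq> edges (U - W)" "pair_matching N2" "model (U - W) B2" "card (U - W) \<le> card B2 + card N2"
      using IH[of "U - W"] 3 by blast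
    have sub: "\<Union>B1 \<subseteq> W" "\<Union>B2 \<subseteq> U - W" using N1(3) N2(3) unfolding model_def by auto
    have br: "B \<noteq> {}" if "B \<in> B1 \<or> B \<in> B2" for B
      using that N1(3) N2(3) branch_nonempty[of B] unfolding model_def by auto
    have touch: "\<exists>x\<in>B. \<exists>y\<in>B'. \<not> E x y" if BB: "B \<in> B1" "B' \<in> B2" for B B'
    proof -
      obtain x y where xy: "x \<in> B" "y \<in> B'" using br[of B] br[of B'] BB by auto
      then have "x \<in> W" "y \<in> U - W" using sub BB by auto
      then show ?thesis using 3(4) xy by blast
    qed
    have m12: "model U B1" "model U B2" using model_mono[OF N1(3)] model_mono[OF N2(3)] 3(1) by auto
    have dj: "\<Union>B1 \<inter> \<Union>B2 = {}" using sub by auto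
    note u = model_union[OF m12 dj touch]
    have e1: "e \<subseteq> W" if "e \<in> N1" for e using that N1(1) edge_subset by blast
    have e2: "e \<subseteq> U - W" if "e \<in> N2" for e using that N2(1) edge_subset by blast
    have c2: "card e = 2" if "e \<in> N1 \<union> N2" for e using that N1(2) N2(2) unfolding pair_matching_def by blast
    have N12: "N1 \<inter> N2 = {}"
    proof (rule ccontr)
      assume "N1 \<inter> N2 \<noteq> {}"
      then obtain e where "e \<in> N1" "e \<in> N2" by blast
      then have "e = {}" using e1[of e] e2[of e] by blast
      then show False using c2[of e] \<open>e \<in> N1\<close> by simp
    qed
    have "pair_matching (N1 \<union> N2)"
      unfolding pair_matching_def
    proof (intro conjI ballI)
      show "finite (N1 \<union> N2)" using N1(2) N2(2) unfolding pair_matching_def by simp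
      show "disjoint (N1 \<union> N2)"
      proof (rule pairwiseI)
        fix e f assume ef: "e \<in> N1 \<union> N2" "f \<in> N1 \<union> N2" "e \<noteq> f"
        then consider "e \<in> N1" "f \<in> N1" | "e \<in> N2" "f \<in> N2" | "e \<in> N1" "f \<in> N2" | "e \<in> N2" "f \<in> N1" by auto
        then show "disjnt e f"
        proof cases
          case 1 then show ?thesis using pair_matching_eqI[OF N1(2)] ef(3) unfolding disjnt_def by blast
        next
          case 2 then show ?thesis using pair_matching_eqI[OF N2(2)] ef(3) unfolding disjnt_def by blast
        next
          case 3 then show ?thesis using e1[of e] e2[of f] unfolding disjnt_def by blast
        next
          case 4 then show ?thesis using e1[of f] e2[of e] unfolding disjnt_def by blast
        qed
      qed
    qed (rule c2)
    moreover have "N1 \<union> N2 \<subseteq> edges U"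
      using N1(1) N2(1) edges_mono[of W U] edges_mono[of "U - W" U] 3(1) by blast
    moreover have "card (N1 \<union> N2) = card N1 + card N2"
      using N12 N1(2) N2(2) unfolding pair_matching_def by (simp add: card_Un_disjoint)
    moreover have "card (B1 \<union> B2) = card B1 + card B2"
      using u(2) model_finite[OF psubset.hyps m12(1)] model_finite[OF psubset.hyps m12(2)] by (simp add: card_Un_disjoint)
    moreover have "card U = card W + card (U - W)"
      using 3(1) psubset.hyps by (metis card_Diff_subset card_mono finite_subset le_add_diff_inverse)
    ultimately show ?thesis
      using u(1) N1(4) N2(4) by (intro exI[of _ "N1 \<union> N2"] exI[of _ "B1 \<union> B2"]) simp
  next
    case 4
    have fc: "\<exists>N. N \<subseteq> edges U \<and> pair_matching N \<and> \<Union>N = U - {v}" if "v \<in> U" for v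
      by (rule gallai[OF psubset.hyps 4(3,2) that]) blast+
    obtain v where v: "v \<in> U" using 4(1) by blast
    obtain N where N: "N \<subseteq> edges U" "pair_matching N" "\<Union>N = U - {v}" using fc[OF v] by blast
    have "card U = 2 * card N + 1"
      using pair_matching_card_Union[OF N(2)] N(3) v psubset.hyps by (metis Suc_eq_plus1 card_Suc_Diff1)
    moreover have "\<exists>Z\<subseteq>U. indep Z \<and> 33 * card U \<le> 124 * card Z" using psubset.prems by blast
    ultimately obtain B where "model U B" "card N + 1 \<le> card B"
      using factor_critical_model[OF psubset.hyps 4(1) fc] by blast
    then show ?thesis using N \<open>card U = _\<close> by (intro exI[of _ N] exI[of _ B]) simp
  qed
qed

end

section \<open>Inflations\<close>

text \<open>In the symmetrised induced digraph every vertex reaches the centre \<open>v\<close>, and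
  is reached from it, in at most one step.\<close>

lemma connected_induced_star:
  assumes "pair_graph G" and v: "v \<in> B" and adj: "\<And>u. u \<in> B \<Longrightarrow> u \<noteq> v \<Longrightarrow> (u, v) \<in> parcs G"
  shows "Digraph_Component.connected (with_proj G \<restriction> B)"
proof -
  interpret pair_graph G by fact
  let ?H = "mk_symmetric (with_proj G \<restriction> B)"
  have arc: "(u, v) \<in> parcs ?H" "(v, u) \<in> parcs ?H" if "u \<in> B" "u \<noteq> v" for u
    using adj[OF that] that v by (auto simp: parcs_mk_symmetric)
  have verts: "pverts ?H = B" by simp
  have "(u, v) \<in> rtrancl_on B (parcs ?H)" if "u \<in> B" for u
    using arc[of u] that v by (cases "u = v") (auto intro: rtrancl_on.intros)
  moreover have "(v, u) \<in> rtrancl_on B (parcs ?H)" if "u \<in> B" for u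
    using arc[of u] that v by (cases "u = v") (auto intro: rtrancl_on.intros)
  ultimately have "(u, w) \<in> rtrancl_on B (parcs ?H)" if "u \<in> B" "w \<in> B" for u w
    using that rtrancl_on_trans by metis
  then show ?thesis
    unfolding Digraph_Component.connected_def strongly_connected_def reachable_def
    using v verts by auto
qed

text \<open>Membership in the vertex set is part of the relation because
  \<open>triangle_free\<close> speaks about the whole type.\<close>

definition nonadjacent :: "'a pair_pre_digraph \<Rightarrow> 'a \<Rightarrow> 'a \<Rightarrow> bool" where
  "nonadjacent G x y \<longleftrightarrow> x \<in> pverts G \<and> y \<in> pverts G \<and> x \<noteq> y \<and> (x, y) \<notin> parcs G"

lemma triangle_free_nonadjacent:
  assumes "pair_graph G" "independence_number G = 2"
  shows "triangle_free (nonadjacent G)"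
proof
  interpret pair_graph G by fact
  show "\<And>x y. nonadjacent G x y \<Longrightarrow> nonadjacent G y x"
    unfolding nonadjacent_def using arcs_symmetric by blast
  show "\<And>x. \<not> nonadjacent G x x" unfolding nonadjacent_def by simp
  fix x y z assume xy: "nonadjacent G x y" "nonadjacent G y z"
  show "\<not> nonadjacent G x z"
  proof
    assume xz: "nonadjacent G x z"
    have sym: "(u, v) \<in> parcs G \<Longrightarrow> (v, u) \<in> parcs G" for u v using arcs_symmetric by blast
    have loop: "(u, u) \<notin> parcs G" for u using pair_no_loops by fastforce
    have "independent_vertices G {x, y, z}"
      unfolding independent_vertices_def using xy xz sym loop unfolding nonadjacent_def by blast
    moreover have "finite {card S | S. independent_vertices G S}"
      by (rule finite_subset[of _ "card ` Pow (pverts G)"])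
        (auto simp: independent_vertices_def pair_finite_verts)
    ultimately have "card {x, y, z} \<le> independence_number G"
      unfolding independence_number_def by (intro Max_ge) auto
    moreover have "card {x, y, z} = 3" using xy xz unfolding nonadjacent_def by auto
    ultimately show False using assms(2) by simp
  qed
qed

text \<open>The colour classes are the edges of \<open>M\<close>, whose ends are nonadjacent in
  \<open>G\<close>, and the remaining single vertices. \<open>c\<close> sends a vertex to its class
  and \<open>g\<close> numbers the classes.\<close>

lemma chromatic_number_le_matching:
  assumes "pair_graph G" "triangle_free (nonadjacent G)"
    and M: "M \<subseteq> triangle_free.edges (nonadjacent G) (pverts G)" "pair_matching M"
  shows "chromatic_number G + card M \<le> card (pverts G)"
proof -
  interpret pair_graph G by fact
  interpret triangle_free "nonadjacent G" by fact
  define c where "c v = (if v \<in> \<Union>M then (THE e. e \<in> M \<and> v \<in> e) else {v})" for v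
  have cM: "c v = e" if "e \<in> M" "v \<in> e" for e v
    using that pair_matching_eqI[OF M(2)] unfolding c_def by (auto intro!: the_equality)
  have cS: "c v = {v}" if "v \<notin> \<Union>M" for v using that unfolding c_def by simp
  have MV: "\<Union>M \<subseteq> pverts G" using M(1) edge_subset by blast
  have finM: "finite M" using M(2) unfolding pair_matching_def by blast
  have im: "c ` pverts G \<subseteq> M \<union> (\<lambda>v. {v}) ` (pverts G - \<Union>M)"
  proof
    fix K assume "K \<in> c ` pverts G"
    then obtain v where v: "v \<in> pverts G" "K = c v" by blast
    show "K \<in> M \<union> (\<lambda>v. {v}) ` (pverts G - \<Union>M)"
    proof (cases "v \<in> \<Union>M")
      case True
      then obtain e where "e \<in> M" "v \<in> e" by blast
      then show ?thesis using cM v by auto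
    next
      case False
      then show ?thesis using cS v by auto
    qed
  qed
  have "card (c ` pverts G) \<le> card (M \<union> (\<lambda>v. {v}) ` (pverts G - \<Union>M))"
    using im finM pair_finite_verts by (intro card_mono) auto
  also have "\<dots> \<le> card M + card ((\<lambda>v. {v}) ` (pverts G - \<Union>M))" by (rule card_Un_le)
  also have "card ((\<lambda>v. {v}) ` (pverts G - \<Union>M)) = card (pverts G - \<Union>M)"
    by (intro card_image) auto
  also have "\<dots> = card (pverts G) - 2 * card M"
    using pair_matching_card_Union[OF M(2)] MV pair_finite_verts
    by (simp add: card_Diff_subset finite_subset)
  finally have le: "card (c ` pverts G) \<le> card M + (card (pverts G) - 2 * card M)" .
  have "2 * card M \<le> card (pverts G)"
    using pair_matching_card_Union[OF M(2)] card_mono[OF pair_finite_verts MV] by simp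
  then have le': "card (c ` pverts G) + card M \<le> card (pverts G)" using le by linarith
  obtain g :: "'a set \<Rightarrow> nat" where g: "bij_betw g (c ` pverts G) {0..<card (c ` pverts G)}"
    using ex_bij_betw_finite_nat[of "c ` pverts G"] pair_finite_verts by blast
  have "proper_colouring G (card (c ` pverts G)) (g \<circ> c)"
    unfolding proper_colouring_def
  proof (intro conjI ballI)
    show "(g \<circ> c) ` pverts G \<subseteq> {..<card (c ` pverts G)}"
      using bij_betw_imp_surj_on[OF g] by auto
    fix a assume "a \<in> parcs G"
    moreover obtain u v where a: "a = (u, v)" by force
    ultimately have uv: "(u, v) \<in> parcs G" by simp
    have V: "u \<in> pverts G" "v \<in> pverts G" using uv in_arcsD1 in_arcsD2 by auto
    have "u \<noteq> v" using uv pair_no_loops by fastforce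
    have "c u \<noteq> c v"
    proof
      assume eq: "c u = c v"
      show False
      proof (cases "u \<in> \<Union>M")
        case True
        then obtain e where e: "e \<in> M" "u \<in> e" by blast
        then have "c v = e" using cM eq by simp
        have "v \<in> e"
        proof (cases "v \<in> \<Union>M")
          case True
          then obtain f where "f \<in> M" "v \<in> f" by blast
          then show ?thesis using cM[of f v] \<open>c v = e\<close> by simp
        next
          case False
          then show ?thesis using cS[of v] \<open>c v = e\<close> by auto
        qed
        have "e \<in> edges (pverts G)" using e M(1) by blast
        then obtain x y where "e = {x, y}" "nonadjacent G x y" unfolding edges_def by blast
        then have "nonadjacent G u v" using e(2) \<open>v \<in> e\<close> \<open>u \<noteq> v\<close> sym by auto
        then show False using uv unfolding nonadjacent_def by simp
      next
        case False
        then have "c v = {u}" using cS eq by simp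
        show False
        proof (cases "v \<in> \<Union>M")
          case True
          then obtain f where "f \<in> M" "v \<in> f" by blast
          then show False using cM[of f v] \<open>c v = {u}\<close> \<open>u \<noteq> v\<close> by auto
        next
          case False
          then show False using cS[of v] \<open>c v = {u}\<close> \<open>u \<noteq> v\<close> by simp
        qed
      qed
    qed
    then have "g (c u) \<noteq> g (c v)"
      using bij_betw_imp_inj_on[OF g] V by (auto dest: inj_onD)
    then show "case a of (u, v) \<Rightarrow> (g \<circ> c) u \<noteq> (g \<circ> c) v" using a by simp
  qed
  then have "chromatic_number G \<le> card (c ` pverts G)"
    unfolding chromatic_number_def by (intro Least_le) blast
  then show ?thesis using le' by linarith
qed

text \<open>An enumeration of the branch sets gives the minor. For \<open>Max\<close> to be
  meaningful the orders of complete minors must be bounded; disjoint nonempty branch sets bound them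
  by the number of vertices.\<close>

lemma hadwiger_number_ge_model:
  assumes "pair_graph G" "triangle_free (nonadjacent G)"
    and B: "triangle_free.model (nonadjacent G) (pverts G) B"
  shows "card B \<le> hadwiger_number G"
proof -
  interpret pair_graph G by fact
  interpret triangle_free "nonadjacent G" by fact
  have finB: "finite B" using model_finite[OF pair_finite_verts B] .
  have Bsub: "b \<subseteq> pverts G" if "b \<in> B" for b using B that unfolding model_def by blast
  have nonadj: "(x, y) \<in> parcs G" if "x \<in> pverts G" "y \<in> pverts G" "x \<noteq> y" "\<not> nonadjacent G x y" for x y
    using that unfolding nonadjacent_def by blast
  have conn: "Digraph_Component.connected (with_proj G \<restriction> b)" if b: "b \<in> B" for b
  proof -
    have "branch b" using B b unfolding model_def by blast
    \<comment> \<open>In a gull this is the middle vertex of the seagull, in the other shapes any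
      vertex.\<close>
    then obtain v where v: "v \<in> b" "\<And>u. u \<in> b \<Longrightarrow> u \<noteq> v \<Longrightarrow> \<not> nonadjacent G u v"
      unfolding branch_def gull_def by blast
    show ?thesis
      using v nonadj Bsub[OF b] by (intro connected_induced_star[OF assms(1) v(1)]) blast
  qed
  obtain h where h: "bij_betw h {0..<card B} B" using ex_bij_betw_nat_finite[OF finB] by blast
  define K :: "nat pair_pre_digraph" where
    "K = \<lparr> pverts = {0..<card B}, parcs = {(i, j). i \<in> {0..<card B} \<and> j \<in> {0..<card B} \<and> i \<noteq> j} \<rparr>"
  have K: "pverts K = {0..<card B}" "parcs K = {(i, j). i \<in> {0..<card B} \<and> j \<in> {0..<card B} \<and> i \<noteq> j}"
    unfolding K_def by simp_all
  have hB: "h i \<in> B" if "i \<in> {0..<card B}" for i using bij_betwE[OF h] that by blast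
  have hd: "h i \<noteq> h j" if "i \<in> {0..<card B}" "j \<in> {0..<card B}" "i \<noteq> j" for i j
    using inj_onD[OF bij_betw_imp_inj_on[OF h], of i j] that by blast
  have dj: "b \<inter> b' = {}" if "b \<in> B" "b' \<in> B" "b \<noteq> b'" for b b'
    using B that unfolding model_def pairwise_def disjnt_def by blast
  have "is_minor K G"
    unfolding is_minor_def
  proof (intro exI[of _ h] conjI ballI)
    fix i assume "i \<in> pverts K"
    then show "h i \<subseteq> pverts G" "Digraph_Component.connected (with_proj G \<restriction> h i)"
      using hB Bsub conn K by auto
  next
    show "disjoint_family_on h (pverts K)"
      unfolding disjoint_family_on_def using hB hd dj K by simp
  next
    fix a assume "a \<in> parcs K"
    then obtain i j where a: "a = (i, j)" and ij: "i \<in> {0..<card B}" "j \<in> {0..<card B}" "i \<noteq> j"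
      unfolding K by blast
    have "\<forall>b\<in>B. \<forall>b'\<in>B. b \<noteq> b' \<longrightarrow> (\<exists>x\<in>b. \<exists>y\<in>b'. \<not> nonadjacent G x y)"
      using B unfolding model_def by blast
    then have "\<exists>x\<in>h i. \<exists>y\<in>h j. \<not> nonadjacent G x y"
      using hB[OF ij(1)] hB[OF ij(2)] hd[OF ij] by simp
    then obtain x y where xy: "x \<in> h i" "y \<in> h j" "\<not> nonadjacent G x y" by blast
    have "x \<noteq> y" using xy dj[OF hB[OF ij(1)] hB[OF ij(2)] hd[OF ij]] by blast
    then have "(x, y) \<in> parcs G" using nonadj xy Bsub[OF hB[OF ij(1)]] Bsub[OF hB[OF ij(2)]] by blast
    then show "case a of (x, y) \<Rightarrow> \<exists>u\<in>h x. \<exists>v\<in>h y. (u, v) \<in> parcs G" using a xy by auto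
  qed
  moreover have "complete_digraph (card B) (with_proj K)"
    unfolding complete_digraph_pair_def K by auto
  ultimately have mem: "card B \<in> {t. \<exists>K :: nat pair_pre_digraph. complete_digraph t (with_proj K) \<and> is_minor K G}"
    by blast
  have "{t. \<exists>K :: nat pair_pre_digraph. complete_digraph t (with_proj K) \<and> is_minor K G} \<subseteq> {..card (pverts G)}"
  proof
    fix t assume "t \<in> {t. \<exists>K :: nat pair_pre_digraph. complete_digraph t (with_proj K) \<and> is_minor K G}"
    then obtain L :: "nat pair_pre_digraph" where L: "complete_digraph t (with_proj L)" "is_minor L G" by blast
    then obtain C where C: "\<And>x. x \<in> pverts L \<Longrightarrow> C x \<subseteq> pverts G"
      "\<And>x. x \<in> pverts L \<Longrightarrow> Digraph_Component.connected (with_proj G \<restriction> C x)" "disjoint_family_on C (pverts L)"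
      unfolding is_minor_def by blast
    have "C x \<noteq> {}" if "x \<in> pverts L" for x
      using C(2)[OF that] unfolding Digraph_Component.connected_def strongly_connected_def by auto
    then have "\<And>x. x \<in> pverts L \<Longrightarrow> \<exists>y. y \<in> C x" by blast
    then obtain f where f: "\<And>x. x \<in> pverts L \<Longrightarrow> f x \<in> C x" by metis
    have "inj_on f (pverts L)"
      using f C(3) unfolding disjoint_family_on_def inj_on_def by (metis IntI empty_iff)
    moreover have "f ` pverts L \<subseteq> pverts G" using f C(1) by blast
    ultimately have "card (pverts L) \<le> card (pverts G)"
      using pair_finite_verts card_inj_on_le by blast
    moreover have "card (pverts L) = t" using L(1) unfolding complete_digraph_pair_def by blast
    ultimately show "t \<in> {..card (pverts G)}" by simp
  qed
  then show ?thesis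
    unfolding hadwiger_number_def using mem by (intro Max_ge) (auto intro: finite_subset)
qed

text \<open>\<open>W\<close> induces an inflation with clique orders
  \<open>|C x \<inter> W|\<close>. Its copy on \<open>'a \<times> nat\<close> takes part in the
  infimum, and a maximum clique of the copy is carried back into \<open>W\<close>.\<close>

lemma inflation_clique_ratio:
  fixes G :: "'a pair_pre_digraph" and G' :: "'b pair_pre_digraph"
  assumes "pair_graph G" "is_inflation G G'" and q: "q \<le> inflated_clique_ratio G"
    and W: "W \<subseteq> pverts G'"
  shows "\<exists>Z\<subseteq>W. (\<forall>x\<in>Z. \<forall>y\<in>Z. \<not> nonadjacent G' x y) \<and> q * real (card W) \<le> real (card Z)"
proof (cases "W = {}")
  case True
  then show ?thesis by auto
next
  case False
  interpret pair_graph G by fact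
  obtain C where C: "\<forall>x\<in>pverts G. finite (C x)" "disjoint_family_on C (pverts G)"
    "pverts G' = (\<Union>x\<in>pverts G. C x)"
    "parcs G' = {(u, v). \<exists>x\<in>pverts G. \<exists>y\<in>pverts G. u \<in> C x \<and> v \<in> C y \<and>
                   (x = y \<and> u \<noteq> v \<or> x \<noteq> y \<and> (x, y) \<in> parcs G)}"
    using assms(2) unfolding is_inflation_def by blast
  define c where "c x = card (C x \<inter> W)" for x
  define I :: "('a \<times> nat) pair_pre_digraph" where "I = \<lparr> pverts = (SIGMA x:pverts G. {..<c x}),
      parcs = {((x, i), (y, j)). x \<in> pverts G \<and> y \<in> pverts G \<and> i < c x \<and> j < c y \<and>
                 (x = y \<and> i \<noteq> j \<or> x \<noteq> y \<and> (x, y) \<in> parcs G)} \<rparr>"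
  have I: "is_inflation G I" unfolding I_def by (rule inflation_exists)
  have vI: "pverts I = (SIGMA x:pverts G. {..<c x})" unfolding I_def by simp
  have finI: "finite (pverts I)" unfolding vI using pair_finite_verts by simp
  have finC: "finite (C x \<inter> W)" if "x \<in> pverts G" for x using C(1) that by blast
  have cW: "card (pverts I) = card W"
  proof -
    have "card (pverts I) = (\<Sum>x\<in>pverts G. c x)" unfolding vI using pair_finite_verts by simp
    also have "\<dots> = card (\<Union>x\<in>pverts G. C x \<inter> W)"
      unfolding c_def using pair_finite_verts finC C(2) unfolding disjoint_family_on_def
      by (intro card_UN_disjoint[symmetric]) auto
    also have "(\<Union>x\<in>pverts G. C x \<inter> W) = W" using W C(3) by blast
    finally show ?thesis .
  qed
  have finW: "finite W"
  proof -
    have "finite (pverts G')" using C(1,3) pair_finite_verts by simp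
    then show ?thesis using W finite_subset by blast
  qed
  then have pos: "card (pverts I) > 0" using cW False by (simp add: card_gt_0_iff)
  \<comment> \<open>The ratios are bounded below by \<open>0\<close>, so the infimum is at most the
    ratio of \<open>I\<close>.\<close>
  have "inflated_clique_ratio G \<le> real (clique_number I) / real (card (pverts I))"
    unfolding inflated_clique_ratio_def
    using I pos by (intro cInf_lower bdd_belowI[of _ 0]) auto
  then have ratio: "q * real (card W) \<le> real (clique_number I)"
  proof -
    assume "inflated_clique_ratio G \<le> real (clique_number I) / real (card (pverts I))"
    then have "q \<le> real (clique_number I) / real (card W)" using q cW by simp
    then show ?thesis using pos cW by (simp add: pos_le_divide_eq)
  qed
  have fin: "finite {card S | S. clique I S}"
    by (rule finite_subset[of _ "card ` Pow (pverts I)"]) (auto simp: clique_def finI)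
  have "clique I {}" unfolding clique_def by simp
  then have "clique_number I \<in> {card S | S. clique I S}"
    unfolding clique_number_def using fin by (intro Max_in) auto
  then obtain S where S: "clique I S" "card S = clique_number I" by auto
  have "\<exists>h. bij_betw h {..<c x} (C x \<inter> W)" if "x \<in> pverts G" for x
    using ex_bij_betw_nat_finite[OF finC[OF that]] unfolding c_def lessThan_atLeast0 .
  then obtain h where h: "\<And>x. x \<in> pverts G \<Longrightarrow> bij_betw (h x) {..<c x} (C x \<inter> W)" by metis
  define f where "f = (\<lambda>(x, i). h x i)"
  have f: "f (x, i) \<in> C x" "f (x, i) \<in> W" if "(x, i) \<in> pverts I" for x i
    using bij_betwE[OF h] that unfolding f_def vI by auto
  have SI: "S \<subseteq> pverts I" using S(1) unfolding clique_def by blast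
  have arc: "(f a, f b) \<in> parcs G' \<and> f a \<noteq> f b" if ab: "a \<in> S" "b \<in> S" "a \<noteq> b" for a b
  proof -
    obtain x i y j where xy: "a = (x, i)" "b = (y, j)" by (metis surj_pair)
    have v: "(x, i) \<in> pverts I" "(y, j) \<in> pverts I" using ab SI xy by auto
    have "(a, b) \<in> parcs I" using S(1) ab unfolding clique_def by blast
    then have e: "x = y \<and> i \<noteq> j \<or> x \<noteq> y \<and> (x, y) \<in> parcs G" unfolding I_def xy by auto
    have xV: "x \<in> pverts G" "y \<in> pverts G" "i < c x" "j < c y" using v unfolding vI by auto
    have ne: "f a \<noteq> f b"
    proof (cases "x = y")
      case True
      then show ?thesis
        using e bij_betw_imp_inj_on[OF h[OF xV(1)]] xV unfolding f_def xy by (auto dest: inj_onD)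
    next
      case False
      then have "C x \<inter> C y = {}" using C(2) xV unfolding disjoint_family_on_def by blast
      then show ?thesis using f[OF v(1)] f[OF v(2)] unfolding xy by auto
    qed
    have "(f a, f b) \<in> parcs G'"
      unfolding C(4) using e f(1)[OF v(1)] f(1)[OF v(2)] xV ne unfolding xy by blast
    then show ?thesis using ne by blast
  qed
  have "inj_on f S" by (rule inj_onI) (metis arc)
  then have "card (f ` S) = clique_number I" using card_image S(2) by metis
  moreover have "f ` S \<subseteq> W"
  proof
    fix y assume "y \<in> f ` S"
    then obtain x i where "(x, i) \<in> S" "y = f (x, i)" by auto
    then show "y \<in> W" using f(2) SI by blast
  qed
  moreover have "\<not> nonadjacent G' u v" if "u \<in> f ` S" "v \<in> f ` S" for u v
    using that arc unfolding nonadjacent_def by blast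
  ultimately show ?thesis using ratio by (intro exI[of _ "f ` S"]) auto
qed

theorem theorem2p29:
  fixes G :: "'a pair_pre_digraph" and G' :: "'b pair_pre_digraph"
  assumes "pair_graph G"
    and "independence_number G = 2"
    and "inflated_clique_ratio G \<ge> 1/4 + 1/62"
    and "is_inflation G G'"
    and "independence_number G' = 2"
  shows "hadwiger_number G' \<ge> chromatic_number G'"
proof -
  have G': "pair_graph G'" by (rule pair_graph_inflation[OF assms(1,4)])
  interpret pair_graph G' by (rule G')
  note tf = triangle_free_nonadjacent[OF G' assms(5)]
  interpret triangle_free "nonadjacent G'" by (rule tf)
  have "\<exists>Z\<subseteq>W. indep Z \<and> 33 * card W \<le> 124 * card Z" if W: "W \<subseteq> pverts G'" for W
  proof -
    obtain Z where "Z \<subseteq> W" "\<forall>x\<in>Z. \<forall>y\<in>Z. \<not> nonadjacent G' x y" "(1/4 + 1/62) * real (card W) \<le> real (card Z)"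
      using inflation_clique_ratio[OF assms(1,4,3) W] by blast
    \<comment> \<open>Clearing denominators in \<open>1/4 + 1/62 = 33/124\<close> gives the form
      over the naturals that \<open>matching_model\<close> expects.\<close>
    moreover from this have "33 * real (card W) \<le> 124 * real (card Z)" by simp
    then have "33 * card W \<le> 124 * card Z" by linarith
    ultimately show ?thesis unfolding indep_def by blast
  qed
  then obtain M B where MB: "M \<subseteq> edges (pverts G')" "pair_matching M" "model (pverts G') B"
    "card (pverts G') \<le> card B + card M"
    using matching_model[OF pair_finite_verts] by blast
  show ?thesis
    using chromatic_number_le_matching[OF G' tf MB(1,2)] hadwiger_number_ge_model[OF G' tf MB(3)] MB(4)
    by linarith
qed

end
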